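(* Let $G$ be a free group of finite rank $m\ge1$, $A$ a finite set with $|A|\ge2$, $\varphi:A^G\to\mathbb{R}$ a potential, and let $\nu$ be a shift-invariant Gibbs measure for $\varphi$. If the $f$-invariant of the shift action of $G$ on $(A^G,\nu)$ is nonpositive, then a phase transition occurs, i.e. there is more than one Gibbs measure for $\varphi$.
   Context: Shift action: $(gx)(h)=x(hg)$ for $x\in A^G$, $g,h\in G$. A potential is a function $\varphi:A^G\to\mathbb{R}$ for which there is a finite $D\subset G$ such that $\varphi(x)$ depends only on $x|_D$. For finite $\Lambda\subset G$ and $x\in A^G$ let $\pi_\Lambda(x)$ be the probability measure supported on the set of $y\in A^G$ agreeing with $x$ on $G\setminus\Lambda$, giving such $y$ mass proportional to $\exp(-\sum_{g:\,Dg\cap\Lambda\ne\varnothing}\varphi(gy))$; $\bar\pi_\Lambda(\mu)=\int\pi_\Lambda(x)\,d\mu(x)$. A Borel probability measure $\nu$ on $A^G$ is a Gibbs measure for $\varphi$ if $\bar\pi_\Lambda(\nu)=\nu$ for all finite $\Lambda\subset G$. For a partition $\beta$, $\beta^g=\{g^{-1}(B):B\in\beta\}$ and $\beta^F=\bigvee_{g\in F}\beta^g$ for $F\subset G$; $\beta$ is generating if $\beta^G$ is mod $0$ the algebra of all measurable sets. $H$ is Shannon entropy. $f$-invariant: let $s_1,\dots,s_m$ be free generators of $G$, $C_r$ the ball of radius $r$ about the identity in the word metric for $\{s_1^{\pm1},\dots,s_m^{\pm1}\}$, and $\beta$ a finite generating partition; then $h_f=\inf_{r}\{(1-2m)H(\beta^{C_r})+\sum_{i=1}^mH(\beta^{C_r}\vee(\beta^{C_r})^{s_i})\}$,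 which does not depend on $\beta$. *)

theory Defs
  imports
    "HOL-Algebra.Coset"
    "HOL-Library.Disjoint_Sets"
    "HOL-Probability.Probability"
begin

text \<open>The letter \<open>(i, True)\<close> stands for \<open>s i\<close> and \<open>(i, False)\<close> for its inverse.\<close>

definition words :: "nat \<Rightarrow> (nat \<times> bool) list set" where
  "words m = lists ({..<m} \<times> UNIV)"

definition reduced_words :: "nat \<Rightarrow> (nat \<times> bool) list set" where
  "reduced_words m =
     {w \<in> words m. successively (\<lambda>(i, b) (j, c). \<not> (i = j \<and> b \<noteq> c)) w}"

definition letter_val ::
    "('g, 'b) monoid_scheme \<Rightarrow> (nat \<Rightarrow> 'g) \<Rightarrow> nat \<times> bool \<Rightarrow> 'g" where
  "letter_val G s l = (if snd l then s (fst l) else inv\<^bsub>G\<^esub> (s (fst l)))"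

definition word_val ::
    "('g, 'b) monoid_scheme \<Rightarrow> (nat \<Rightarrow> 'g) \<Rightarrow> (nat \<times> bool) list \<Rightarrow> 'g" where
  "word_val G s w = foldr (\<lambda>l g. letter_val G s l \<otimes>\<^bsub>G\<^esub> g) w \<one>\<^bsub>G\<^esub>"

text \<open>
  The elements \<open>s 0, \<dots>, s (m - 1)\<close> freely generate the group \<open>G\<close>: every element of \<open>G\<close> is
  the value of exactly one reduced word.
\<close>

definition free_generators ::
    "('g, 'b) monoid_scheme \<Rightarrow> nat \<Rightarrow> (nat \<Rightarrow> 'g) \<Rightarrow> bool" where
  "free_generators G m s \<longleftrightarrow>
     s \<in> {..<m} \<rightarrow> carrier G \<and> bij_betw (word_val G s) (reduced_words m) (carrier G)"

definition word_ball ::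
    "('g, 'b) monoid_scheme \<Rightarrow> nat \<Rightarrow> (nat \<Rightarrow> 'g) \<Rightarrow> nat \<Rightarrow> 'g set" where
  "word_ball G m s r = word_val G s ` {w \<in> words m. length w \<le> r}"

text \<open>
  Configurations are extensional functions on \<open>carrier G\<close>. When \<open>G\<close> is countable and \<open>A\<close> is
  finite and discrete, the product sigma-algebra is the Borel sigma-algebra of the product
  topology on \<open>A\<^sup>G\<close>.
\<close>

definition config_space :: "('g, 'b) monoid_scheme \<Rightarrow> 'a set \<Rightarrow> ('g \<Rightarrow> 'a) measure" where
  "config_space G A = Pi\<^sub>M (carrier G) (\<lambda>_. count_space A)"

definition shift :: "('g, 'b) monoid_scheme \<Rightarrow> 'g \<Rightarrow> ('g \<Rightarrow> 'a) \<Rightarrow> ('g \<Rightarrow> 'a)" where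
  "shift G g x = (\<lambda>h\<in>carrier G. x (h \<otimes>\<^bsub>G\<^esub> g))"

definition borel_prob :: "('g, 'b) monoid_scheme \<Rightarrow> 'a set \<Rightarrow> ('g \<Rightarrow> 'a) measure \<Rightarrow> bool" where
  "borel_prob G A \<nu> \<longleftrightarrow> prob_space \<nu> \<and> sets \<nu> = sets (config_space G A)"

definition shift_invariant :: "('g, 'b) monoid_scheme \<Rightarrow> ('g \<Rightarrow> 'a) measure \<Rightarrow> bool" where
  "shift_invariant G \<nu> \<longleftrightarrow> (\<forall>g\<in>carrier G. distr \<nu> \<nu> (shift G g) = \<nu>)"

text \<open>
  The finite window \<open>D\<close> enters the specification \<open>\<pi>\<^sub>\<Lambda>\<close>, so it is kept as a parameter. The
  choice of \<open>D\<close> is immaterial: a term \<open>\<phi> (g y)\<close> that \<open>D\<close> includes but another window does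
  not is constant in \<open>y\<close> on \<open>agreeing G A \<Lambda> x\<close> and cancels in the normalisation.
\<close>

definition potential ::
    "('g, 'b) monoid_scheme \<Rightarrow> 'a set \<Rightarrow> 'g set \<Rightarrow> (('g \<Rightarrow> 'a) \<Rightarrow> real) \<Rightarrow> bool" where
  "potential G A D \<phi> \<longleftrightarrow> finite D \<and> D \<subseteq> carrier G \<and>
     (\<forall>x \<in> space (config_space G A). \<forall>y \<in> space (config_space G A).
        (\<forall>d\<in>D. x d = y d) \<longrightarrow> \<phi> x = \<phi> y)"

definition agreeing ::
    "('g, 'b) monoid_scheme \<Rightarrow> 'a set \<Rightarrow> 'g set \<Rightarrow> ('g \<Rightarrow> 'a) \<Rightarrow> ('g \<Rightarrow> 'a) set" where
  "agreeing G A \<Lambda> x =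
     {y \<in> space (config_space G A). \<forall>h \<in> carrier G - \<Lambda>. y h = x h}"

definition boltzmann ::
    "('g, 'b) monoid_scheme \<Rightarrow> 'g set \<Rightarrow> (('g \<Rightarrow> 'a) \<Rightarrow> real) \<Rightarrow> 'g set \<Rightarrow> ('g \<Rightarrow> 'a) \<Rightarrow> real" where
  "boltzmann G D \<phi> \<Lambda> y =
     exp (- (\<Sum>g | g \<in> carrier G \<and> (D #>\<^bsub>G\<^esub> g) \<inter> \<Lambda> \<noteq> {}. \<phi> (shift G g y)))"

definition gibbs_kernel ::
    "('g, 'b) monoid_scheme \<Rightarrow> 'a set \<Rightarrow> 'g set \<Rightarrow> (('g \<Rightarrow> 'a) \<Rightarrow> real) \<Rightarrow> 'g set \<Rightarrow>
     ('g \<Rightarrow> 'a) \<Rightarrow> ('g \<Rightarrow> 'a) measure" where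
  "gibbs_kernel G A D \<phi> \<Lambda> x =
     distr
       (point_measure (agreeing G A \<Lambda> x)
          (\<lambda>y. ennreal (boltzmann G D \<phi> \<Lambda> y / (\<Sum>z\<in>agreeing G A \<Lambda> x. boltzmann G D \<phi> \<Lambda> z))))
       (config_space G A) (\<lambda>y. y)"

definition gibbs_measure ::
    "('g, 'b) monoid_scheme \<Rightarrow> 'a set \<Rightarrow> 'g set \<Rightarrow> (('g \<Rightarrow> 'a) \<Rightarrow> real) \<Rightarrow>
     ('g \<Rightarrow> 'a) measure \<Rightarrow> bool" where
  "gibbs_measure G A D \<phi> \<nu> \<longleftrightarrow> borel_prob G A \<nu> \<and>
     (\<forall>\<Lambda>. finite \<Lambda> \<and> \<Lambda> \<subseteq> carrier G \<longrightarrow>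
        Giry_Monad.bind \<nu> (gibbs_kernel G A D \<phi> \<Lambda>) = \<nu>)"

definition finite_partition :: "'x measure \<Rightarrow> 'x set set \<Rightarrow> bool" where
  "finite_partition M \<beta> \<longleftrightarrow> finite \<beta> \<and> \<beta> \<subseteq> sets M \<and> partition_on (space M) \<beta>"

definition translate_partition ::
    "'x measure \<Rightarrow> ('g \<Rightarrow> 'x \<Rightarrow> 'x) \<Rightarrow> 'g \<Rightarrow> 'x set set \<Rightarrow> 'x set set" where
  "translate_partition M act g \<beta> = (\<lambda>B. act g -` B \<inter> space M) ` \<beta>"

definition iterated_partition ::
    "'x measure \<Rightarrow> ('g \<Rightarrow> 'x \<Rightarrow> 'x) \<Rightarrow> 'g set \<Rightarrow> 'x set set \<Rightarrow> 'x set set" where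
  "iterated_partition M act F \<beta> = common_refinement ((\<lambda>g. translate_partition M act g \<beta>) ` F)"

definition generating ::
    "('g, 'b) monoid_scheme \<Rightarrow> 'x measure \<Rightarrow> ('g \<Rightarrow> 'x \<Rightarrow> 'x) \<Rightarrow> 'x set set \<Rightarrow> bool" where
  "generating G M act \<beta> \<longleftrightarrow>
     (\<forall>B \<in> sets M.
        \<exists>B' \<in> sigma_sets (space M) (\<Union>g\<in>carrier G. translate_partition M act g \<beta>).
          (B - B') \<union> (B' - B) \<in> null_sets M)"

definition shannon_entropy :: "'x measure \<Rightarrow> 'x set set \<Rightarrow> real" where
  "shannon_entropy M P = - (\<Sum>B\<in>P. measure M B * ln (measure M B))"

text \<open>
  The infimum is taken in \<open>ereal\<close> because it may be \<open>-\<infinity>\<close>. For a finite generating partition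
  \<open>\<beta>\<close> its value is the f-invariant of the action, which does not depend on \<open>\<beta>\<close>.
\<close>

definition f_invariant ::
    "('g, 'b) monoid_scheme \<Rightarrow> nat \<Rightarrow> (nat \<Rightarrow> 'g) \<Rightarrow> 'x measure \<Rightarrow> ('g \<Rightarrow> 'x \<Rightarrow> 'x) \<Rightarrow>
     'x set set \<Rightarrow> ereal" where
  "f_invariant G m s M act \<beta> =
     (INF r. let P = iterated_partition M act (word_ball G m s r) \<beta> in
        ereal ((1 - 2 * real m) * shannon_entropy M P +
          (\<Sum>i<m. shannon_entropy M
             (common_refinement {P, translate_partition M act (s i) P}))))"

end

theory Submission
  imports Defs
begin

text \<open>
  The f-invariant is an annealed entropy. For a finite partition \<open>P\<close> the number
  \<open>F(P) = (1 - 2m) H(P) + \<Sum>i. H(P \<or> s\<^sub>i P)\<close> is an upper bound for the exponential growth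
  rate, relative to \<open>(n!)\<^sup>m\<close>, of the number of pairs consisting of \<open>m\<close> permutations of \<open>n\<close>
  points and a labelling of the points by atoms of \<open>P\<close> whose vertex and edge statistics are close to
  those of \<open>\<nu>\<close> (\<open>card_labelled_perm_tuples\<close>; the proof is the method of types). So \<open>F(P)\<close> is
  bounded below as soon as most tuples of permutations carry exponentially many such labellings.

  If \<open>\<nu>\<close> is the only Gibbs measure, finite-volume Gibbs states supply them. A tuple of permutations
  of a finite set \<open>V\<close> is an action of \<open>G\<close> on \<open>V\<close>; give \<open>x : V \<rightarrow> A\<close> the weight
  \<open>exp (- \<Sum>v. \<phi>(pull x v))\<close>, where \<open>pull x v\<close> is the configuration on \<open>G\<close> that \<open>x\<close> induces along
  the orbit map of \<open>v\<close>. For most tuples the orbit map of most points is injective on a prescribed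
  window (\<open>few_bad_vertices\<close>), and near such a point the conditional law of \<open>x\<close>, given its values
  outside, is exactly a Gibbs kernel (\<open>local_conditioning\<close>). Uniqueness and compactness make the
  kernels converge to \<open>\<nu>\<close> uniformly in the boundary condition (\<open>uniform_convergence_of_unique\<close>).
  Hence local observables at distant points are almost uncorrelated with means given by \<open>\<nu>\<close>, and by
  Chebyshev's inequality \<open>x\<close> is typical, with statistics close to those of \<open>\<nu>\<close>, with probability
  at least one half. Changing one letter changes the weight by a factor of at least some \<open>q > 0\<close>,
  so that no single \<open>x\<close> has probability above \<open>(1 + q) powr (- n)\<close>. Therefore at least
  \<open>(1 + q)\<^sup>n / 2\<close> configurations are typical (\<open>many_typical_configurations\<close>).

  It remains to pass from letters to labels by atoms of \<open>\<beta>\<close> translated over a ball. A local map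
  approximates \<open>\<beta>\<close>, and because \<open>\<beta>\<close> generates, the letters can be recovered from the labels up to a
  small proportion of the points. Since the number of points of a Hamming ball grows at a small
  exponential rate if its radius is a small multiple of \<open>n\<close> (\<open>small_hamming_balls\<close>), distinct typical \<open>x\<close> give almost as many distinct labellings, with a loss
  that does not depend on the ball. This yields \<open>F \<ge> ln (1 + q) / 2\<close> at every level of the infimum
  (\<open>level_entropy_lower_bound\<close>), so the f-invariant is positive.
\<close>

section \<open>Actions of the free group defined by random permutations\<close>

lemma real_card_filter: "finite S \<Longrightarrow> real (card {v\<in>S. P v}) = (\<Sum>v\<in>S. of_bool (P v))"
  by (simp add: of_bool_def sum.If_cases Int_def)

text \<open>
  The letters and words act on \<open>V\<close> from the left, as in \<open>word_val\<close>: the last letter is applied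
  first.
\<close>

definition perm_letter :: "(nat \<Rightarrow> 'v \<Rightarrow> 'v) \<Rightarrow> nat \<times> bool \<Rightarrow> 'v \<Rightarrow> 'v" where
  "perm_letter \<sigma> l = (if snd l then \<sigma> (fst l) else inv_into UNIV (\<sigma> (fst l)))"

definition perm_word :: "(nat \<Rightarrow> 'v \<Rightarrow> 'v) \<Rightarrow> (nat \<times> bool) list \<Rightarrow> 'v \<Rightarrow> 'v" where
  "perm_word \<sigma> w v = foldr (perm_letter \<sigma>) w v"

definition perm_tuples :: "nat \<Rightarrow> 'v set \<Rightarrow> (nat \<Rightarrow> 'v \<Rightarrow> 'v) set" where
  "perm_tuples m V = {..<m} \<rightarrow>\<^sub>E {p. p permutes V}"

lemma perm_word_simps [simp]:
  "perm_word \<sigma> [] v = v"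
  "perm_word \<sigma> (l # w) v = perm_letter \<sigma> l (perm_word \<sigma> w v)"
  "perm_word \<sigma> (u @ w) v = perm_word \<sigma> u (perm_word \<sigma> w v)"
  by (simp_all add: perm_word_def)

lemma perm_letter_permutes:
  assumes "\<sigma> \<in> perm_tuples m V" "fst l < m"
  shows "perm_letter \<sigma> l permutes V"
  using assms by (auto simp: perm_letter_def perm_tuples_def PiE_iff permutes_inv)

lemma perm_letter_inverse:
  assumes "\<sigma> \<in> perm_tuples m V" "i < m"
  shows "perm_letter \<sigma> (i, \<not> b) (perm_letter \<sigma> (i, b) v) = v"
proof -
  have "\<sigma> i permutes V" using assms by (auto simp: perm_tuples_def PiE_iff)
  then show ?thesis by (cases b) (auto simp: perm_letter_def permutes_inverses)
qed

lemma perm_word_permutes: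
  assumes "\<sigma> \<in> perm_tuples m V" "w \<in> words m"
  shows "perm_word \<sigma> w permutes V"
  using assms(2)
proof (induction w)
  case Nil
  then show ?case by (simp add: perm_word_def permutes_id[unfolded id_def] fun_eq_iff)
next
  case (Cons l w)
  then have "perm_letter \<sigma> l permutes V" "perm_word \<sigma> w permutes V"
    by (auto simp: words_def intro!: perm_letter_permutes[OF assms(1)])
  then show ?case
    using permutes_compose[of "perm_word \<sigma> w" V "perm_letter \<sigma> l"]
    by (simp add: o_def fun_eq_iff perm_word_def)
qed

lemma finite_perm_tuples: "finite V \<Longrightarrow> finite (perm_tuples m V)"
  unfolding perm_tuples_def by (intro finite_PiE) (auto simp: finite_permutations)

lemma card_perm_tuples: "finite V \<Longrightarrow> card (perm_tuples m V) = fact (card V) ^ m"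
  unfolding perm_tuples_def by (simp add: card_PiE card_permutations)

text \<open>
  The switching move: the arrow labelled \<open>l\<close> that ends in \<open>q\<close> is redirected to end in \<open>x\<close>, and the
  one that ended in \<open>x\<close> is redirected to \<open>q\<close>. It is an involution, which makes the switching
  argument below injective.
\<close>

definition reroute ::
    "(nat \<Rightarrow> 'v \<Rightarrow> 'v) \<Rightarrow> nat \<times> bool \<Rightarrow> 'v \<Rightarrow> 'v \<Rightarrow> nat \<Rightarrow> 'v \<Rightarrow> 'v" where
  "reroute \<sigma> l q x = \<sigma>(fst l :=
     (if snd l then Transposition.transpose q x \<circ> \<sigma> (fst l) else \<sigma> (fst l) \<circ> Transposition.transpose q x))"

lemma reroute_reroute: "reroute (reroute \<sigma> l q x) l q x = \<sigma>"
  by (auto simp: reroute_def fun_eq_iff)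

lemma reroute_in_perm_tuples:
  assumes "\<sigma> \<in> perm_tuples m V" "fst l < m" "q \<in> V" "x \<in> V"
  shows "reroute \<sigma> l q x \<in> perm_tuples m V"
proof -
  have "\<sigma> (fst l) permutes V" "Transposition.transpose q x permutes V"
    using assms by (auto simp: perm_tuples_def PiE_iff permutes_swap_id)
  then show ?thesis using assms(1,2)
    by (auto simp: perm_tuples_def reroute_def PiE_iff extensional_def intro!: permutes_compose)
qed

lemma perm_letter_reroute_same:
  assumes "\<sigma> \<in> perm_tuples m V" "fst l < m"
  shows "perm_letter (reroute \<sigma> l q x) l v = Transposition.transpose q x (perm_letter \<sigma> l v)"
proof -
  have "bij (\<sigma> (fst l))" using assms permutes_bij[of "\<sigma> (fst l)" V] by (auto simp: perm_tuples_def PiE_iff)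
  then show ?thesis by (auto simp: perm_letter_def reroute_def o_inv_distrib)
qed

lemma perm_letter_reroute_opposite:
  assumes "\<sigma> \<in> perm_tuples m V" "fst l < m"
  shows "perm_letter (reroute \<sigma> l q x) (fst l, \<not> snd l) v =
         perm_letter \<sigma> (fst l, \<not> snd l) (Transposition.transpose q x v)"
proof -
  have "bij (\<sigma> (fst l))" using assms permutes_bij[of "\<sigma> (fst l)" V] by (auto simp: perm_tuples_def PiE_iff)
  then show ?thesis by (auto simp: perm_letter_def reroute_def o_inv_distrib)
qed

lemma perm_letter_reroute_other:
  "fst l' \<noteq> fst l \<Longrightarrow> perm_letter (reroute \<sigma> l q x) l' v = perm_letter \<sigma> l' v"
  by (auto simp: perm_letter_def reroute_def)

text \<open>
  The points visited when \<open>w\<close> is applied to \<open>v\<close> letter by letter, indexed backwards: index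
  \<open>length w\<close> is the start \<open>v\<close> and index \<open>0\<close> the end.
\<close>

abbreviation trail :: "(nat \<Rightarrow> 'v \<Rightarrow> 'v) \<Rightarrow> (nat \<times> bool) list \<Rightarrow> 'v \<Rightarrow> nat \<Rightarrow> 'v" where
  "trail \<sigma> w v k \<equiv> perm_word \<sigma> (drop k w) v"

definition simple_trail :: "(nat \<Rightarrow> 'v \<Rightarrow> 'v) \<Rightarrow> (nat \<times> bool) list \<Rightarrow> 'v \<Rightarrow> bool" where
  "simple_trail \<sigma> w v \<longleftrightarrow> inj_on (trail \<sigma> w v) {..length w}"

lemma reduced_words_Cons:
  "l # w \<in> reduced_words m \<longleftrightarrow>
     fst l < m \<and> w \<in> reduced_words m \<and> (w = [] \<or> hd w \<noteq> (fst l, \<not> snd l))"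
  by (cases w; cases l) (auto simp: reduced_words_def words_def)

lemma reduced_words_words: "w \<in> reduced_words m \<Longrightarrow> w \<in> words m"
  by (auto simp: reduced_words_def)

lemma words_drop: "w \<in> words m \<Longrightarrow> drop k w \<in> words m"
  by (auto simp: words_def in_lists_conv_set dest: in_set_dropD)

text \<open>
  If the trail of \<open>w\<close> has no repetition, then, since \<open>l # w\<close> is reduced, the arrow used by the new
  letter \<open>l\<close> was not used before, in either direction. Redirecting that arrow to a point off the
  trail leaves the trail as it was.
\<close>

lemma trail_reroute:
  assumes \<sigma>: "\<sigma> \<in> perm_tuples m V" and w: "l # w \<in> reduced_words m"
    and simple: "simple_trail \<sigma> w v"
    and q: "perm_word \<sigma> (l # w) v = q"
    and x: "x \<notin> trail \<sigma> w v ` {..length w}" and k: "k \<le> length w"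
  shows "trail (reroute \<sigma> l q x) w v k = trail \<sigma> w v k"
  using k
proof (induction k rule: inc_induct)
  case base
  then show ?case by simp
next
  case (step k)
  let ?\<sigma>' = "reroute \<sigma> l q x"
  let ?p = "trail \<sigma> w v (Suc k)"
  have l: "fst l < m" and nth: "drop k w = w ! k # drop (Suc k) w"
    and wm: "w \<in> words m"
    using w step by (auto simp: Cons_nth_drop_Suc reduced_words_Cons dest: reduced_words_words)
  have lk: "fst (w ! k) < m"
    using wm step(2) by (auto simp: words_def in_lists_conv_set mem_Times_iff)
  have IH: "trail ?\<sigma>' w v (Suc k) = ?p" by (rule step)
  have x_off: "x \<noteq> trail \<sigma> w v j" if "j \<le> length w" for j
    using x that by auto
  have inj: "j = j'" if "trail \<sigma> w v j = trail \<sigma> w v j'" "j \<le> length w" "j' \<le> length w" for j j'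
    using simple that by (auto simp: simple_trail_def inj_on_def)
  consider "fst (w ! k) \<noteq> fst l" | "w ! k = l" | "w ! k = (fst l, \<not> snd l)"
    by (cases l; cases "w ! k") auto
  then have "perm_letter ?\<sigma>' (w ! k) ?p = perm_letter \<sigma> (w ! k) ?p"
  proof cases
    case 1
    then show ?thesis by (simp add: perm_letter_reroute_other)
  next
    case 2
    let ?t = "perm_letter \<sigma> l ?p"
    have t: "?t = trail \<sigma> w v k" using nth 2 by simp
    have "?t \<noteq> x" using x_off[of k] t step by auto
    moreover have "?t \<noteq> q"
    proof
      assume "?t = q"
      then have "perm_letter \<sigma> l ?p = perm_letter \<sigma> l (trail \<sigma> w v 0)" using q by simp
      then have "?p = trail \<sigma> w v 0"
        using permutes_inj[OF perm_letter_permutes[OF \<sigma> l]] by (auto simp: inj_def)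
      from inj[OF this] show False using step by simp
    qed
    ultimately show ?thesis
      using perm_letter_reroute_same[OF \<sigma> l, of q x ?p] 2 by (simp add: Transposition.transpose_def)
  next
    case 3
    have "?p \<noteq> x" using x_off[of "Suc k"] step by auto
    moreover have "?p \<noteq> q"
    proof
      assume "?p = q"
      then have "trail \<sigma> w v k = perm_letter \<sigma> (fst l, \<not> snd l) (perm_letter \<sigma> l (trail \<sigma> w v 0))"
        using nth 3 q by simp
      also have "\<dots> = trail \<sigma> w v 0"
        using perm_letter_inverse[OF \<sigma> l, of "snd l"] by simp
      finally have "k = 0" using inj step by simp
      then have "hd w = (fst l, \<not> snd l)" "w \<noteq> []" using 3 nth step by (auto simp: hd_conv_nth)
      then show False using w by (simp add: reduced_words_Cons)
    qed
    ultimately show ?thesis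
      using perm_letter_reroute_opposite[OF \<sigma> l, of q x ?p] 3 by (simp add: Transposition.transpose_def)
  qed
  then show ?case using nth IH by simp
qed

lemma trail_in:
  assumes "\<sigma> \<in> perm_tuples m V" "w \<in> words m" "v \<in> V"
  shows "trail \<sigma> w v k \<in> V"
  using permutes_in_image[OF perm_word_permutes[OF assms(1) words_drop[OF assms(2)]]] assms(3) by auto

text \<open>
  Switching argument. If the trail first closes at step \<open>l\<close>, the closing arrow can be redirected to
  any of the points off the trail; the new end is \<open>x\<close> and the old end is still the \<open>k\<close>-th point of
  the trail, so the original permutations can be recovered.
\<close>

lemma card_trail_closes:
  assumes V: "finite V" "v \<in> V" and w: "l # w \<in> reduced_words m" and k: "k \<le> length w"
  defines "S \<equiv> {\<sigma> \<in> perm_tuples m V. simple_trail \<sigma> w v \<and>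
                 perm_word \<sigma> (l # w) v = trail \<sigma> w v k}"
  shows "card S * (card V - (length w + 1)) \<le> card (perm_tuples m V)"
proof -
  let ?P = "\<lambda>\<sigma>. V - trail \<sigma> w v ` {..length w}"
  let ?f = "\<lambda>(\<sigma>, x). reroute \<sigma> l (trail \<sigma> w v k) x"
  have l: "fst l < m" and wm: "w \<in> words m"
    using w by (auto simp: reduced_words_Cons dest: reduced_words_words)
  have fin: "finite S" using finite_perm_tuples[OF V(1)] by (auto simp: S_def)
  have "card (?P \<sigma>) = card V - (length w + 1)" if "\<sigma> \<in> S" for \<sigma>
  proof -
    have "trail \<sigma> w v ` {..length w} \<subseteq> V" using that trail_in[OF _ wm V(2)] by (auto simp: S_def)
    moreover have "card (trail \<sigma> w v ` {..length w}) = length w + 1"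
      using that by (subst card_image) (auto simp: S_def simple_trail_def)
    ultimately show ?thesis by (subst card_Diff_subset) auto
  qed
  then have "card (SIGMA \<sigma>:S. ?P \<sigma>) = card S * (card V - (length w + 1))"
    using fin V(1) by simp
  moreover have "card (SIGMA \<sigma>:S. ?P \<sigma>) \<le> card (perm_tuples m V)"
  proof (rule card_inj_on_le)
    have facts: "trail (?f (\<sigma>, x)) w v k = trail \<sigma> w v k \<and> perm_word (?f (\<sigma>, x)) (l # w) v = x
        \<and> ?f (\<sigma>, x) \<in> perm_tuples m V"
      if "\<sigma> \<in> S" "x \<in> ?P \<sigma>" for \<sigma> x
    proof -
      have \<sigma>: "\<sigma> \<in> perm_tuples m V" "simple_trail \<sigma> w v" "perm_word \<sigma> (l # w) v = trail \<sigma> w v k"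
        using that by (auto simp: S_def)
      have eq: "trail (?f (\<sigma>, x)) w v j = trail \<sigma> w v j" if "j \<le> length w" for j
        using trail_reroute[OF \<sigma>(1) w \<sigma>(2,3) _ that] \<open>x \<in> ?P \<sigma>\<close> by simp
      from eq[of 0] have "perm_word (?f (\<sigma>, x)) (l # w) v
          = perm_letter (?f (\<sigma>, x)) l (trail \<sigma> w v 0)" by simp
      also have "\<dots> = x"
        using perm_letter_reroute_same[OF \<sigma>(1) l] \<sigma>(3) by simp
      finally show ?thesis
        using eq[OF k] reroute_in_perm_tuples[OF \<sigma>(1) l trail_in[OF \<sigma>(1) wm V(2)], of x k] that by auto
    qed
    show "inj_on ?f (SIGMA \<sigma>:S. ?P \<sigma>)"
    proof (rule inj_onI, clarify)
      fix \<sigma> x \<tau> y assume a: "\<sigma> \<in> S" "\<tau> \<in> S" "x \<in> V" "y \<in> V"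
        "x \<notin> trail \<sigma> w v ` {..length w}" "y \<notin> trail \<tau> w v ` {..length w}"
        and e: "reroute \<sigma> l (trail \<sigma> w v k) x = reroute \<tau> l (trail \<tau> w v k) y"
      have 1: "x = y" "trail \<sigma> w v k = trail \<tau> w v k"
        using facts[of \<sigma> x] facts[of \<tau> y] a e by auto
      have "\<sigma> = reroute (reroute \<sigma> l (trail \<sigma> w v k) x) l (trail \<sigma> w v k) x"
        by (simp add: reroute_reroute)
      also have "\<dots> = reroute (reroute \<tau> l (trail \<tau> w v k) y) l (trail \<tau> w v k) y"
        using e 1 by simp
      finally show "\<sigma> = \<tau> \<and> x = y" using 1 by (simp add: reroute_reroute)
    qed
    show "?f ` (SIGMA \<sigma>:S. ?P \<sigma>) \<subseteq> perm_tuples m V" using facts by blast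
  qed (use finite_perm_tuples[OF V(1)] in auto)
  ultimately show ?thesis by simp
qed

lemma card_not_simple_trail:
  assumes V: "finite V" "v \<in> V" and w: "w \<in> reduced_words m" and L: "length w \<le> L"
  shows "card {\<sigma> \<in> perm_tuples m V. \<not> simple_trail \<sigma> w v} * (card V - L)
           \<le> length w * L * card (perm_tuples m V)"
  using w L
proof (induction w)
  case Nil
  then show ?case by (simp add: simple_trail_def)
next
  case (Cons l w)
  let ?N = "\<lambda>w. {\<sigma> \<in> perm_tuples m V. \<not> simple_trail \<sigma> w v}"
  let ?S = "\<lambda>k. {\<sigma> \<in> perm_tuples m V. simple_trail \<sigma> w v \<and>
                 perm_word \<sigma> (l # w) v = trail \<sigma> w v k}"
  have fin: "finite (perm_tuples m V)" using V finite_perm_tuples by auto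
  have "?N (l # w) \<subseteq> ?N w \<union> (\<Union>k\<in>{..length w}. ?S k)"
  proof (rule subsetI, rule ccontr)
    fix \<sigma> assume \<sigma>: "\<sigma> \<in> ?N (l # w)" "\<sigma> \<notin> ?N w \<union> (\<Union>k\<in>{..length w}. ?S k)"
    from \<sigma> have s: "simple_trail \<sigma> w v" and ne: "\<And>k. k \<le> length w \<Longrightarrow> perm_word \<sigma> (l # w) v \<noteq> trail \<sigma> w v k"
      by auto
    have eq: "{..length (l # w)} = insert 0 (Suc ` {..length w})"
      by (simp add: atMost_Suc_eq_insert_0)
    have "inj_on (trail \<sigma> (l # w) v) (Suc ` {..length w})"
      using s unfolding simple_trail_def inj_on_def by simp
    moreover have "trail \<sigma> (l # w) v 0 \<notin> trail \<sigma> (l # w) v ` (Suc ` {..length w})"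
    proof
      assume "trail \<sigma> (l # w) v 0 \<in> trail \<sigma> (l # w) v ` (Suc ` {..length w})"
      then obtain k where "k \<le> length w" "trail \<sigma> (l # w) v 0 = trail \<sigma> w v k" by force
      with ne[of k] show False by simp
    qed
    ultimately have "simple_trail \<sigma> (l # w) v"
      unfolding simple_trail_def eq inj_on_insert by (metis Diff_empty Diff_insert0 image_iff nat.distinct(1))
    with \<sigma> show False by simp
  qed
  then have "card (?N (l # w)) \<le> card (?N w \<union> (\<Union>k\<in>{..length w}. ?S k))"
    by (intro card_mono) (use fin in auto)
  also have "\<dots> \<le> card (?N w) + card (\<Union>k\<in>{..length w}. ?S k)"
    by (rule card_Un_le)
  also have "card (\<Union>k\<in>{..length w}. ?S k) \<le> (\<Sum>k\<le>length w. card (?S k))"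
    by (rule card_UN_le) auto
  finally have "card (?N (l # w)) \<le> card (?N w) + (\<Sum>k\<le>length w. card (?S k))" by simp
  from mult_le_mono1[OF this, of "card V - L"]
  have "card (?N (l # w)) * (card V - L) \<le>
      card (?N w) * (card V - L) + (\<Sum>k\<le>length w. card (?S k) * (card V - L))"
    by (simp only: add_mult_distrib sum_distrib_right)
  also have "(\<Sum>k\<le>length w. card (?S k) * (card V - L)) \<le> (\<Sum>k\<le>length w. card (perm_tuples m V))"
  proof (rule sum_mono)
    fix k assume k: "k \<in> {..length w}"
    have "card (?S k) * (card V - L) \<le> card (?S k) * (card V - (length w + 1))"
      using Cons by (intro mult_le_mono2) auto
    also have "\<dots> \<le> card (perm_tuples m V)"
      using card_trail_closes[OF V Cons(2), of k] k by auto
    finally show "card (?S k) * (card V - L) \<le> card (perm_tuples m V)" .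
  qed
  also have "\<dots> \<le> L * card (perm_tuples m V)"
    using mult_le_mono1[of "Suc (length w)" L "card (perm_tuples m V)"] Cons(3) by simp
  also have "card (?N w) * (card V - L) \<le> length w * L * card (perm_tuples m V)"
    using Cons by (auto simp: reduced_words_Cons)
  finally show ?case by (simp add: algebra_simps)
qed

text \<open>
  A nonempty reduced word fixes a given point with probability \<open>O(1/n)\<close>: a trail that returns to
  its starting point has a first repetition.
\<close>

lemma card_fixed_point:
  assumes V: "finite V" "v \<in> V" and w: "w \<in> reduced_words m" "w \<noteq> []"
  shows "card {\<sigma> \<in> perm_tuples m V. perm_word \<sigma> w v = v} * (card V - length w)
           \<le> (length w)\<^sup>2 * card (perm_tuples m V)"
proof -
  have "{\<sigma> \<in> perm_tuples m V. perm_word \<sigma> w v = v} \<subseteq> {\<sigma> \<in> perm_tuples m V. \<not> simple_trail \<sigma> w v}"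
  proof clarify
    fix \<sigma> assume "perm_word \<sigma> w v = v" "simple_trail \<sigma> w v"
    then have "(0::nat) = length w" unfolding simple_trail_def
      by (elim inj_onD) auto
    with w show False by simp
  qed
  then have "card {\<sigma> \<in> perm_tuples m V. perm_word \<sigma> w v = v}
      \<le> card {\<sigma> \<in> perm_tuples m V. \<not> simple_trail \<sigma> w v}"
    by (intro card_mono) (use finite_perm_tuples[OF V(1)] in auto)
  then have "card {\<sigma> \<in> perm_tuples m V. perm_word \<sigma> w v = v} * (card V - length w) \<le>
    card {\<sigma> \<in> perm_tuples m V. \<not> simple_trail \<sigma> w v} * (card V - length w)" by simp
  also have "\<dots> \<le> length w * length w * card (perm_tuples m V)"
    using card_not_simple_trail[OF V w(1) order_refl] .
  finally show ?thesis by (simp add: power2_eq_square)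
qed

locale free_group = group G for G (structure) +
  fixes m :: nat and s :: "nat \<Rightarrow> 'a"
  assumes free: "free_generators G m s"
begin

lemma gen_closed: "i < m \<Longrightarrow> s i \<in> carrier G"
  using free by (auto simp: free_generators_def)

lemma letter_val_closed: "fst l < m \<Longrightarrow> letter_val G s l \<in> carrier G"
  using gen_closed by (auto simp: letter_val_def)

lemma word_val_Nil [simp]: "word_val G s [] = \<one>"
  by (simp add: word_val_def)

lemma word_val_Cons [simp]: "word_val G s (l # w) = letter_val G s l \<otimes> word_val G s w"
  by (simp add: word_val_def)

lemma word_val_closed: "w \<in> words m \<Longrightarrow> word_val G s w \<in> carrier G"
  by (induction w) (auto simp: words_def letter_val_closed)

lemma word_val_append:
  "u \<in> words m \<Longrightarrow> w \<in> words m \<Longrightarrow> word_val G s (u @ w) = word_val G s u \<otimes> word_val G s w"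
proof (induction u)
  case Nil
  then show ?case by (simp add: word_val_closed)
next
  case (Cons l u)
  then have "fst l < m" "u \<in> words m" by (auto simp: words_def)
  then show ?case using Cons
    by (simp add: m_assoc letter_val_closed word_val_closed)
qed

definition word_of :: "'a \<Rightarrow> (nat \<times> bool) list" where
  "word_of = inv_into (reduced_words m) (word_val G s)"

lemma word_of:
  assumes "g \<in> carrier G"
  shows "word_of g \<in> reduced_words m" "word_val G s (word_of g) = g"
proof -
  have "g \<in> word_val G s ` reduced_words m"
    using free assms by (auto simp: free_generators_def bij_betw_def)
  then show "word_of g \<in> reduced_words m" "word_val G s (word_of g) = g"
    unfolding word_of_def by (auto intro: inv_into_into f_inv_into_f)
qed

lemma word_of_word_val: "w \<in> reduced_words m \<Longrightarrow> word_of (word_val G s w) = w"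
  using free by (auto simp: free_generators_def bij_betw_def word_of_def)

definition act :: "(nat \<Rightarrow> 'v \<Rightarrow> 'v) \<Rightarrow> 'a \<Rightarrow> 'v \<Rightarrow> 'v" where
  "act \<sigma> g = perm_word \<sigma> (word_of g)"

text \<open>
  Free cancellation changes neither the value in \<open>G\<close> nor the action on \<open>V\<close>. As reduced words
  represent elements uniquely, the action of a word depends only on its value, so that \<open>act\<close> is an
  action of \<open>G\<close>.
\<close>

lemma ex_reduced_word:
  assumes "\<sigma> \<in> perm_tuples m V" "w \<in> words m"
  shows "\<exists>u\<in>reduced_words m. word_val G s u = word_val G s w \<and> perm_word \<sigma> u = perm_word \<sigma> w"
  using assms(2)
proof (induction w)
  case Nil
  then show ?case by (intro bexI[of _ "[]"]) (auto simp: reduced_words_def)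
next
  case (Cons l w)
  then obtain u where u: "u \<in> reduced_words m" "word_val G s u = word_val G s w"
    "perm_word \<sigma> u = perm_word \<sigma> w" and l: "fst l < m"
    by (auto simp: words_def)
  show ?case
  proof (cases "u = [] \<or> hd u \<noteq> (fst l, \<not> snd l)")
    case True
    then have "l # u \<in> reduced_words m" using u l by (simp add: reduced_words_Cons)
    then show ?thesis using u by (intro bexI[of _ "l # u"]) (auto simp: fun_eq_iff)
  next
    case False
    then obtain u' where u': "u = (fst l, \<not> snd l) # u'" by (cases u) auto
    have red: "u' \<in> reduced_words m" using u u' by (simp add: reduced_words_Cons)
    have "perm_word \<sigma> u' v = perm_letter \<sigma> l (perm_word \<sigma> u v)" for v
      using perm_letter_inverse[OF assms(1) l, of "\<not> snd l"] u' by simp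
    moreover have "letter_val G s l \<otimes> letter_val G s (fst l, \<not> snd l) = \<one>"
      using gen_closed[OF l] by (auto simp: letter_val_def)
    then have "letter_val G s l \<otimes> word_val G s u = word_val G s u'"
      using word_val_closed[OF reduced_words_words[OF red]] letter_val_closed[OF l]
        letter_val_closed[of "(fst l, \<not> snd l)"] l u'
      by (simp add: m_assoc[symmetric])
    ultimately show ?thesis using u red by (intro bexI[of _ u']) (auto simp: fun_eq_iff)
  qed
qed

lemma act_word_val:
  assumes "\<sigma> \<in> perm_tuples m V" "w \<in> words m"
  shows "act \<sigma> (word_val G s w) = perm_word \<sigma> w"
  using ex_reduced_word[OF assms] word_of_word_val unfolding act_def by metis

lemma act_one: "\<sigma> \<in> perm_tuples m V \<Longrightarrow> act \<sigma> \<one> v = v"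
  using act_word_val[of \<sigma> V "[]"] by (simp add: words_def)

lemma act_mult:
  assumes "\<sigma> \<in> perm_tuples m V" "g \<in> carrier G" "h \<in> carrier G"
  shows "act \<sigma> (g \<otimes> h) v = act \<sigma> g (act \<sigma> h v)"
proof -
  have w: "word_of g \<in> words m" "word_of h \<in> words m"
    using word_of assms by (auto dest: reduced_words_words)
  then have "act \<sigma> (word_val G s (word_of g @ word_of h)) v = perm_word \<sigma> (word_of g @ word_of h) v"
    by (intro fun_cong[OF act_word_val[OF assms(1)]]) (auto simp: words_def)
  then show ?thesis using w assms by (simp add: word_val_append word_of act_def)
qed

lemma act_gen:
  assumes "\<sigma> \<in> perm_tuples m V" "i < m"
  shows "act \<sigma> (s i) v = \<sigma> i v"
  using act_word_val[OF assms(1), of "[(i, True)]"] assms gen_closed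
  by (simp add: words_def letter_val_def perm_letter_def)

lemma act_in: "\<sigma> \<in> perm_tuples m V \<Longrightarrow> g \<in> carrier G \<Longrightarrow> v \<in> V \<Longrightarrow> act \<sigma> g v \<in> V"
  unfolding act_def
  by (subst permutes_in_image[OF perm_word_permutes[OF _ reduced_words_words[OF word_of(1)]]])

lemma card_act_fixes:
  assumes "finite V" "v \<in> V" "g \<in> carrier G" "g \<noteq> \<one>"
  shows "card {\<sigma> \<in> perm_tuples m V. act \<sigma> g v = v} * (card V - length (word_of g))
           \<le> (length (word_of g))\<^sup>2 * card (perm_tuples m V)"
proof -
  have "word_of g \<noteq> []" using word_of[OF assms(3)] assms(4) by auto
  then show ?thesis unfolding act_def
    using card_fixed_point[OF assms(1,2) word_of(1)[OF assms(3)]] by simp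
qed

text \<open>
  Two elements of \<open>K\<close> that agree at \<open>v\<close> give a fixed point of a nontrivial element of \<open>G\<close>. The
  expected number of such \<open>v\<close> is bounded independently of \<open>n\<close>, and Markov's inequality applies.
\<close>

lemma few_bad_vertices:
  assumes K: "finite K" "K \<subseteq> carrier G" and \<theta>: "0 < \<theta>"
  shows "\<exists>n0. \<forall>n\<ge>n0.
    fact n ^ m \<le> 2 * card {\<sigma> \<in> perm_tuples m {..<n::nat}.
       card {v\<in>{..<n}. \<not> inj_on (\<lambda>g. act \<sigma> g v) K} \<le> \<theta> * real n}"
proof -
  define Q where "Q = {inv g \<otimes> h |g h. g \<in> K \<and> h \<in> K \<and> g \<noteq> h}"
  have finQ: "finite Q"
    by (rule finite_subset[of _ "(\<lambda>(g,h). inv g \<otimes> h) ` (K \<times> K)"]) (use K in \<open>auto simp: Q_def\<close>)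
  have Q: "q \<in> carrier G" "q \<noteq> \<one>" if "q \<in> Q" for q
  proof -
    obtain g h where gh: "q = inv g \<otimes> h" "g \<in> carrier G" "h \<in> carrier G" "g \<noteq> h"
      using \<open>q \<in> Q\<close> K unfolding Q_def by blast
    then show "q \<in> carrier G" by simp
    show "q \<noteq> \<one>"
    proof
      assume "q = \<one>"
      then have "g \<otimes> (inv g \<otimes> h) = g" using gh by simp
      then show False using gh by (simp add: m_assoc[symmetric])
    qed
  qed
  define L where "L = Max (insert 0 ((\<lambda>q. length (word_of q)) ` Q))"
  have L: "length (word_of q) \<le> L" if "q \<in> Q" for q
    using that finQ by (auto simp: L_def intro!: Max_ge)
  define C where "C = real (card Q * L\<^sup>2)"
  obtain n0 :: nat where n0: "real n0 > L + 2 * C / \<theta>" using reals_Archimedean2 by blast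
  show ?thesis
  proof (intro exI[of _ n0] allI impI)
    fix n :: nat assume n: "n \<ge> n0"
    let ?P = "perm_tuples m {..<n}"
    let ?bad = "\<lambda>\<sigma>. {v\<in>{..<n}. \<not> inj_on (\<lambda>g. act \<sigma> g v) K}"
    let ?G = "{\<sigma> \<in> ?P. card (?bad \<sigma>) \<le> \<theta> * real n}"
    have fin: "finite ?P" by (rule finite_perm_tuples) simp
    have C0: "C \<ge> 0" by (simp add: C_def)
    then have nL: "real n - L > 2 * C / \<theta>" "real n > L"
    proof -
      have "real n0 \<le> real n" "0 \<le> 2 * C / \<theta>" using n C0 \<theta> by auto
      then show "real n - L > 2 * C / \<theta>" "real n > L" using n0 by linarith+
    qed
    have bad_sub: "?bad \<sigma> \<subseteq> (\<Union>q\<in>Q. {v\<in>{..<n}. act \<sigma> q v = v})" if "\<sigma> \<in> ?P" for \<sigma>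
    proof clarify
      fix v assume v: "v < n" "\<not> inj_on (\<lambda>g. act \<sigma> g v) K"
      then obtain g h where gh: "g \<in> K" "h \<in> K" "g \<noteq> h" "act \<sigma> g v = act \<sigma> h v"
        by (auto simp: inj_on_def)
      have gc: "g \<in> carrier G" "h \<in> carrier G" using gh K by auto
      have "act \<sigma> (inv g \<otimes> h) v = act \<sigma> (inv g) (act \<sigma> g v)"
        using gc gh act_mult[OF that] by simp
      also have "\<dots> = act \<sigma> (inv g \<otimes> g) v" using gc by (subst act_mult[OF that]) auto
      finally have "act \<sigma> (inv g \<otimes> h) v = v" using gc act_one[OF that] by simp
      moreover have "inv g \<otimes> h \<in> Q" using gh by (auto simp: Q_def)
      ultimately show "v \<in> (\<Union>q\<in>Q. {v\<in>{..<n}. act \<sigma> q v = v})" using v by auto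
    qed
    have "(\<Sum>\<sigma>\<in>?P. real (card (?bad \<sigma>))) \<le> (\<Sum>\<sigma>\<in>?P. \<Sum>q\<in>Q. real (card {v\<in>{..<n}. act \<sigma> q v = v}))"
    proof (rule sum_mono)
      fix \<sigma> assume "\<sigma> \<in> ?P"
      have "card (?bad \<sigma>) \<le> card (\<Union>q\<in>Q. {v\<in>{..<n}. act \<sigma> q v = v})"
        by (intro card_mono bad_sub) (use finQ \<open>\<sigma> \<in> ?P\<close> in auto)
      also have "\<dots> \<le> (\<Sum>q\<in>Q. card {v\<in>{..<n}. act \<sigma> q v = v})" by (rule card_UN_le[OF finQ])
      finally have "real (card (?bad \<sigma>)) \<le> real (\<Sum>q\<in>Q. card {v\<in>{..<n}. act \<sigma> q v = v})"
        by (rule of_nat_mono)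
      then show "real (card (?bad \<sigma>)) \<le> (\<Sum>q\<in>Q. real (card {v\<in>{..<n}. act \<sigma> q v = v}))"
        by (simp only: of_nat_sum)
    qed
    also have "\<dots> = (\<Sum>q\<in>Q. \<Sum>\<sigma>\<in>?P. \<Sum>v\<in>{..<n}. of_bool (act \<sigma> q v = v))"
      by (subst sum.swap) (simp only: real_card_filter[OF finite_lessThan])
    also have "\<dots> = (\<Sum>q\<in>Q. \<Sum>v\<in>{..<n}. \<Sum>\<sigma>\<in>?P. of_bool (act \<sigma> q v = v))"
      by (intro sum.cong refl) (rule sum.swap)
    also have "\<dots> = (\<Sum>q\<in>Q. \<Sum>v\<in>{..<n}. real (card {\<sigma>\<in>?P. act \<sigma> q v = v}))"
      by (simp only: real_card_filter[OF fin])
    also have "\<dots> \<le> (\<Sum>q\<in>Q. \<Sum>v\<in>{..<n}. L\<^sup>2 * card ?P / (real n - L))"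
    proof (intro sum_mono)
      fix q v assume q: "q \<in> Q" and v: "v \<in> {..<n}"
      let ?c = "card {\<sigma> \<in> ?P. act \<sigma> q v = v}"
      have "?c * (n - L) \<le> ?c * (n - length (word_of q))" using L[OF q] by (intro mult_le_mono2) auto
      also have "\<dots> \<le> (length (word_of q))\<^sup>2 * card ?P"
        using card_act_fixes[of "{..<n}" v q] Q[OF q] v by simp
      also have "\<dots> \<le> L\<^sup>2 * card ?P" using L[OF q] by (intro mult_le_mono1 power_mono) auto
      finally have "real (?c * (n - L)) \<le> real (L\<^sup>2 * card ?P)" by (rule of_nat_mono)
      then have "real ?c * (real n - L) \<le> L\<^sup>2 * card ?P" using nL by (simp add: of_nat_diff)
      then show "real ?c \<le> L\<^sup>2 * card ?P / (real n - L)" using nL by (simp add: field_simps)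
    qed
    also have "\<dots> = C * n * card ?P / (real n - L)" by (simp add: C_def)
    finally have 1: "(\<Sum>\<sigma>\<in>?P. real (card (?bad \<sigma>))) \<le> C * n * card ?P / (real n - L)" .
    have npos: "n > 0" using nL by linarith
    have "real (card (?P - ?G)) * (\<theta> * n) = (\<Sum>\<sigma>\<in>?P - ?G. \<theta> * n)" by simp
    also have "\<dots> \<le> (\<Sum>\<sigma>\<in>?P - ?G. real (card (?bad \<sigma>)))" by (intro sum_mono) auto
    also have "\<dots> \<le> (\<Sum>\<sigma>\<in>?P. real (card (?bad \<sigma>)))" by (intro sum_mono2) (use fin in auto)
    finally have "real (card (?P - ?G)) * (\<theta> * n) \<le> C * n * card ?P / (real n - L)" using 1 by simp
    then have "real (card (?P - ?G)) * (\<theta> * n) * (real n - L) \<le> C * n * card ?P"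
      using nL(2) by (simp only: pos_le_divide_eq diff_gt_0_iff_gt)
    then have "real n * (real (card (?P - ?G)) * \<theta> * (real n - L)) \<le> real n * (C * card ?P)"
      by (simp only: ac_simps)
    then have "real (card (?P - ?G)) * \<theta> * (real n - L) \<le> C * card ?P"
      using npos by (simp only: mult_le_cancel_left_pos of_nat_0_less_iff)
    moreover have "2 * C \<le> \<theta> * (real n - L)" using nL(1) \<theta> by (simp add: field_simps)
    then have "real (card ?P) * (2 * C) \<le> real (card ?P) * (\<theta> * (real n - L))"
      by (intro mult_left_mono) auto
    ultimately have "2 * (real (card (?P - ?G)) * (\<theta> * (real n - L))) \<le> real (card ?P) * (\<theta> * (real n - L))"
      by (simp add: algebra_simps)
    then have "2 * real (card (?P - ?G)) \<le> real (card ?P)"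
      using \<theta> nL by (simp add: mult.assoc[symmetric] mult_le_cancel_right)
    moreover have "card (?P - ?G) = card ?P - card ?G" by (intro card_Diff_subset) (use fin in auto)
    moreover have "card ?G \<le> card ?P" by (intro card_mono) (use fin in auto)
    ultimately have "card ?P \<le> 2 * card ?G" by linarith
    then show "fact n ^ m \<le> 2 * card ?G" using card_perm_tuples[of "{..<n}" m] by simp
  qed
qed

end

section \<open>Counting labellings and permutations by their statistics\<close>

definition shannon :: "'l set \<Rightarrow> ('l \<Rightarrow> real) \<Rightarrow> real" where
  "shannon L p = - (\<Sum>a\<in>L. p a * ln (p a))"

definition near_type :: "'v set \<Rightarrow> 'l set \<Rightarrow> ('l \<Rightarrow> real) \<Rightarrow> real \<Rightarrow> ('v \<Rightarrow> 'l) \<Rightarrow> bool" where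
  "near_type V L p \<epsilon> y \<longleftrightarrow>
     (\<forall>a\<in>L. \<bar>real (card {v\<in>V. y v = a}) - real (card V) * p a\<bar> \<le> \<epsilon> * real (card V))"

lemma sum_by_value:
  fixes f :: "'l \<Rightarrow> real"
  assumes "finite V" "finite L" "y ` V \<subseteq> L"
  shows "(\<Sum>v\<in>V. f (y v)) = (\<Sum>a\<in>L. real (card {v\<in>V. y v = a}) * f a)"
proof -
  have "(\<Sum>v\<in>V. f (y v)) = (\<Sum>a\<in>L. \<Sum>v\<in>{v\<in>V. y v = a}. f (y v))"
    by (rule sum.group[OF assms, symmetric])
  also have "\<dots> = (\<Sum>a\<in>L. \<Sum>v\<in>{v\<in>V. y v = a}. f a)"
    by (intro sum.cong refl) auto
  finally show ?thesis by simp
qed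

lemma near_type_sum:
  fixes f :: "'l \<Rightarrow> real"
  assumes "finite V" "finite L" "y ` V \<subseteq> L" "near_type V L p \<epsilon> y"
  shows "\<bar>(\<Sum>v\<in>V. f (y v)) - real (card V) * (\<Sum>a\<in>L. p a * f a)\<bar>
          \<le> \<epsilon> * real (card V) * (\<Sum>a\<in>L. \<bar>f a\<bar>)"
proof -
  have "(\<Sum>v\<in>V. f (y v)) - real (card V) * (\<Sum>a\<in>L. p a * f a) =
     (\<Sum>a\<in>L. (real (card {v\<in>V. y v = a}) - real (card V) * p a) * f a)"
    unfolding sum_by_value[OF assms(1-3)]
    by (simp add: sum_subtractf sum_distrib_left left_diff_distrib mult.assoc)
  also have "\<bar>\<dots>\<bar> \<le> (\<Sum>a\<in>L. \<bar>(real (card {v\<in>V. y v = a}) - real (card V) * p a) * f a\<bar>)"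
    by (rule sum_abs)
  also have "\<dots> \<le> (\<Sum>a\<in>L. \<epsilon> * real (card V) * \<bar>f a\<bar>)"
    using assms(4) by (intro sum_mono) (auto simp: near_type_def abs_mult intro!: mult_right_mono)
  finally show ?thesis by (simp add: sum_distrib_left)
qed

text \<open>
  The weights of the labellings in \<open>S\<close> for a product (sub-)probability sum to at most \<open>1\<close>.
\<close>

lemma card_le_of_weights:
  fixes q :: "'v \<Rightarrow> 'l \<Rightarrow> real"
  assumes "finite V" "finite L" "S \<subseteq> V \<rightarrow>\<^sub>E L"
    and "\<And>v b. v \<in> V \<Longrightarrow> b \<in> L \<Longrightarrow> 0 < q v b"
    and "\<And>v. v \<in> V \<Longrightarrow> (\<Sum>b\<in>L. q v b) \<le> 1"
    and "\<And>z. z \<in> S \<Longrightarrow> - X \<le> (\<Sum>v\<in>V. ln (q v (z v)))"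
  shows "real (card S) \<le> exp X"
proof -
  have "real (card S) * exp (- X) = (\<Sum>z\<in>S. exp (- X))" by simp
  also have "\<dots> \<le> (\<Sum>z\<in>S. \<Prod>v\<in>V. q v (z v))"
  proof (rule sum_mono)
    fix z assume z: "z \<in> S"
    have "exp (- X) \<le> exp (\<Sum>v\<in>V. ln (q v (z v)))" using assms(6)[OF z] by simp
    also have "\<dots> = (\<Prod>v\<in>V. q v (z v))"
      unfolding exp_sum[OF assms(1)] using assms(3,4) z by (intro prod.cong) (auto simp: PiE_iff)
    finally show "exp (- X) \<le> (\<Prod>v\<in>V. q v (z v))" .
  qed
  also have "\<dots> \<le> (\<Sum>z\<in>V \<rightarrow>\<^sub>E L. \<Prod>v\<in>V. q v (z v))"
    using assms by (intro sum_mono2 finite_PiE prod_nonneg) (auto simp: PiE_iff less_imp_le)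
  also have "\<dots> = (\<Prod>v\<in>V. \<Sum>b\<in>L. q v b)"
    by (rule prod_sum_PiE[symmetric]) (use assms in auto)
  also have "\<dots> \<le> 1"
    by (intro prod_le_1 conjI sum_nonneg less_imp_le[OF assms(4)] assms(5))
  finally show ?thesis by (simp add: exp_minus field_simps)
qed

text \<open>
  Method of types: weigh \<open>z\<close> by the product of the conditional probabilities of \<open>z v\<close> given \<open>y v\<close>
  under \<open>W\<close>. These may vanish, so a small constant \<open>\<tau>\<close> is added to \<open>W\<close>; by monotonicity of \<open>ln\<close>
  this costs at most \<open>\<kappa> \<tau>\<close> for each element of \<open>K\<close>.
\<close>

lemma card_near_conditional:
  fixes W :: "'k \<times> 'l \<Rightarrow> real"
  assumes K: "finite K" and L: "finite L" "L \<noteq> {}"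
    and W: "\<And>a b. a \<in> K \<Longrightarrow> b \<in> L \<Longrightarrow> 0 \<le> W (a, b)"
    and p: "\<And>a. a \<in> K \<Longrightarrow> p a = (\<Sum>b\<in>L. W (a, b))"
    and \<eta>: "0 < \<eta>"
  shows "\<exists>\<epsilon>0>0. \<forall>\<epsilon>\<le>\<epsilon>0. \<forall>(V :: 'v set) y. finite V \<longrightarrow> y ` V \<subseteq> K \<longrightarrow>
    real (card {z \<in> V \<rightarrow>\<^sub>E L. near_type V (K \<times> L) W \<epsilon> (\<lambda>v. (y v, z v))})
      \<le> exp (real (card V) * (shannon (K \<times> L) W - shannon K p + \<eta>))"
proof -
  define \<kappa> where "\<kappa> = real (card L)"
  have \<kappa>: "\<kappa> \<ge> 1" using L by (simp add: \<kappa>_def Suc_le_eq card_gt_0_iff)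
  define \<tau> where "\<tau> = \<eta> / (2 * (real (card K) * \<kappa> + 1))"
  have \<tau>: "\<tau> > 0" using \<eta> \<kappa> by (auto simp: \<tau>_def intro!: divide_pos_pos add_nonneg_pos)
  have \<tau>2: "real (card K) * \<kappa> * \<tau> \<le> \<eta> / 2"
  proof -
    have "(real (card K) * \<kappa> + 1) * \<tau> = \<eta> / 2"
      using \<kappa> by (simp add: \<tau>_def field_simps add_nonneg_eq_0_iff)
    then show ?thesis using \<tau> by (simp add: algebra_simps)
  qed
  have p0: "0 \<le> p a" if "a \<in> K" for a using p[OF that] W[OF that] by (auto intro: sum_nonneg)
  define Q where "Q ab = (W ab + \<tau>) / (p (fst ab) + \<kappa> * \<tau>)" for ab
  have den: "0 < p a + \<kappa> * \<tau>" if "a \<in> K" for a using p0[OF that] \<kappa> \<tau> by (simp add: add_nonneg_pos)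
  have Qpos: "0 < Q (a, b)" if "a \<in> K" "b \<in> L" for a b
    using den[OF that(1)] W[OF that] \<tau> unfolding Q_def by (intro divide_pos_pos) simp_all
  have Qsum: "(\<Sum>b\<in>L. Q (a, b)) = 1" if "a \<in> K" for a
    using den[OF that] p[OF that] by (simp add: Q_def sum_divide_distrib[symmetric] sum.distrib \<kappa>_def)
  have "(\<Sum>ab\<in>K \<times> L. W ab * ln (Q ab)) =
        (\<Sum>ab\<in>K \<times> L. W ab * ln (W ab + \<tau>)) - (\<Sum>a\<in>K. p a * ln (p a + \<kappa> * \<tau>))"
  proof -
    have "(\<Sum>ab\<in>K \<times> L. W ab * ln (Q ab)) =
       (\<Sum>ab\<in>K \<times> L. W ab * ln (W ab + \<tau>) - W ab * ln (p (fst ab) + \<kappa> * \<tau>))"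
    proof (intro sum.cong refl)
      fix ab assume ab: "ab \<in> K \<times> L"
      have "0 \<le> W ab" "0 < p (fst ab) + \<kappa> * \<tau>"
        using ab W[of "fst ab" "snd ab"] den[of "fst ab"] by auto
      then have "0 < W ab + \<tau>" "0 < p (fst ab) + \<kappa> * \<tau>" using \<tau> by auto
      then show "W ab * ln (Q ab) = W ab * ln (W ab + \<tau>) - W ab * ln (p (fst ab) + \<kappa> * \<tau>)"
        unfolding Q_def by (subst ln_div) (auto simp: algebra_simps)
    qed
    also have "\<dots> = (\<Sum>ab\<in>K \<times> L. W ab * ln (W ab + \<tau>))
        - (\<Sum>a\<in>K. \<Sum>b\<in>L. W (a,b) * ln (p a + \<kappa> * \<tau>))"
      by (simp add: sum_subtractf sum.cartesian_product split_def)
    finally show ?thesis by (simp add: p sum_distrib_right)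
  qed
  moreover have "(\<Sum>ab\<in>K \<times> L. W ab * ln (W ab)) \<le> (\<Sum>ab\<in>K \<times> L. W ab * ln (W ab + \<tau>))"
  proof (rule sum_mono)
    fix ab assume "ab \<in> K \<times> L"
    then have "0 \<le> W ab" using W by auto
    then show "W ab * ln (W ab) \<le> W ab * ln (W ab + \<tau>)"
      using \<tau> by (cases "W ab = 0") (auto intro!: mult_left_mono)
  qed
  moreover have "(\<Sum>a\<in>K. p a * ln (p a + \<kappa> * \<tau>)) \<le> (\<Sum>a\<in>K. p a * ln (p a) + \<kappa> * \<tau>)"
  proof (rule sum_mono)
    fix a assume a: "a \<in> K"
    show "p a * ln (p a + \<kappa> * \<tau>) \<le> p a * ln (p a) + \<kappa> * \<tau>"
    proof (cases "p a = 0")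
      case True
      then show ?thesis using \<kappa> \<tau> by simp
    next
      case False
      then have pa: "p a > 0" using p0[OF a] by simp
      have "p a + \<kappa> * \<tau> = p a * (1 + \<kappa> * \<tau> / p a)" using pa by (simp add: field_simps)
      moreover have "0 < 1 + \<kappa> * \<tau> / p a" using pa \<kappa> \<tau> by (intro add_pos_nonneg) auto
      ultimately have "ln (p a + \<kappa> * \<tau>) = ln (p a) + ln (1 + \<kappa> * \<tau> / p a)"
        using pa by (simp add: ln_mult)
      also have "ln (1 + \<kappa> * \<tau> / p a) \<le> \<kappa> * \<tau> / p a"
        using pa \<kappa> \<tau> by (intro ln_add_one_self_le_self) auto
      finally have "p a * ln (p a + \<kappa> * \<tau>) \<le> p a * (ln (p a) + \<kappa> * \<tau> / p a)"
        using pa by (intro mult_left_mono) auto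
      then show ?thesis using pa by (simp add: algebra_simps)
    qed
  qed
  then have "(\<Sum>a\<in>K. p a * ln (p a + \<kappa> * \<tau>)) \<le> (\<Sum>a\<in>K. p a * ln (p a)) + \<eta> / 2"
    using \<tau>2 by (simp add: sum.distrib mult.assoc)
  ultimately have lnQ: "- (\<Sum>ab\<in>K \<times> L. W ab * ln (Q ab)) \<le> shannon (K \<times> L) W - shannon K p + \<eta> / 2"
    by (simp add: shannon_def)
  define B where "B = (\<Sum>ab\<in>K \<times> L. \<bar>ln (Q ab)\<bar>)"
  have B0: "B \<ge> 0" by (simp add: B_def sum_nonneg)
  define \<epsilon>0 where "\<epsilon>0 = \<eta> / (2 * (B + 1))"
  have \<epsilon>0: "\<epsilon>0 > 0" using \<eta> B0 by (auto simp: \<epsilon>0_def)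
  have \<epsilon>0B: "\<epsilon>0 * B \<le> \<eta> / 2"
  proof -
    have "\<epsilon>0 * (B + 1) = \<eta> / 2" using B0 by (simp add: \<epsilon>0_def field_simps)
    then show ?thesis using \<epsilon>0 by (simp add: algebra_simps)
  qed
  show ?thesis
  proof (intro exI[of _ \<epsilon>0] conjI allI impI \<epsilon>0)
    fix \<epsilon> and V :: "'v set" and y assume \<epsilon>: "\<epsilon> \<le> \<epsilon>0" and V: "finite V" "y ` V \<subseteq> K"
    let ?S = "{z \<in> V \<rightarrow>\<^sub>E L. near_type V (K \<times> L) W \<epsilon> (\<lambda>v. (y v, z v))}"
    let ?n = "real (card V)"
    show "real (card ?S) \<le> exp (?n * (shannon (K \<times> L) W - shannon K p + \<eta>))"
    proof (rule card_le_of_weights[where q = "\<lambda>v b. Q (y v, b)"])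
      fix z assume z: "z \<in> ?S"
      have "\<bar>(\<Sum>v\<in>V. ln (Q (y v, z v))) - ?n * (\<Sum>ab\<in>K \<times> L. W ab * ln (Q ab))\<bar> \<le> \<epsilon> * ?n * B"
        unfolding B_def
        using near_type_sum[of V "K \<times> L" "\<lambda>v. (y v, z v)" W \<epsilon> "\<lambda>ab. ln (Q ab)"] z V K L
        by (auto simp: PiE_iff)
      then have "?n * (\<Sum>ab\<in>K \<times> L. W ab * ln (Q ab)) - \<epsilon> * ?n * B \<le> (\<Sum>v\<in>V. ln (Q (y v, z v)))"
        by linarith
      moreover have "?n * (- (\<Sum>ab\<in>K \<times> L. W ab * ln (Q ab))) \<le>
          ?n * (shannon (K \<times> L) W - shannon K p + \<eta> / 2)"
        using lnQ by (rule mult_left_mono) simp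
      moreover have "?n * (\<epsilon> * B) \<le> ?n * (\<eta> / 2)"
        using \<epsilon> \<epsilon>0B B0 by (intro mult_left_mono) (auto intro: order_trans[OF mult_right_mono])
      ultimately show "- (?n * (shannon (K \<times> L) W - shannon K p + \<eta>)) \<le> (\<Sum>v\<in>V. ln (Q (y v, z v)))"
        by (simp add: algebra_simps)
    qed (use V K L Qpos Qsum in auto)
  qed
qed

text \<open>
  The conditional bound over a one-letter alphabet.
\<close>

lemma card_near_type:
  assumes L: "finite L" "L \<noteq> {}" and p: "\<And>a. a \<in> L \<Longrightarrow> 0 \<le> p a" "(\<Sum>a\<in>L. p a) = 1"
    and \<eta>: "0 < \<eta>"
  shows "\<exists>\<epsilon>0>0. \<forall>\<epsilon>\<le>\<epsilon>0. \<forall>(V :: 'v set). finite V \<longrightarrow>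
    real (card {z \<in> V \<rightarrow>\<^sub>E L. near_type V L p \<epsilon> z}) \<le> exp (real (card V) * (shannon L p + \<eta>))"
proof -
  have UL: "{()} \<times> L = Pair () ` L" by auto
  have sh: "shannon ({()} \<times> L) (\<lambda>(_, b). p b) = shannon L p"
    unfolding shannon_def UL by (subst sum.reindex) (auto simp: inj_on_def)
  have nt: "near_type V ({()} \<times> L) (\<lambda>(_, b). p b) \<epsilon> (\<lambda>v. ((), z v)) \<longleftrightarrow> near_type V L p \<epsilon> z" for V \<epsilon> z
    unfolding near_type_def UL by auto
  let ?bound = "\<lambda>\<epsilon>0. \<forall>\<epsilon>\<le>\<epsilon>0. \<forall>(V :: 'v set) y. finite V \<longrightarrow> y ` V \<subseteq> {()} \<longrightarrow>
    real (card {z \<in> V \<rightarrow>\<^sub>E L. near_type V ({()} \<times> L) (\<lambda>(_, b). p b) \<epsilon> (\<lambda>v. (y v, z v))})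
      \<le> exp (real (card V) * (shannon ({()} \<times> L) (\<lambda>(_, b). p b) - shannon {()} (\<lambda>_. 1) + \<eta>))"
  have "\<exists>\<epsilon>0>0. ?bound \<epsilon>0"
    by (rule card_near_conditional) (use assms in auto)
  then obtain \<epsilon>0 where e: "\<epsilon>0 > 0" "?bound \<epsilon>0"
    by (elim exE conjE)
  have U: "shannon {()} (\<lambda>_. 1) = 0" by (simp add: shannon_def)
  show ?thesis
  proof (intro exI[of _ \<epsilon>0] conjI allI impI e(1))
    fix \<epsilon> and V :: "'v set" assume "\<epsilon> \<le> \<epsilon>0" "finite V"
    moreover have "(\<lambda>_. ()) ` V \<subseteq> {()}" by auto
    ultimately show "real (card {z \<in> V \<rightarrow>\<^sub>E L. near_type V L p \<epsilon> z}) \<le> exp (real (card V) * (shannon L p + \<eta>))"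
      using e(2)[rule_format, of \<epsilon> V "\<lambda>_. ()"] unfolding sh nt U by simp
  qed
qed

lemma ln_fact_le: "ln (fact k :: real) \<le> (real k + 1) * ln (real k + 1) - real k"
proof (induction k)
  case (Suc k)
  have "ln (fact (Suc k) :: real) = ln (real k + 1) + ln (fact k)"
    by (simp add: ln_mult add.commute)
  moreover have "1 / (real k + 2) \<le> ln (real k + 2) - ln (real k + 1)"
  proof -
    have "ln ((real k + 1) / (real k + 2)) \<le> (real k + 1) / (real k + 2) - 1"
      by (rule ln_le_minus_one) (auto intro!: divide_pos_pos)
    then show ?thesis by (subst (asm) ln_div) (auto simp: field_simps)
  qed
  then have "1 \<le> (real k + 2) * (ln (real k + 2) - ln (real k + 1))"
    by (simp add: field_simps)
  ultimately show ?case using Suc by (simp add: algebra_simps)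
qed simp

lemma ln_fact_ge:
  assumes "n > 0"
  shows "real n * ln (real n) - real n \<le> ln (fact n :: real)"
proof -
  have "real n ^ n / fact n \<le> exp (real n)"
  proof -
    have "(\<Sum>i\<in>{n}. real n ^ i /\<^sub>R fact i) \<le> exp (real n)"
      unfolding exp_def by (rule sum_le_suminf[OF summable_exp_generic]) auto
    then show ?thesis by (simp add: field_simps)
  qed
  then have "ln (real n ^ n / fact n) \<le> real n"
    using assms by (metis divide_pos_pos fact_gt_zero ln_exp ln_mono of_nat_0_less_iff zero_less_power)
  then show ?thesis using assms by (simp add: ln_div ln_realpow)
qed

lemma x_ln_x_upper:
  fixes p :: real
  assumes "0 \<le> p" "0 < \<eta>"
  shows "\<exists>\<delta>>0. \<forall>t. 0 < t \<longrightarrow> \<bar>t - p\<bar> \<le> \<delta> \<longrightarrow> t * ln t \<le> p * ln p + \<eta>"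
proof (cases "p = 0")
  case True
  have "t * ln t \<le> p * ln p + \<eta>" if "0 < t" "\<bar>t - p\<bar> \<le> 1" for t
  proof -
    have "ln t \<le> 0" using that True by simp
    then have "t * ln t \<le> 0" using that by (simp add: mult_nonneg_nonpos)
    then show ?thesis using True assms by simp
  qed
  then show ?thesis by (intro exI[of _ 1]) auto
next
  case False
  then have "isCont (\<lambda>t. t * ln t) p" using assms by (intro continuous_intros) auto
  then have "((\<lambda>t. t * ln t) \<longlongrightarrow> p * ln p) (at p)" by (simp add: isCont_def)
  then obtain d where d: "d > 0" "\<And>t. t \<noteq> p \<Longrightarrow> \<bar>t - p\<bar> < d \<Longrightarrow> \<bar>t * ln t - p * ln p\<bar> < \<eta>"
    using assms(2) unfolding LIM_eq by (auto simp: real_norm_def)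
  have "t * ln t \<le> p * ln p + \<eta>" if "\<bar>t - p\<bar> \<le> d / 2" for t
    using d(2)[of t] that d(1) assms(2) by (cases "t = p") auto
  then show ?thesis using d(1) by (intro exI[of _ "d / 2"]) auto
qed

text \<open>
  Crude form of Stirling's formula: a multinomial coefficient is at least
  \<open>exp (n (shannon L p - \<eta>))\<close>.
\<close>

lemma prod_fact_le:
  assumes L: "finite L" and p: "\<And>a. a \<in> L \<Longrightarrow> 0 \<le> p a" and \<eta>: "0 < \<eta>"
  shows "\<exists>\<epsilon>0>0. \<exists>n0. \<forall>\<epsilon>\<le>\<epsilon>0. \<forall>k n. n \<ge> n0 \<longrightarrow> (\<Sum>a\<in>L. k a) = n \<longrightarrow>
     (\<forall>a\<in>L. \<bar>real (k a) - real n * p a\<bar> \<le> \<epsilon> * real n) \<longrightarrow>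
     real (\<Prod>a\<in>L. fact (k a)) \<le> fact n * exp (real n * (\<eta> - shannon L p))"
proof -
  define \<eta>' where "\<eta>' = \<eta> / (2 * (real (card L) + 1))"
  have \<eta>': "\<eta>' > 0" using \<eta> by (auto simp: \<eta>'_def intro!: divide_pos_pos add_nonneg_pos)
  have \<eta>'2: "real (card L) * \<eta>' \<le> \<eta> / 2"
  proof -
    have "(real (card L) + 1) * \<eta>' = \<eta> / 2" by (simp add: \<eta>'_def field_simps add_nonneg_eq_0_iff)
    then show ?thesis using \<eta>' by (simp add: algebra_simps)
  qed
  have "\<forall>a\<in>L. \<exists>\<delta>>0. \<forall>t. 0 < t \<longrightarrow> \<bar>t - p a\<bar> \<le> \<delta> \<longrightarrow> t * ln t \<le> p a * ln (p a) + \<eta>'"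
    using x_ln_x_upper p \<eta>' by blast
  then obtain d where d: "\<And>a. a \<in> L \<Longrightarrow> d a > 0"
    "\<And>a t. a \<in> L \<Longrightarrow> 0 < t \<Longrightarrow> \<bar>t - p a\<bar> \<le> d a \<Longrightarrow> t * ln t \<le> p a * ln (p a) + \<eta>'"
    by metis
  define \<delta> where "\<delta> = Min (insert 1 (d ` L))"
  have \<delta>: "\<delta> > 0" "\<And>a. a \<in> L \<Longrightarrow> \<delta> \<le> d a" using d(1) L by (auto simp: \<delta>_def)
  have "((\<lambda>n. real (card L) * (ln (real n) / real n)) \<longlongrightarrow> real (card L) * 0) sequentially"
    by (intro tendsto_mult tendsto_const) real_asymp
  then have "eventually (\<lambda>n. real (card L) * (ln (real n) / real n) < \<eta> / 2) sequentially"
    using \<eta> by (auto dest!: order_tendstoD(2)[of _ _ _ "\<eta> / 2"])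
  moreover have "eventually (\<lambda>n. 1 / real n < \<delta> / 2) sequentially"
    using \<delta> by real_asymp
  moreover have "eventually (\<lambda>n. n > 0) sequentially" by (rule eventually_gt_at_top)
  ultimately have "eventually (\<lambda>n. real (card L) * (ln (real n) / real n) < \<eta> / 2 \<and>
      1 / real n < \<delta> / 2 \<and> n > 0) sequentially" by eventually_elim auto
  then obtain n0 where n0: "\<And>n. n \<ge> n0 \<Longrightarrow> real (card L) * (ln (real n) / real n) < \<eta> / 2"
    "\<And>n. n \<ge> n0 \<Longrightarrow> 1 / real n < \<delta> / 2" "\<And>n. n \<ge> n0 \<Longrightarrow> n > 0"
    unfolding eventually_sequentially by blast
  show ?thesis
  proof (intro exI[of _ "\<delta> / 2"] exI[of _ n0] conjI allI impI)
    fix \<epsilon> :: real and k and n :: nat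
    assume \<epsilon>: "\<epsilon> \<le> \<delta> / 2" and n: "n0 \<le> n" and sumk: "sum k L = n"
      and near: "\<forall>a\<in>L. \<bar>real (k a) - real n * p a\<bar> \<le> \<epsilon> * real n"
    have npos: "real n > 0" using n0(3)[OF n] by simp
    \<comment> \<open>The increment matches \<open>ln_fact_le\<close> and keeps the argument of the logarithm positive.\<close>
    define t where "t a = (real (k a) + 1) / real n" for a
    have t0: "t a > 0" for a using npos by (simp add: t_def add_nonneg_pos)
    have tk: "real (k a) + 1 = real n * t a" for a using npos by (simp add: t_def)
    have tp: "t a * ln (t a) \<le> p a * ln (p a) + \<eta>'" if a: "a \<in> L" for a
    proof (rule d(2)[OF a t0])
      have "\<bar>real (k a) - real n * p a\<bar> / real n \<le> \<epsilon>" using near a npos by (simp add: field_simps)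
      then have "\<bar>(real (k a) - real n * p a) / real n\<bar> \<le> \<epsilon>" using npos by simp
      then have "\<bar>t a - 1 / real n - p a\<bar> \<le> \<epsilon>" using npos by (simp add: t_def field_simps)
      moreover have "0 < 1 / real n" using npos by simp
      ultimately have "\<bar>t a - p a\<bar> \<le> \<epsilon> + 1 / real n" by linarith
      also have "\<dots> \<le> d a" using \<epsilon> n0(2)[OF n] \<delta>(2)[OF a] by linarith
      finally show "\<bar>t a - p a\<bar> \<le> d a" .
    qed
    have sumt: "(\<Sum>a\<in>L. real n * t a) = real n + real (card L)"
    proof -
      have "(\<Sum>a\<in>L. real n * t a) = (\<Sum>a\<in>L. real (k a) + 1)" by (simp only: tk)
      also have "\<dots> = real (\<Sum>a\<in>L. k a) + real (card L)" by (simp add: sum.distrib)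
      finally show ?thesis using sumk by simp
    qed
    have "ln (\<Prod>a\<in>L. fact (k a) :: real) = (\<Sum>a\<in>L. ln (fact (k a)))"
      by (rule ln_prod) (use L in auto)
    also have "\<dots> \<le> (\<Sum>a\<in>L. (real (k a) + 1) * ln (real (k a) + 1) - real (k a))"
      by (intro sum_mono ln_fact_le)
    also have "\<dots> = (\<Sum>a\<in>L. real n * t a * ln (real n) + real n * (t a * ln (t a))) - real n"
    proof -
      have "(real (k a) + 1) * ln (real (k a) + 1) = real n * t a * ln (real n) + real n * (t a * ln (t a))" for a
        unfolding tk using t0[of a] npos by (simp add: ln_mult algebra_simps)
      moreover have "(\<Sum>a\<in>L. real (k a)) = real n" using sumk by (metis of_nat_sum)
      ultimately show ?thesis by (simp add: sum_subtractf)
    qed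
    also have "\<dots> = (real n + real (card L)) * ln (real n) + real n * (\<Sum>a\<in>L. t a * ln (t a)) - real n"
      unfolding sum.distrib sum_distrib_right[symmetric] sumt sum_distrib_left[symmetric, of "real n" "\<lambda>a. t a * ln (t a)"] ..
    also have "\<dots> \<le> (real n + real (card L)) * ln (real n) + real n * (\<Sum>a\<in>L. p a * ln (p a) + \<eta>') - real n"
      using tp npos by (auto intro!: mult_left_mono sum_mono)
    also have "\<dots> = (real n * ln (real n) - real n) + real n * (real (card L) * (ln (real n) / real n)
       + real (card L) * \<eta>' - shannon L p)"
      using npos by (simp add: shannon_def sum.distrib algebra_simps)
    also have "\<dots> \<le> ln (fact n) + real n * (\<eta> - shannon L p)"
    proof -
      have "real (card L) * (ln (real n) / real n) + real (card L) * \<eta>' - shannon L p \<le> \<eta> - shannon L p"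
        using n0(1)[OF n] \<eta>'2 by linarith
      then show ?thesis using ln_fact_ge[of n] npos by (intro add_mono mult_left_mono) auto
    qed
    finally have "ln (\<Prod>a\<in>L. fact (k a) :: real) \<le> ln (fact n * exp (real n * (\<eta> - shannon L p)))"
      by (simp add: ln_mult)
    then show "real (\<Prod>a\<in>L. fact (k a)) \<le> fact n * exp (real n * (\<eta> - shannon L p))"
      by (subst (asm) ln_le_cancel_iff) (auto intro!: prod_pos)
  qed (use \<delta> in auto)
qed

text \<open>
  Such a permutation restricts to a permutation of each label class, and is determined by these.
\<close>

lemma card_label_preserving_perms:
  assumes V: "finite V" and L: "finite L" and z: "z ` V \<subseteq> L"
  shows "card {\<rho>. \<rho> permutes V \<and> (\<forall>v\<in>V. z (\<rho> v) = z v)} \<le> (\<Prod>b\<in>L. fact (card {v\<in>V. z v = b}))"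
proof -
  let ?S = "{\<rho>. \<rho> permutes V \<and> (\<forall>v\<in>V. z (\<rho> v) = z v)}"
  let ?F = "\<lambda>b. {v\<in>V. z v = b}"
  let ?r = "\<lambda>\<rho>. \<lambda>b\<in>L. \<lambda>v. if v \<in> ?F b then \<rho> v else v"
  have "card ?S \<le> card (\<Pi>\<^sub>E b\<in>L. {\<pi>. \<pi> permutes ?F b})"
  proof (rule card_inj_on_le[where f = ?r])
    show "inj_on ?r ?S"
    proof (rule inj_onI)
      fix \<rho> \<rho>' assume a: "\<rho> \<in> ?S" "\<rho>' \<in> ?S" and e: "?r \<rho> = ?r \<rho>'"
      show "\<rho> = \<rho>'"
      proof
        fix v show "\<rho> v = \<rho>' v"
        proof (cases "v \<in> V")
          case True
          then have "?r \<rho> (z v) v = \<rho> v" "?r \<rho>' (z v) v = \<rho>' v" using z by auto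
          then show ?thesis using e by metis
        next
          case False
          then show ?thesis using a by (auto simp: permutes_def)
        qed
      qed
    qed
    show "?r ` ?S \<subseteq> (\<Pi>\<^sub>E b\<in>L. {\<pi>. \<pi> permutes ?F b})"
    proof (intro image_subsetI PiE_I)
      fix \<rho> b assume \<rho>: "\<rho> \<in> ?S" and b: "b \<in> L"
      have "inj_on \<rho> (?F b)" using \<rho> permutes_inj inj_on_subset by fastforce
      moreover have sub: "\<rho> ` ?F b \<subseteq> ?F b" using \<rho> by (auto simp: permutes_in_image)
      moreover have "\<rho> ` ?F b = ?F b"
        by (rule endo_inj_surj) (use V sub \<open>inj_on \<rho> (?F b)\<close> in auto)
      ultimately have "bij_betw \<rho> (?F b) (?F b)" by (simp only: bij_betw_def)
      then have "bij_betw (\<lambda>v. if v \<in> ?F b then \<rho> v else v) (?F b) (?F b)"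
        by (rule bij_betw_cong[THEN iffD1, rotated]) auto
      then have "(\<lambda>v. if v \<in> ?F b then \<rho> v else v) permutes ?F b"
        by (rule bij_imp_permutes) auto
      then show "?r \<rho> b \<in> {\<pi>. \<pi> permutes ?F b}" using b by simp
    qed auto
    show "finite (\<Pi>\<^sub>E b\<in>L. {\<pi>. \<pi> permutes ?F b})"
      using L V by (intro finite_PiE finite_permutations) auto
  qed
  also have "\<dots> = (\<Prod>b\<in>L. card {\<pi>. \<pi> permutes ?F b})" using L by (rule card_PiE)
  also have "\<dots> = (\<Prod>b\<in>L. fact (card (?F b)))"
    using V by (intro prod.cong refl card_permutations) auto
  finally show ?thesis .
qed

text \<open>
  All such \<open>\<tau>\<close> differ by permutations that preserve the labelling \<open>z\<close>.
\<close>

lemma card_perms_pulling_back: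
  assumes V: "finite V" and L: "finite L" and z: "z ` V \<subseteq> L"
  shows "card {\<tau>. \<tau> permutes V \<and> (\<forall>v\<in>V. y (\<tau> v) = z v)} \<le> (\<Prod>b\<in>L. fact (card {v\<in>V. z v = b}))"
proof (cases "{\<tau>. \<tau> permutes V \<and> (\<forall>v\<in>V. y (\<tau> v) = z v)} = {}")
  case True
  then show ?thesis by (simp only: card.empty le0)
next
  case False
  then obtain \<tau>0 where \<tau>0: "\<tau>0 permutes V" "\<forall>v\<in>V. y (\<tau>0 v) = z v" by blast
  let ?i = "inv_into UNIV \<tau>0"
  let ?T = "{\<tau>. \<tau> permutes V \<and> (\<forall>v\<in>V. y (\<tau> v) = z v)}"
  have "card ?T \<le> card {\<rho>. \<rho> permutes V \<and> (\<forall>v\<in>V. z (\<rho> v) = z v)}"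
  proof (rule card_inj_on_le[where f = "\<lambda>\<tau>. ?i \<circ> \<tau>"])
    show "inj_on (\<lambda>\<tau>. ?i \<circ> \<tau>) ?T"
    proof (rule inj_onI)
      fix \<tau> \<tau>' assume "?i \<circ> \<tau> = ?i \<circ> \<tau>'"
      then have "\<tau>0 \<circ> (?i \<circ> \<tau>) = \<tau>0 \<circ> (?i \<circ> \<tau>')" by simp
      then show "\<tau> = \<tau>'" using permutes_inverses[OF \<tau>0(1)] by (simp add: fun_eq_iff)
    qed
    show "(\<lambda>\<tau>. ?i \<circ> \<tau>) ` ?T \<subseteq> {\<rho>. \<rho> permutes V \<and> (\<forall>v\<in>V. z (\<rho> v) = z v)}"
    proof (intro image_subsetI CollectI conjI ballI)
      fix \<tau> assume t: "\<tau> \<in> ?T"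
      then show p: "?i \<circ> \<tau> permutes V" using \<tau>0 by (intro permutes_compose permutes_inv) auto
      fix v assume v: "v \<in> V"
      have "(?i \<circ> \<tau>) v \<in> V" using p v by (simp only: permutes_in_image)
      then have "z ((?i \<circ> \<tau>) v) = y (\<tau>0 ((?i \<circ> \<tau>) v))" using \<tau>0 by auto
      also have "\<dots> = z v" using t v permutes_inverses[OF \<tau>0(1)] by simp
      finally show "z ((?i \<circ> \<tau>) v) = z v" .
    qed
    show "finite {\<rho>. \<rho> permutes V \<and> (\<forall>v\<in>V. z (\<rho> v) = z v)}"
      using finite_permutations[OF V] by auto
  qed
  with card_label_preserving_perms[OF assms] show ?thesis by linarith
qed

text \<open>
  A permutation \<open>\<tau>\<close> is determined by the labelling \<open>y' \<circ> \<tau>\<close>, which \<open>card_near_conditional\<close> counts,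
  and by a choice of one permutation for each label class, which \<open>prod_fact_le\<close> counts. Up to \<open>\<eta>\<close>, the
  exponent is minus the mutual information of \<open>W\<close>.
\<close>

lemma card_near_perms:
  fixes W :: "'k \<times> 'l \<Rightarrow> real"
  assumes K: "finite K" and L: "finite L" "L \<noteq> {}"
    and W: "\<And>a b. a \<in> K \<Longrightarrow> b \<in> L \<Longrightarrow> 0 \<le> W (a, b)"
    and p: "\<And>a. a \<in> K \<Longrightarrow> p a = (\<Sum>b\<in>L. W (a, b))"
    and p': "\<And>b. b \<in> L \<Longrightarrow> p' b = (\<Sum>a\<in>K. W (a, b))"
    and \<eta>: "0 < \<eta>"
  shows "\<exists>\<epsilon>0>0. \<exists>n0. \<forall>\<epsilon>. 0 < \<epsilon> \<and> \<epsilon> \<le> \<epsilon>0 \<longrightarrow> (\<forall>(V :: 'v set) y y'. finite V \<longrightarrow> card V \<ge> n0 \<longrightarrow> y ` V \<subseteq> K \<longrightarrow> y' ` V \<subseteq> L \<longrightarrow>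
    real (card {\<tau>. \<tau> permutes V \<and> near_type V (K \<times> L) W \<epsilon> (\<lambda>v. (y v, y' (\<tau> v)))})
      \<le> fact (card V) * exp (real (card V) * (shannon (K \<times> L) W - shannon K p - shannon L p' + \<eta>)))"
proof -
  let ?labels = "\<lambda>\<epsilon>1. \<forall>\<epsilon>\<le>\<epsilon>1. \<forall>(V :: 'v set) y. finite V \<longrightarrow> y ` V \<subseteq> K \<longrightarrow>
    real (card {z \<in> V \<rightarrow>\<^sub>E L. near_type V (K \<times> L) W \<epsilon> (\<lambda>v. (y v, z v))})
      \<le> exp (real (card V) * (shannon (K \<times> L) W - shannon K p + \<eta> / 2))"
  let ?facts = "\<lambda>\<epsilon>2 n0. \<forall>\<epsilon>\<le>\<epsilon>2. \<forall>k n. n \<ge> n0 \<longrightarrow> (\<Sum>a\<in>L. k a) = n \<longrightarrow>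
     (\<forall>a\<in>L. \<bar>real (k a) - real n * p' a\<bar> \<le> \<epsilon> * real n) \<longrightarrow>
     real (\<Prod>a\<in>L. fact (k a)) \<le> fact n * exp (real n * (\<eta> / 2 - shannon L p'))"
  have "\<exists>\<epsilon>1>0. ?labels \<epsilon>1"
    by (rule card_near_conditional[OF K L]) (use W p \<eta> in auto)
  then obtain \<epsilon>1 where \<epsilon>1: "\<epsilon>1 > 0" "?labels \<epsilon>1"
    by (elim exE conjE)
  have p'0: "0 \<le> p' b" if "b \<in> L" for b using p'[OF that] W that by (auto intro: sum_nonneg)
  have "\<exists>\<epsilon>2>0. \<exists>n0. ?facts \<epsilon>2 n0"
    by (rule prod_fact_le) (use L p'0 \<eta> in auto)
  then obtain \<epsilon>2 n0 where \<epsilon>2: "\<epsilon>2 > 0" "?facts \<epsilon>2 n0"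
    by (elim exE conjE)
  define \<epsilon>0 where "\<epsilon>0 = min \<epsilon>1 (\<epsilon>2 / (real (card K) + 1))"
  have \<epsilon>0: "\<epsilon>0 > 0" using \<epsilon>1 \<epsilon>2 by (auto simp: \<epsilon>0_def intro!: divide_pos_pos add_nonneg_pos)
  show ?thesis
  proof (intro exI[of _ \<epsilon>0] exI[of _ n0] conjI \<epsilon>0 allI impI)
    fix \<epsilon> and V :: "'v set" and y y'
    assume \<epsilon>: "0 < \<epsilon> \<and> \<epsilon> \<le> \<epsilon>0" and V: "finite V" and n: "card V \<ge> n0" and y: "y ` V \<subseteq> K" "y' ` V \<subseteq> L"
    let ?n = "real (card V)"
    let ?Z = "{z \<in> V \<rightarrow>\<^sub>E L. near_type V (K \<times> L) W \<epsilon> (\<lambda>v. (y v, z v))}"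
    let ?T = "\<lambda>z. {\<tau>. \<tau> permutes V \<and> (\<forall>v\<in>V. y' (\<tau> v) = z v)}"
    have finZ: "finite ?Z" using V L finite_PiE[of V "\<lambda>_. L"] by auto
    have e2: "real (card K) * \<epsilon> \<le> \<epsilon>2"
    proof -
      have "\<epsilon> \<le> \<epsilon>2 / (real (card K) + 1)" using \<epsilon> by (simp add: \<epsilon>0_def)
      then have "\<epsilon> * (real (card K) + 1) \<le> \<epsilon>2" by (subst (asm) pos_le_divide_eq) (auto intro: add_nonneg_pos)
      then show ?thesis using \<epsilon> by (simp add: algebra_simps)
    qed
    have T: "real (card (?T z)) \<le> fact (card V) * exp (?n * (\<eta> / 2 - shannon L p'))" if z: "z \<in> ?Z" for z
    proof -
      have zL: "z ` V \<subseteq> L" using z by (auto simp: PiE_iff)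
      have "real (card (?T z)) \<le> real (\<Prod>b\<in>L. fact (card {v\<in>V. z v = b}))"
        using card_perms_pulling_back[OF V L(1) zL] by (rule of_nat_mono)
      also have "\<dots> \<le> fact (card V) * exp (?n * (\<eta> / 2 - shannon L p'))"
      proof (rule \<epsilon>2(2)[rule_format, OF e2 n])
        show "(\<Sum>b\<in>L. card {v\<in>V. z v = b}) = card V"
          using sum_by_value[OF V L(1) zL, of "\<lambda>_. 1"] by (simp flip: of_nat_sum)
        show "\<bar>real (card {v \<in> V. z v = b}) - ?n * p' b\<bar> \<le> real (card K) * \<epsilon> * ?n" if b: "b \<in> L" for b
        proof -
          have "real (card {v\<in>V. z v = b}) = (\<Sum>v\<in>{v\<in>V. z v = b}. 1)" by simp
          also have "\<dots> = (\<Sum>a\<in>K. real (card {v\<in>{v\<in>V. z v = b}. y v = a}))"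
            using sum_by_value[of "{v\<in>V. z v = b}" K y "\<lambda>_. 1"] V K y by auto
          also have "\<dots> = (\<Sum>a\<in>K. real (card {v\<in>V. (y v, z v) = (a, b)}))"
            by (intro sum.cong refl arg_cong[where f = real] arg_cong[where f = card]) auto
          finally have "real (card {v \<in> V. z v = b}) - ?n * p' b =
             (\<Sum>a\<in>K. real (card {v\<in>V. (y v, z v) = (a, b)}) - ?n * W (a, b))"
            using p'[OF b] by (simp add: sum_subtractf sum_distrib_left)
          also have "\<bar>\<dots>\<bar> \<le> (\<Sum>a\<in>K. \<bar>real (card {v\<in>V. (y v, z v) = (a, b)}) - ?n * W (a, b)\<bar>)"
            by (rule sum_abs)
          also have "\<dots> \<le> (\<Sum>a\<in>K. \<epsilon> * ?n)"
            using z b by (intro sum_mono) (auto simp: near_type_def)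
          finally show "\<bar>real (card {v \<in> V. z v = b}) - ?n * p' b\<bar> \<le> real (card K) * \<epsilon> * ?n"
            by simp
        qed
      qed
      finally show ?thesis .
    qed
    have "{\<tau>. \<tau> permutes V \<and> near_type V (K \<times> L) W \<epsilon> (\<lambda>v. (y v, y' (\<tau> v)))} \<subseteq> (\<Union>z\<in>?Z. ?T z)"
    proof clarify
      fix \<tau> assume \<tau>: "\<tau> permutes V" "near_type V (K \<times> L) W \<epsilon> (\<lambda>v. (y v, y' (\<tau> v)))"
      let ?z = "\<lambda>v\<in>V. y' (\<tau> v)"
      have "?z \<in> V \<rightarrow>\<^sub>E L" using y(2) permutes_in_image[OF \<tau>(1)] by auto
      moreover have "near_type V (K \<times> L) W \<epsilon> (\<lambda>v. (y v, ?z v))"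
        using \<tau>(2) unfolding near_type_def by (simp cong: conj_cong)
      ultimately have "?z \<in> ?Z" by blast
      then show "\<tau> \<in> (\<Union>z\<in>?Z. ?T z)" by (rule UN_I) (use \<tau>(1) in auto)
    qed
    then have "card {\<tau>. \<tau> permutes V \<and> near_type V (K \<times> L) W \<epsilon> (\<lambda>v. (y v, y' (\<tau> v)))}
        \<le> card (\<Union>z\<in>?Z. ?T z)"
      using finZ finite_permutations[OF V] by (intro card_mono finite_UN_I) auto
    also have "\<dots> \<le> (\<Sum>z\<in>?Z. card (?T z))" by (rule card_UN_le[OF finZ])
    finally have "real (card {\<tau>. \<tau> permutes V \<and> near_type V (K \<times> L) W \<epsilon> (\<lambda>v. (y v, y' (\<tau> v)))})
        \<le> real (\<Sum>z\<in>?Z. card (?T z))" by (rule of_nat_mono)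
    also have "\<dots> = (\<Sum>z\<in>?Z. real (card (?T z)))" by (rule of_nat_sum)
    also have "\<dots> \<le> (\<Sum>z\<in>?Z. fact (card V) * exp (?n * (\<eta> / 2 - shannon L p')))"
      by (rule sum_mono) (rule T)
    also have "\<dots> = real (card ?Z) * (fact (card V) * exp (?n * (\<eta> / 2 - shannon L p')))" by simp
    also have "\<dots> \<le> exp (?n * (shannon (K \<times> L) W - shannon K p + \<eta> / 2)) *
        (fact (card V) * exp (?n * (\<eta> / 2 - shannon L p')))"
      using \<epsilon>1(2)[rule_format, of \<epsilon> V y] \<epsilon> V y by (intro mult_right_mono) (auto simp: \<epsilon>0_def)
    also have "\<dots> = fact (card V) * exp (?n * (shannon (K \<times> L) W - shannon K p - shannon L p' + \<eta>))"
      by (simp add: exp_add[symmetric] algebra_simps)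
    finally show "real (card {\<tau>. \<tau> permutes V \<and> near_type V (K \<times> L) W \<epsilon> (\<lambda>v. (y v, y' (\<tau> v)))})
      \<le> fact (card V) * exp (?n * (shannon (K \<times> L) W - shannon K p - shannon L p' + \<eta>))" .
  qed
qed

text \<open>
  Once \<open>y\<close> is chosen, the permutations can be chosen independently of each other. Up to the
  multiple of \<open>\<eta>\<close>, the exponent is the quantity whose infimum is the f-invariant.
\<close>

lemma card_labelled_perm_tuples:
  fixes W :: "nat \<Rightarrow> 'l \<times> 'l \<Rightarrow> real"
  assumes L: "finite L" "L \<noteq> {}" and p: "\<And>a. a \<in> L \<Longrightarrow> 0 \<le> p a" "(\<Sum>a\<in>L. p a) = 1"
    and W: "\<And>i a b. i < m \<Longrightarrow> a \<in> L \<Longrightarrow> b \<in> L \<Longrightarrow> 0 \<le> W i (a, b)"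
    and W1: "\<And>i a. i < m \<Longrightarrow> a \<in> L \<Longrightarrow> p a = (\<Sum>b\<in>L. W i (a, b))"
    and W2: "\<And>i b. i < m \<Longrightarrow> b \<in> L \<Longrightarrow> p b = (\<Sum>a\<in>L. W i (a, b))"
    and \<eta>: "0 < \<eta>"
  shows "\<exists>\<epsilon>>0. \<exists>n0. \<forall>V :: 'v set. finite V \<longrightarrow> card V \<ge> n0 \<longrightarrow>
    real (card {(y, \<sigma>). y \<in> V \<rightarrow>\<^sub>E L \<and> \<sigma> \<in> perm_tuples m V \<and> near_type V L p \<epsilon> y \<and>
        (\<forall>i<m. near_type V (L \<times> L) (W i) \<epsilon> (\<lambda>v. (y v, y (\<sigma> i v))))})
    \<le> fact (card V) ^ m * exp (real (card V) *
        ((1 - 2 * real m) * shannon L p + (\<Sum>i<m. shannon (L \<times> L) (W i)) + (real m + 1) * \<eta>))"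
proof -
  let ?vertex = "\<lambda>\<epsilon>0. \<forall>\<epsilon>\<le>\<epsilon>0. \<forall>V :: 'v set. finite V \<longrightarrow>
    real (card {z \<in> V \<rightarrow>\<^sub>E L. near_type V L p \<epsilon> z}) \<le> exp (real (card V) * (shannon L p + \<eta>))"
  let ?edge = "\<lambda>i \<epsilon>0 n0. \<forall>\<epsilon>. 0 < \<epsilon> \<and> \<epsilon> \<le> \<epsilon>0 \<longrightarrow> (\<forall>(V :: 'v set) y y'.
    finite V \<longrightarrow> card V \<ge> n0 \<longrightarrow> y ` V \<subseteq> L \<longrightarrow> y' ` V \<subseteq> L \<longrightarrow>
    real (card {\<tau>. \<tau> permutes V \<and> near_type V (L \<times> L) (W i) \<epsilon> (\<lambda>v. (y v, y' (\<tau> v)))}) \<le>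
      fact (card V) * exp (real (card V) * (shannon (L \<times> L) (W i) - shannon L p - shannon L p + \<eta>)))"
  have "\<exists>\<epsilon>0>0. ?vertex \<epsilon>0"
    by (rule card_near_type) (use assms in auto)
  then obtain \<epsilon>p where \<epsilon>p: "\<epsilon>p > 0" "?vertex \<epsilon>p" by (elim exE conjE)
  have "\<forall>i\<in>{..<m}. \<exists>\<epsilon>0. 0 < \<epsilon>0 \<and> (\<exists>n0. ?edge i \<epsilon>0 n0)"
    by (intro ballI card_near_perms) (use assms in auto)
  then obtain e where e: "\<forall>i\<in>{..<m}. 0 < e i \<and> (\<exists>n0. ?edge i (e i) n0)"
    by (rule bchoice[THEN exE])
  then have "\<forall>i\<in>{..<m}. \<exists>n0. ?edge i (e i) n0"
    by (intro ballI) (drule (1) bspec, erule conjunct2)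
  then obtain N where N: "\<forall>i\<in>{..<m}. ?edge i (e i) (N i)"
    by (rule bchoice[THEN exE])
  define \<epsilon> where "\<epsilon> = Min (insert \<epsilon>p (e ` {..<m}))"
  have \<epsilon>: "\<epsilon> > 0" "\<epsilon> \<le> \<epsilon>p" "\<And>i. i < m \<Longrightarrow> \<epsilon> \<le> e i" using e \<epsilon>p by (auto simp: \<epsilon>_def)
  define n0 where "n0 = Max (insert 0 (N ` {..<m}))"
  have n0: "\<And>i. i < m \<Longrightarrow> N i \<le> n0" by (auto simp: n0_def)
  show ?thesis
  proof (intro exI[of _ \<epsilon>] exI[of _ n0] conjI \<epsilon>(1) allI impI)
    fix V :: "'v set" assume V: "finite V" and n: "n0 \<le> card V"
    let ?n = "real (card V)"
    let ?Y = "{y \<in> V \<rightarrow>\<^sub>E L. near_type V L p \<epsilon> y}"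
    let ?T = "\<lambda>y i. {\<tau>. \<tau> permutes V \<and> near_type V (L \<times> L) (W i) \<epsilon> (\<lambda>v. (y v, y (\<tau> v)))}"
    let ?c = "\<lambda>i. fact (card V) * exp (?n * (shannon (L \<times> L) (W i) - shannon L p - shannon L p + \<eta>))"
    let ?A = "{(y, \<sigma>). y \<in> V \<rightarrow>\<^sub>E L \<and> \<sigma> \<in> perm_tuples m V \<and> near_type V L p \<epsilon> y \<and>
        (\<forall>i<m. near_type V (L \<times> L) (W i) \<epsilon> (\<lambda>v. (y v, y (\<sigma> i v))))}"
    have finY: "finite ?Y" using V L finite_PiE[of V "\<lambda>_. L"] by auto
    have finT: "finite (?T y i)" for y i using finite_permutations[OF V] by auto
    have "?A \<subseteq> (SIGMA y:?Y. \<Pi>\<^sub>E i\<in>{..<m}. ?T y i)"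
      by (auto simp: perm_tuples_def PiE_iff extensional_def)
    then have "card ?A \<le> card (SIGMA y:?Y. \<Pi>\<^sub>E i\<in>{..<m}. ?T y i)"
      using finY finT by (intro card_mono finite_SigmaI finite_PiE) auto
    also have "\<dots> = (\<Sum>y\<in>?Y. \<Prod>i<m. card (?T y i))"
      using finY finT by (subst card_SigmaI) (auto intro!: finite_PiE simp: card_PiE)
    finally have "real (card ?A) \<le> real (\<Sum>y\<in>?Y. \<Prod>i<m. card (?T y i))" by (rule of_nat_mono)
    also have "\<dots> = (\<Sum>y\<in>?Y. \<Prod>i<m. real (card (?T y i)))" by simp
    also have "\<dots> \<le> (\<Sum>y\<in>?Y. \<Prod>i<m. ?c i)"
    proof (intro sum_mono prod_mono conjI)
      fix y i assume y: "y \<in> ?Y" and i: "i \<in> {..<m}"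
      have "y ` V \<subseteq> L" using y by (auto simp: PiE_iff)
      then show "real (card (?T y i)) \<le> ?c i"
        using N[rule_format, of i \<epsilon> V y y] i \<epsilon> n n0[of i] V by auto
    qed auto
    also have "\<dots> = real (card ?Y) * (\<Prod>i<m. ?c i)" by simp
    also have "\<dots> \<le> exp (?n * (shannon L p + \<eta>)) * (\<Prod>i<m. ?c i)"
      using \<epsilon>p(2)[rule_format, OF \<epsilon>(2) V] by (intro mult_right_mono prod_nonneg) auto
    also have "(\<Prod>i<m. ?c i) = fact (card V) ^ m *
        exp (\<Sum>i<m. ?n * (shannon (L \<times> L) (W i) - shannon L p - shannon L p + \<eta>))"
      by (simp add: prod.distrib exp_sum)
    also have "(\<Sum>i<m. ?n * (shannon (L \<times> L) (W i) - shannon L p - shannon L p + \<eta>)) =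
        ?n * ((\<Sum>i<m. shannon (L \<times> L) (W i)) - 2 * real m * shannon L p + real m * \<eta>)"
      by (simp add: sum_distrib_left[symmetric] sum.distrib sum_subtractf algebra_simps)
    also have "exp (?n * (shannon L p + \<eta>)) * (fact (card V) ^ m *
        exp (?n * ((\<Sum>i<m. shannon (L \<times> L) (W i)) - 2 * real m * shannon L p + real m * \<eta>)))
      = fact (card V) ^ m * exp (?n * ((1 - 2 * real m) * shannon L p +
          (\<Sum>i<m. shannon (L \<times> L) (W i)) + (real m + 1) * \<eta>))"
      by (simp add: exp_add[symmetric] mult.left_commute algebra_simps)
    finally show "real (card ?A) \<le> fact (card V) ^ m * exp (?n * ((1 - 2 * real m) * shannon L p +
          (\<Sum>i<m. shannon (L \<times> L) (W i)) + (real m + 1) * \<eta>))" .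
  qed
qed

definition hamming :: "'v set \<Rightarrow> ('v \<Rightarrow> 'a) \<Rightarrow> ('v \<Rightarrow> 'a) \<Rightarrow> nat" where
  "hamming V x y = card {v\<in>V. x v \<noteq> y v}"

text \<open>
  Generating function of the Hamming distance from \<open>x\<close>; it serves both for the lower bound on the
  partition function and for the size of Hamming balls.
\<close>

lemma sum_power_hamming:
  fixes t :: real
  assumes "finite V" "finite A"
  shows "(\<Sum>y\<in>V \<rightarrow>\<^sub>E A. t ^ hamming V x y) = (\<Prod>v\<in>V. \<Sum>a\<in>A. if x v = a then 1 else t)"
proof -
  have "t ^ hamming V x y = (\<Prod>v\<in>V. if x v = y v then 1 else t)" for y
    using assms(1) by (simp add: hamming_def prod.If_cases Int_def)
  then show ?thesis using assms by (simp add: prod_sum_PiE)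
qed

lemma sum_power_hamming_ge:
  fixes t :: real
  assumes "finite V" "finite A" "card A \<ge> 2" "x \<in> V \<rightarrow> A" "0 \<le> t"
  shows "(1 + t) ^ card V \<le> (\<Sum>y\<in>V \<rightarrow>\<^sub>E A. t ^ hamming V x y)"
proof -
  have "(1 + t) ^ card V = (\<Prod>v\<in>V. 1 + t)" by simp
  also have "\<dots> \<le> (\<Prod>v\<in>V. \<Sum>a\<in>A. if x v = a then 1 else t)"
  proof (intro prod_mono conjI)
    fix v assume v: "v \<in> V"
    then have xv: "x v \<in> A" using assms by auto
    then obtain b where b: "b \<in> A" "b \<noteq> x v"
      using assms(3) by (metis card_2_iff' obtain_subset_with_card_n subsetD)
    have "1 + t = (\<Sum>a\<in>{x v, b}. if x v = a then 1 else t)" using b by auto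
    also have "\<dots> \<le> (\<Sum>a\<in>A. if x v = a then 1 else t)"
      using xv b assms by (intro sum_mono2) auto
    finally show "1 + t \<le> (\<Sum>a\<in>A. if x v = a then 1 else t)" .
  qed (use assms in auto)
  finally show ?thesis using sum_power_hamming[OF assms(1,2)] by simp
qed

text \<open>
  Chernoff bound: \<open>t ^ hamming\<close> is at least \<open>t powr (\<delta> n)\<close> on the ball, while its total is at most
  \<open>(1 + card A t)\<^sup>n\<close>. First \<open>t\<close>, then \<open>\<delta>\<close> is taken small.
\<close>

lemma small_hamming_balls:
  assumes A: "finite A" and c: "0 < c"
  shows "\<exists>\<delta>>0. \<forall>(V :: 'v set) (x :: 'v \<Rightarrow> 'a). finite V \<longrightarrow>
    real (card {y \<in> V \<rightarrow>\<^sub>E A. real (hamming V x y) \<le> \<delta> * real (card V)}) \<le> exp (c * real (card V))"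
proof -
  define t where "t = min 1 (c / (2 * (real (card A) + 1)))"
  have t: "0 < t" "t \<le> 1" using c by (auto simp: t_def intro!: divide_pos_pos add_nonneg_pos)
  have At: "real (card A) * t \<le> c / 2"
  proof -
    have "(real (card A) + 1) * t \<le> (real (card A) + 1) * (c / (2 * (real (card A) + 1)))"
      by (intro mult_left_mono) (auto simp: t_def)
    also have "\<dots> = c / 2" by (simp add: field_simps add_nonneg_eq_0_iff)
    finally show ?thesis using t by (simp add: algebra_simps)
  qed
  define \<delta> where "\<delta> = (c / 2) / (1 - ln t)"
  have lnt: "ln t \<le> 0" using t by simp
  then have \<delta>: "\<delta> > 0" using c by (auto simp: \<delta>_def)
  have \<delta>t: "\<delta> * (- ln t) \<le> c / 2"
  proof -
    have "(1 - ln t) * \<delta> = c / 2" using lnt unfolding \<delta>_def by (subst times_divide_eq_right, subst nonzero_mult_div_cancel_left) auto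
    then show ?thesis using \<delta> by (simp add: algebra_simps)
  qed
  show ?thesis
  proof (intro exI[of _ \<delta>] conjI \<delta> allI impI)
    fix V :: "'v set" and x :: "'v \<Rightarrow> 'a" assume V: "finite V"
    let ?n = "real (card V)"
    let ?B = "{y \<in> V \<rightarrow>\<^sub>E A. real (hamming V x y) \<le> \<delta> * ?n}"
    have fin: "finite (V \<rightarrow>\<^sub>E A)" using V A by (intro finite_PiE) auto
    have "real (card ?B) * exp (\<delta> * ?n * ln t) = (\<Sum>y\<in>?B. exp (\<delta> * ?n * ln t))" by simp
    also have "\<dots> \<le> (\<Sum>y\<in>?B. t ^ hamming V x y)"
    proof (rule sum_mono)
      fix y assume "y \<in> ?B"
      then have "\<delta> * ?n * ln t \<le> real (hamming V x y) * ln t"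
        using lnt by (intro mult_right_mono_neg) auto
      then have "exp (\<delta> * ?n * ln t) \<le> exp (real (hamming V x y) * ln t)" by simp
      also have "\<dots> = t ^ hamming V x y" using t by (simp add: exp_of_nat_mult)
      finally show "exp (\<delta> * ?n * ln t) \<le> t ^ hamming V x y" .
    qed
    also have "\<dots> \<le> (\<Sum>y\<in>V \<rightarrow>\<^sub>E A. t ^ hamming V x y)"
      using fin t by (intro sum_mono2) auto
    also have "\<dots> = (\<Prod>v\<in>V. \<Sum>a\<in>A. if x v = a then 1 else t)" by (rule sum_power_hamming[OF V A])
    also have "\<dots> \<le> (\<Prod>v\<in>V. exp (c / 2))"
    proof (intro prod_mono conjI sum_nonneg)
      fix v
      have "(\<Sum>a\<in>A. if x v = a then 1 else t) \<le> (\<Sum>a\<in>A. (if a = x v then 1 else 0) + t)"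
        using t by (intro sum_mono) auto
      also have "\<dots> \<le> 1 + real (card A) * t" using A by (simp add: sum.distrib)
      also have "\<dots> \<le> 1 + c / 2" using At by simp
      also have "\<dots> \<le> exp (c / 2)" by (rule exp_ge_add_one_self)
      finally show "(\<Sum>a\<in>A. if x v = a then 1 else t) \<le> exp (c / 2)" .
    qed (use t in auto)
    also have "\<dots> = exp (?n * (c / 2))" by (subst exp_of_nat_mult) simp
    finally have "real (card ?B) \<le> exp (?n * (c / 2)) / exp (\<delta> * ?n * ln t)" by (simp add: field_simps)
    also have "\<dots> = exp (?n * (c / 2) + ?n * (\<delta> * (- ln t)))" by (simp add: exp_diff[symmetric] algebra_simps)
    also have "\<dots> \<le> exp (?n * (c / 2) + ?n * (c / 2))" using \<delta>t by (intro exp_le_cancel_iff[THEN iffD2] add_left_mono mult_left_mono) auto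
    also have "\<dots> = exp (c * ?n)" by (simp add: algebra_simps)
    finally show "real (card ?B) \<le> exp (c * ?n)" .
  qed
qed

section \<open>Gibbs kernels and the uniqueness regime\<close>

text \<open>
  Tychonoff's theorem for families of numbers in the unit interval, in the form of a finer filter
  along which all coordinates converge.
\<close>

lemma filter_cluster_point:
  fixes q :: "'i \<Rightarrow> 'e \<Rightarrow> real"
  assumes "F \<noteq> bot" "\<And>i e. q i e \<in> {0..1}"
  shows "\<exists>\<rho> F'. F' \<le> F \<and> F' \<noteq> bot \<and> (\<forall>e. ((\<lambda>i. q i e) \<longlongrightarrow> \<rho> e) F')"
proof -
  have "compactin (product_topology (\<lambda>_. euclidean) UNIV) (PiE (UNIV :: 'e set) (\<lambda>_. {0..1::real}))"
    unfolding compactin_PiE by simp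
  then have "compact (PiE (UNIV :: 'e set) (\<lambda>_. {0..1::real}))"
    by (simp add: euclidean_product_topology)
  moreover have "filtermap q F \<noteq> bot" using assms(1) by (simp add: filtermap_bot_iff)
  moreover have "eventually (\<lambda>f. f \<in> PiE UNIV (\<lambda>_. {0..1})) (filtermap q F)"
    using assms(2) by (simp add: eventually_filtermap PiE_UNIV_domain)
  ultimately obtain \<rho> where \<rho>: "inf (nhds \<rho>) (filtermap q F) \<noteq> bot"
    unfolding compact_filter by blast
  define F' where "F' = inf F (filtercomap q (nhds \<rho>))"
  have "F' \<noteq> bot"
  proof
    assume "F' = bot"
    then have "eventually (\<lambda>_. False) F'" by simp
    then obtain P Q where PQ: "eventually P F" "eventually Q (filtercomap q (nhds \<rho>))"
      "\<And>x. P x \<Longrightarrow> Q x \<Longrightarrow> False" unfolding F'_def eventually_inf by auto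
    then obtain S where S: "eventually S (nhds \<rho>)" "\<And>x. S (q x) \<Longrightarrow> Q x"
      unfolding eventually_filtercomap by auto
    have "eventually (\<lambda>f. \<not> S f) (filtermap q F)"
      unfolding eventually_filtermap using PQ(1) by (rule eventually_mono) (use PQ(3) S(2) in blast)
    with S(1) have "eventually (\<lambda>_. False) (inf (nhds \<rho>) (filtermap q F))"
      unfolding eventually_inf by blast
    with \<rho> show False by (simp add: eventually_False)
  qed
  moreover have "F' \<le> F" by (simp add: F'_def)
  moreover have "((\<lambda>i. q i e) \<longlongrightarrow> \<rho> e) F'" for e
  proof -
    have "filterlim q (nhds \<rho>) F'"
      by (rule filterlim_mono[OF filterlim_filtercomap order_refl]) (simp add: F'_def)
    moreover have "((\<lambda>f. f e) \<longlongrightarrow> \<rho> e) (at \<rho>)"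
      using continuous_on_product_coordinates[of e, where ?'b = real] by (simp add: continuous_on_def)
    then have "((\<lambda>f. f e) \<longlongrightarrow> \<rho> e) (nhds \<rho>)"
      by (rule tendsto_at_iff_tendsto_nhds[where g = "\<lambda>f. f e", THEN iffD1])
    ultimately show ?thesis by (rule filterlim_compose[rotated])
  qed
  ultimately show ?thesis by blast
qed

lemma sum_le_by_fibres:
  fixes F w :: "'x \<Rightarrow> real"
  assumes "finite S"
    and "\<And>x. x \<in> S \<Longrightarrow> \<bar>\<Sum>y\<in>{y\<in>S. r y = r x}. F y\<bar> \<le> (\<Sum>y\<in>{y\<in>S. r y = r x}. w y)"
  shows "\<bar>\<Sum>x\<in>S. F x\<bar> \<le> (\<Sum>x\<in>S. w x)"
proof -
  have "\<bar>\<Sum>x\<in>S. F x\<bar> = \<bar>\<Sum>k\<in>r ` S. \<Sum>y\<in>{y\<in>S. r y = k}. F y\<bar>"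
    using sum.image_gen[OF assms(1), of F r] by simp
  also have "\<dots> \<le> (\<Sum>k\<in>r ` S. \<bar>\<Sum>y\<in>{y\<in>S. r y = k}. F y\<bar>)" by (rule sum_abs)
  also have "\<dots> \<le> (\<Sum>k\<in>r ` S. \<Sum>y\<in>{y\<in>S. r y = k}. w y)"
    by (intro sum_mono) (use assms(2) in auto)
  also have "\<dots> = (\<Sum>x\<in>S. w x)" using sum.image_gen[OF assms(1), of w r] by simp
  finally show ?thesis .
qed

locale configurations = group G for G :: "('g, 'b) monoid_scheme" (structure) +
  fixes A :: "'a set"
  assumes finite_A: "finite A" and A_ne: "A \<noteq> {}"
begin

abbreviation \<Omega> :: "('g \<Rightarrow> 'a) set" where "\<Omega> \<equiv> carrier G \<rightarrow>\<^sub>E A"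

lemma space_config: "space (config_space G A) = \<Omega>"
  by (simp add: config_space_def space_PiM)

text \<open>
  A reference configuration, used to extend patterns on a finite window to all of \<open>G\<close>.
\<close>

definition base :: "'g \<Rightarrow> 'a" where "base = (\<lambda>g\<in>carrier G. SOME a. a \<in> A)"

lemma base_in: "base \<in> \<Omega>"
proof -
  have "(SOME a. a \<in> A) \<in> A" using A_ne by (simp add: some_in_eq)
  then show ?thesis by (simp add: base_def)
qed

definition overlay :: "'g set \<Rightarrow> ('g \<Rightarrow> 'a) \<Rightarrow> ('g \<Rightarrow> 'a) \<Rightarrow> 'g \<Rightarrow> 'a" where
  "overlay \<Lambda> z x = (\<lambda>g\<in>carrier G. if g \<in> \<Lambda> then z g else x g)"

lemma overlay_in: "z \<in> \<Lambda> \<rightarrow>\<^sub>E A \<Longrightarrow> x \<in> \<Omega> \<Longrightarrow> overlay \<Lambda> z x \<in> \<Omega>"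
  by (auto simp: overlay_def PiE_iff)

definition depends_on :: "'g set \<Rightarrow> (('g \<Rightarrow> 'a) \<Rightarrow> 'r) \<Rightarrow> bool" where
  "depends_on K f \<longleftrightarrow> finite K \<and> K \<subseteq> carrier G \<and>
     (\<forall>x\<in>\<Omega>. \<forall>y\<in>\<Omega>. (\<forall>k\<in>K. x k = y k) \<longrightarrow> f x = f y)"

lemma depends_onD:
  "depends_on K f \<Longrightarrow> x \<in> \<Omega> \<Longrightarrow> y \<in> \<Omega> \<Longrightarrow> (\<And>k. k \<in> K \<Longrightarrow> x k = y k) \<Longrightarrow> f x = f y"
  unfolding depends_on_def by blast

lemma depends_on_compose:
  assumes "depends_on K f"
  shows "depends_on K (\<lambda>x. h (f x))"
proof -
  have "h (f x) = h (f y)" if "x \<in> \<Omega>" "y \<in> \<Omega>" "\<forall>k\<in>K. x k = y k" for x y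
    using depends_onD[OF assms that(1,2)] that(3) by (intro arg_cong[where f = h]) blast
  then show ?thesis using assms unfolding depends_on_def by blast
qed

lemma depends_on_expand:
  fixes f :: "('g \<Rightarrow> 'a) \<Rightarrow> real"
  assumes f: "depends_on K f" and x: "x \<in> \<Omega>"
  shows "f x = (\<Sum>z\<in>K \<rightarrow>\<^sub>E A. f (overlay K z base) * of_bool (restrict x K = z))"
proof -
  have K: "finite K" "K \<subseteq> carrier G" using f by (auto simp: depends_on_def)
  have rK: "restrict x K \<in> K \<rightarrow>\<^sub>E A" using x K(2) by (auto simp: PiE_iff)
  have "(\<Sum>z\<in>K \<rightarrow>\<^sub>E A. f (overlay K z base) * of_bool (restrict x K = z)) =
     (\<Sum>z\<in>{restrict x K}. f (overlay K z base) * of_bool (restrict x K = z))"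
    using rK K finite_A by (intro sum.mono_neutral_right finite_PiE) auto
  also have "\<dots> = f (overlay K (restrict x K) base)" by simp
  also have "\<dots> = f x"
    using rK K by (intro depends_onD[OF f] overlay_in base_in x) (auto simp: overlay_def)
  finally show ?thesis by simp
qed

lemma cylinder_sets:
  assumes "finite K" "K \<subseteq> carrier G" "z \<in> K \<rightarrow>\<^sub>E A"
  shows "{x\<in>\<Omega>. restrict x K = z} \<in> sets (config_space G A)"
proof -
  have "{x\<in>\<Omega>. restrict x K = z} = prod_emb (carrier G) (\<lambda>_. count_space A) K (PiE K (\<lambda>k. {z k}))"
    using assms by (auto simp: prod_emb_def space_PiM PiE_singleton PiE_iff extensional_def)
  also have "\<dots> \<in> sets (config_space G A)"
    unfolding config_space_def using assms by (intro sets_PiM_I) auto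
  finally show ?thesis .
qed

lemma local_event_sets:
  assumes E: "depends_on K (\<lambda>x. x \<in> E)" "E \<subseteq> \<Omega>"
  shows "E \<in> sets (config_space G A)"
proof -
  have K: "finite K" "K \<subseteq> carrier G" using E by (auto simp: depends_on_def)
  have "E = (\<Union>z\<in>(\<lambda>x. restrict x K) ` E. {x\<in>\<Omega>. restrict x K = z})"
  proof (intro equalityI subsetI)
    fix x assume "x \<in> (\<Union>z\<in>(\<lambda>x. restrict x K) ` E. {x\<in>\<Omega>. restrict x K = z})"
    then obtain y where y: "y \<in> E" "x \<in> \<Omega>" "restrict x K = restrict y K" by auto
    then have "x k = y k" if "k \<in> K" for k using that by (metis restrict_apply')
    then show "x \<in> E" using depends_onD[OF E(1), of x y] y E(2) by auto
  qed (use E in auto)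
  moreover have sub: "(\<lambda>x. restrict x K) ` E \<subseteq> K \<rightarrow>\<^sub>E A" using E(2) K by (fastforce simp: PiE_iff)
  then have "finite ((\<lambda>x. restrict x K) ` E)"
    by (rule finite_subset) (use K finite_A in \<open>auto intro!: finite_PiE\<close>)
  then have "(\<Union>z\<in>(\<lambda>x. restrict x K) ` E. {x\<in>\<Omega>. restrict x K = z}) \<in> sets (config_space G A)"
    by (intro sets.finite_UN cylinder_sets K subsetD[OF sub])
  ultimately show ?thesis by (simp only:)
qed

lemma depends_on_measurable:
  fixes f :: "('g \<Rightarrow> 'a) \<Rightarrow> real"
  assumes "depends_on K f"
  shows "f \<in> borel_measurable (config_space G A)"
proof -
  have K: "finite K" "K \<subseteq> carrier G" using assms by (auto simp: depends_on_def)
  have "(\<lambda>x. \<Sum>z\<in>K \<rightarrow>\<^sub>E A. f (overlay K z base) * indicator {x\<in>\<Omega>. restrict x K = z} x)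
      \<in> borel_measurable (config_space G A)"
    using cylinder_sets[OF K] by (intro borel_measurable_sum borel_measurable_times borel_measurable_indicator) auto
  then show ?thesis
    by (rule measurable_cong[THEN iffD1, rotated])
       (simp add: depends_on_expand[OF assms, symmetric] space_config indicator_def of_bool_def[symmetric]
          flip: of_bool_def cong: conj_cong)
qed

lemma integral_depends_on:
  fixes f :: "('g \<Rightarrow> 'a) \<Rightarrow> real"
  assumes f: "depends_on K f" and \<mu>: "borel_prob G A \<mu>"
  shows "integrable \<mu> f"
    and "integral\<^sup>L \<mu> f = (\<Sum>z\<in>K \<rightarrow>\<^sub>E A. f (overlay K z base) * measure \<mu> {x\<in>\<Omega>. restrict x K = z})"
proof -
  interpret prob_space \<mu> using \<mu> by (simp add: borel_prob_def)
  have K: "finite K" "K \<subseteq> carrier G" using f by (auto simp: depends_on_def)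
  have sets: "sets \<mu> = sets (config_space G A)" using \<mu> by (simp add: borel_prob_def)
  have space: "space \<mu> = \<Omega>" using sets_eq_imp_space_eq[OF sets] by (simp add: space_config)
  let ?h = "\<lambda>x. \<Sum>z\<in>K \<rightarrow>\<^sub>E A. f (overlay K z base) * indicator {x\<in>\<Omega>. restrict x K = z} x"
  have cyl: "{x\<in>\<Omega>. restrict x K = z} \<in> sets \<mu>" if "z \<in> K \<rightarrow>\<^sub>E A" for z
    using cylinder_sets[OF K that] sets by simp
  have eq: "f x = ?h x" if "x \<in> space \<mu>" for x
    using depends_on_expand[OF f, of x] that space by (simp add: indicator_def)
  have int: "integrable \<mu> (\<lambda>x. f (overlay K z base) * indicator {x\<in>\<Omega>. restrict x K = z} x)"
    if "z \<in> K \<rightarrow>\<^sub>E A" for z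
    using cyl[OF that] by (intro integrable_mult_right integrable_real_indicator) (auto simp: emeasure_eq_measure)
  have "integrable \<mu> ?h" using int by (intro Bochner_Integration.integrable_sum) auto
  then show "integrable \<mu> f" by (subst Bochner_Integration.integrable_cong[OF refl eq])
  have "integral\<^sup>L \<mu> f = integral\<^sup>L \<mu> ?h" using eq by (intro Bochner_Integration.integral_cong) auto
  also have "\<dots> = (\<Sum>z\<in>K \<rightarrow>\<^sub>E A. f (overlay K z base) * measure \<mu> {x\<in>\<Omega>. restrict x K = z})"
    using int cyl sets.sets_into_space by (subst Bochner_Integration.integral_sum) (auto simp: Int_absorb2 space)
  finally show "integral\<^sup>L \<mu> f = (\<Sum>z\<in>K \<rightarrow>\<^sub>E A. f (overlay K z base) * measure \<mu> {x\<in>\<Omega>. restrict x K = z})" .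
qed

text \<open>
  Kolmogorov extension. Continuity at the empty set holds because a decreasing sequence of nonempty
  events of finite windows has a common point, the product of finite discrete spaces being compact.
\<close>

lemma measure_of_finitely_additive:
  fixes \<rho> :: "('g \<Rightarrow> 'a) set \<Rightarrow> real"
  assumes pos: "\<And>E. 0 \<le> \<rho> E" and total: "\<rho> \<Omega> = 1"
    and add: "\<And>E F. E \<subseteq> \<Omega> \<Longrightarrow> F \<subseteq> \<Omega> \<Longrightarrow> E \<inter> F = {} \<Longrightarrow> \<rho> (E \<union> F) = \<rho> E + \<rho> F"
  shows "\<exists>\<mu>. borel_prob G A \<mu> \<and> (\<forall>K E. depends_on K (\<lambda>x. x \<in> E) \<longrightarrow> E \<subseteq> \<Omega> \<longrightarrow> measure \<mu> E = \<rho> E)"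
proof -
  have empty: "\<rho> {} = 0" using add[OF empty_subsetI empty_subsetI] by simp
  have fin_add: "\<rho> (\<Union>i\<in>I. E i) = (\<Sum>i\<in>I. \<rho> (E i))"
    if "finite I" "\<And>i. i \<in> I \<Longrightarrow> E i \<subseteq> \<Omega>" "disjoint_family_on E I" for I and E :: "('g \<Rightarrow> 'a) \<Rightarrow> ('g \<Rightarrow> 'a) set"
    using that
  proof (induction I rule: finite_induct)
    case (insert i I)
    have "\<rho> (E i \<union> (\<Union>i\<in>I. E i)) = \<rho> (E i) + \<rho> (\<Union>i\<in>I. E i)"
    proof (rule add)
      show "E i \<inter> (\<Union>i\<in>I. E i) = {}" using insert by (auto simp: disjoint_family_on_def)
    qed (use insert in auto)
    moreover have "disjoint_family_on E I" using insert.prems(2) by (rule disjoint_family_on_mono[rotated]) auto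
    ultimately show ?case using insert by auto
  qed (simp add: empty)
  let ?M = "\<lambda>_::'g. count_space A"
  let ?cyl = "\<lambda>J Y. {x\<in>\<Omega>. restrict x J \<in> Y}"
  define P where "P J = point_measure (J \<rightarrow>\<^sub>E A) (\<lambda>z. ennreal (\<rho> (?cyl J {z})))" for J
  have finJ: "finite (J \<rightarrow>\<^sub>E A)" if "finite J" for J using that finite_A by (intro finite_PiE) auto
  have PiM: "Pi\<^sub>M J ?M = count_space (J \<rightarrow>\<^sub>E A)" if "finite J" for J
    using that finite_A by (intro count_space_PiM_finite) (auto intro: countable_finite)
  have P_eq: "emeasure (P J) Y = ennreal (\<rho> (?cyl J Y))" if J: "finite J" "J \<subseteq> carrier G" and Y: "Y \<subseteq> J \<rightarrow>\<^sub>E A" for J Y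
  proof -
    have "emeasure (P J) Y = (\<Sum>z\<in>Y. ennreal (\<rho> (?cyl J {z})))"
      unfolding P_def using finJ[OF J(1)] Y by (rule emeasure_point_measure_finite)
    also have "\<dots> = ennreal (\<Sum>z\<in>Y. \<rho> (?cyl J {z}))" using pos by (rule sum_ennreal)
    also have "(\<Sum>z\<in>Y. \<rho> (?cyl J {z})) = \<rho> (\<Union>z\<in>Y. ?cyl J {z})"
      using finJ[OF J(1)] Y by (intro fin_add[symmetric]) (auto intro: finite_subset simp: disjoint_family_on_def)
    also have "(\<Union>z\<in>Y. ?cyl J {z}) = ?cyl J Y" by auto
    finally show ?thesis .
  qed
  have sets_P: "sets (P J) = Pow (J \<rightarrow>\<^sub>E A)" for J by (simp add: P_def sets_point_measure)
  have space_P: "space (P J) = J \<rightarrow>\<^sub>E A" for J by (simp add: P_def space_point_measure)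
  interpret projective_family "carrier G" P ?M
  proof (rule projective_family.intro)
    fix J H assume JH: "J \<subseteq> H" "finite H" "H \<subseteq> carrier G"
    then have J: "finite J" "J \<subseteq> carrier G" by (auto intro: finite_subset)
    have meas: "(\<lambda>f. restrict f J) \<in> measurable (P H) (Pi\<^sub>M J ?M)"
      unfolding PiM[OF J(1)] using JH by (auto simp: measurable_def space_P sets_P)
    show "P J = distr (P H) (Pi\<^sub>M J ?M) (\<lambda>f. restrict f J)"
    proof (rule measure_eqI)
      fix Y assume "Y \<in> sets (P J)"
      then have Y: "Y \<subseteq> J \<rightarrow>\<^sub>E A" by (simp add: sets_P)
      have "emeasure (distr (P H) (Pi\<^sub>M J ?M) (\<lambda>f. restrict f J)) Y =
          emeasure (P H) ((\<lambda>f. restrict f J) -` Y \<inter> space (P H))"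
        using meas Y by (intro emeasure_distr) (simp_all add: PiM[OF J(1)])
      also have "\<dots> = ennreal (\<rho> (?cyl H ((\<lambda>f. restrict f J) -` Y \<inter> space (P H))))"
        using JH by (intro P_eq) (auto simp: space_P)
      also have "?cyl H ((\<lambda>f. restrict f J) -` Y \<inter> space (P H)) = ?cyl J Y"
        using JH by (auto simp: space_P Int_absorb1 Int_absorb2)
      also have "ennreal (\<rho> (?cyl J Y)) = emeasure (P J) Y" using P_eq[OF J Y] by simp
      finally show "emeasure (P J) Y = emeasure (distr (P H) (Pi\<^sub>M J ?M) (\<lambda>f. restrict f J)) Y" by (rule sym)
    qed (simp add: sets_P PiM[OF J(1)])
  next
    fix J assume J: "finite J" "J \<subseteq> carrier G"
    have "?cyl J (J \<rightarrow>\<^sub>E A) = \<Omega>" using J by auto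
    then show "prob_space (P J)"
      using P_eq[OF J order_refl] total by (intro prob_spaceI) (simp add: space_P)
  qed
  have emb: "emb (carrier G) J Y = ?cyl J Y" if "J \<subseteq> carrier G" for J Y
    by (auto simp: prod_emb_def space_PiM)
  let ?T = "product_topology (\<lambda>_. discrete_topology A) (carrier G)"
  have compact: "compact_space ?T"
    unfolding compact_space_product_topology using finite_A by (simp add: compact_space_discrete_topology)
  have closed: "closedin ?T (?cyl J Y)" if J: "finite J" "J \<subseteq> carrier G" and Y: "Y \<subseteq> J \<rightarrow>\<^sub>E A" for J Y
  proof -
    \<comment> \<open>The identity is inserted only to keep the index set of the intersection nonempty.\<close>
    have "closedin ?T (\<Inter>j\<in>insert \<one> J. {x\<in>topspace ?T. j \<in> J \<longrightarrow> x j \<in> {z j}})" if z: "z \<in> Y" for z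
    proof (intro closedin_INT)
      fix j
      show "closedin ?T {x\<in>topspace ?T. j \<in> J \<longrightarrow> x j \<in> {z j}}"
      proof (cases "j \<in> J")
        case True
        then have "closedin ?T {x\<in>topspace ?T. x j \<in> {z j}}"
          using J Y z continuous_map_product_projection[of j "carrier G" "\<lambda>_. discrete_topology A"]
          by (intro closedin_continuous_map_preimage[of _ "discrete_topology A"]) auto
        with True show ?thesis by simp
      next
        case False
        then show ?thesis by (simp del: topspace_product_topology)
      qed
    qed auto
    then have "closedin ?T (\<Union>z\<in>Y. \<Inter>j\<in>insert \<one> J. {x\<in>topspace ?T. j \<in> J \<longrightarrow> x j \<in> {z j}})"
      using finite_subset[OF Y finJ[OF J(1)]] by (intro closedin_Union) auto
    also have "(\<Union>z\<in>Y. \<Inter>j\<in>insert \<one> J. {x\<in>topspace ?T. j \<in> J \<longrightarrow> x j \<in> {z j}}) = ?cyl J Y"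
    proof (intro equalityI subsetI)
      fix x assume "x \<in> (\<Union>z\<in>Y. \<Inter>j\<in>insert \<one> J. {x\<in>topspace ?T. j \<in> J \<longrightarrow> x j \<in> {z j}})"
      then obtain z where z: "z \<in> Y" "x \<in> \<Omega>" "\<And>j. j \<in> J \<Longrightarrow> x j = z j" by auto
      then have "restrict x J = z" using Y by (intro ext) (auto simp: PiE_iff extensional_def)
      then show "x \<in> ?cyl J Y" using z by auto
    next
      fix x assume "x \<in> ?cyl J Y"
      then show "x \<in> (\<Union>z\<in>Y. \<Inter>j\<in>insert \<one> J. {x\<in>topspace ?T. j \<in> J \<longrightarrow> x j \<in> {z j}})"
        by (intro UN_I[of "restrict x J"]) auto
    qed
    finally show ?thesis .
  qed
  have lim: "emeasure lim (emb (carrier G) J Y) = P J Y" if JY: "finite J" "J \<subseteq> carrier G" "Y \<in> sets (Pi\<^sub>M J ?M)" for J Y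
  proof (rule emeasure_lim[OF JY])
    fix J and Y :: "nat \<Rightarrow> ('g \<Rightarrow> 'a) set"
    assume J: "\<And>i. J i \<subseteq> carrier G" "\<And>i. finite (J i)" and Y: "\<And>i. Y i \<in> sets (Pi\<^sub>M (J i) ?M)"
      and dec: "decseq (\<lambda>i. emb (carrier G) (J i) (Y i))" and inf: "0 < (INF i. P (J i) (Y i))"
    have Y': "Y i \<subseteq> J i \<rightarrow>\<^sub>E A" for i using Y[of i] by (simp add: PiM[OF J(2)])
    show "(\<Inter>i. emb (carrier G) (J i) (Y i)) \<noteq> {}"
    proof (rule compact_space_imp_nest[OF compact _ _ dec])
      fix i
      show "closedin ?T (emb (carrier G) (J i) (Y i))"
        unfolding emb[OF J(1)] by (rule closed[OF J(2,1) Y'])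
      have "0 < P (J i) (Y i)" using inf by (rule less_le_trans) (auto intro: INF_lower)
      then have "\<rho> (?cyl (J i) (Y i)) \<noteq> 0" using P_eq[OF J(2,1) Y'] by auto
      then show "emb (carrier G) (J i) (Y i) \<noteq> {}" unfolding emb[OF J(1)] using empty by metis
    qed
  qed
  have sets_lim': "sets lim = sets (config_space G A)" by (simp add: config_space_def)
  have space_lim': "space lim = \<Omega>" by (simp add: space_PiM)
  have main: "emeasure lim E = ennreal (\<rho> E)" if E: "depends_on K (\<lambda>x. x \<in> E)" "E \<subseteq> \<Omega>" for K E
  proof -
    have K: "finite K" "K \<subseteq> carrier G" using E by (auto simp: depends_on_def)
    let ?Y = "(\<lambda>x. restrict x K) ` E"
    have Y: "?Y \<subseteq> K \<rightarrow>\<^sub>E A" using E(2) K by (fastforce simp: PiE_iff)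
    have "?cyl K ?Y = E"
    proof (intro equalityI subsetI)
      fix x assume "x \<in> ?cyl K ?Y"
      then obtain y where y: "y \<in> E" "x \<in> \<Omega>" "restrict x K = restrict y K" by auto
      then have "x k = y k" if "k \<in> K" for k using that by (metis restrict_apply')
      then show "x \<in> E" using depends_onD[OF E(1), of x y] y E(2) by auto
    qed (use E in auto)
    then show ?thesis using lim[OF K, of ?Y] P_eq[OF K Y] Y emb[OF K(2)] by (simp add: PiM[OF K(1)])
  qed
  have "emeasure lim \<Omega> = 1" using main[of "{}" \<Omega>] total by (simp add: depends_on_def)
  then have "prob_space lim" by (intro prob_spaceI) (simp add: space_lim' del: space_lim)
  moreover have "measure lim E = \<rho> E" if "depends_on K (\<lambda>x. x \<in> E)" "E \<subseteq> \<Omega>" for K E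
    using main[OF that] pos by (simp add: measure_def)
  ultimately show ?thesis using sets_lim' by (intro exI[of _ lim]) (auto simp: borel_prob_def)
qed

end

locale lattice_potential = configurations G A
  for G :: "('g, 'b) monoid_scheme" (structure) and A :: "'a set" +
  fixes D :: "'g set" and \<phi> :: "('g \<Rightarrow> 'a) \<Rightarrow> real"
  assumes potential: "potential G A D \<phi>"
begin

lemma finite_D: "finite D" and D_sub: "D \<subseteq> carrier G"
  using potential by (auto simp: potential_def)

lemma \<phi>_cong: "x \<in> \<Omega> \<Longrightarrow> y \<in> \<Omega> \<Longrightarrow> (\<And>d. d \<in> D \<Longrightarrow> x d = y d) \<Longrightarrow> \<phi> x = \<phi> y"
  using potential unfolding potential_def space_config by blast

lemma shift_apply: "h \<in> carrier G \<Longrightarrow> shift G g x h = x (h \<otimes> g)"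
  by (simp add: shift_def)

lemma shift_in: "g \<in> carrier G \<Longrightarrow> x \<in> \<Omega> \<Longrightarrow> shift G g x \<in> \<Omega>"
  by (auto simp: shift_def PiE_iff)

lemma \<phi>_shift_cong:
  assumes "g \<in> carrier G" "x \<in> \<Omega>" "y \<in> \<Omega>" "\<And>d. d \<in> D \<Longrightarrow> x (d \<otimes> g) = y (d \<otimes> g)"
  shows "\<phi> (shift G g x) = \<phi> (shift G g y)"
  using assms D_sub by (intro \<phi>_cong shift_in) (auto simp: shift_apply)

definition interacting :: "'g set \<Rightarrow> 'g set" where
  "interacting \<Lambda> = {g \<in> carrier G. (D #> g) \<inter> \<Lambda> \<noteq> {}}"

lemma interacting_iff: "g \<in> interacting \<Lambda> \<longleftrightarrow> g \<in> carrier G \<and> (\<exists>d\<in>D. d \<otimes> g \<in> \<Lambda>)"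
  by (auto simp: interacting_def r_coset_def)

lemma finite_interacting:
  assumes "finite \<Lambda>" "\<Lambda> \<subseteq> carrier G"
  shows "finite (interacting \<Lambda>)"
proof (rule finite_subset)
  show "interacting \<Lambda> \<subseteq> (\<lambda>(d, l). inv d \<otimes> l) ` (D \<times> \<Lambda>)"
  proof
    fix g assume "g \<in> interacting \<Lambda>"
    then obtain d where d: "d \<in> D" "d \<otimes> g \<in> \<Lambda>" "g \<in> carrier G" by (auto simp: interacting_iff)
    then have "g = inv d \<otimes> (d \<otimes> g)" using D_sub by (simp add: m_assoc[symmetric] subsetD)
    then show "g \<in> (\<lambda>(d, l). inv d \<otimes> l) ` (D \<times> \<Lambda>)" using d by force
  qed
qed (use assms finite_D in auto)

lemma boltzmann_eq: "boltzmann G D \<phi> \<Lambda> y = exp (- (\<Sum>g\<in>interacting \<Lambda>. \<phi> (shift G g y)))"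
  by (simp add: boltzmann_def interacting_def)

lemma boltzmann_pos: "0 < boltzmann G D \<phi> \<Lambda> y"
  by (simp add: boltzmann_eq)

lemma sum_agreeing:
  fixes f :: "('g \<Rightarrow> 'a) \<Rightarrow> real"
  assumes \<Lambda>: "\<Lambda> \<subseteq> carrier G" and x: "x \<in> \<Omega>"
  shows "(\<Sum>y\<in>agreeing G A \<Lambda> x. f y) = (\<Sum>z\<in>\<Lambda> \<rightarrow>\<^sub>E A. f (overlay \<Lambda> z x))"
proof (rule sum.reindex_bij_witness[where i = "\<lambda>z. overlay \<Lambda> z x" and j = "\<lambda>y. restrict y \<Lambda>"])
  fix y assume y: "y \<in> agreeing G A \<Lambda> x"
  then show "overlay \<Lambda> (restrict y \<Lambda>) x = y"
    by (intro ext) (auto simp: overlay_def agreeing_def space_config PiE_iff extensional_def)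
  then show "f (overlay \<Lambda> (restrict y \<Lambda>) x) = f y" by simp
  show "restrict y \<Lambda> \<in> \<Lambda> \<rightarrow>\<^sub>E A" using y \<Lambda> by (auto simp: agreeing_def space_config PiE_iff)
next
  fix z assume z: "z \<in> \<Lambda> \<rightarrow>\<^sub>E A"
  show "restrict (overlay \<Lambda> z x) \<Lambda> = z"
    using z \<Lambda> by (intro ext) (auto simp: overlay_def PiE_iff extensional_def restrict_def)
  show "overlay \<Lambda> z x \<in> agreeing G A \<Lambda> x"
    using overlay_in[OF z x] by (auto simp: agreeing_def space_config overlay_def)
qed

lemma finite_agreeing:
  assumes "finite \<Lambda>" "\<Lambda> \<subseteq> carrier G"
  shows "finite (agreeing G A \<Lambda> x)"
proof (rule finite_imageD[where f = "\<lambda>y. restrict y \<Lambda>"])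
  show "finite ((\<lambda>y. restrict y \<Lambda>) ` agreeing G A \<Lambda> x)"
  proof (rule finite_subset)
    show "(\<lambda>y. restrict y \<Lambda>) ` agreeing G A \<Lambda> x \<subseteq> \<Lambda> \<rightarrow>\<^sub>E A"
      using assms by (auto simp: agreeing_def space_config PiE_iff)
  qed (use assms finite_A in \<open>auto intro!: finite_PiE\<close>)
  show "inj_on (\<lambda>y. restrict y \<Lambda>) (agreeing G A \<Lambda> x)"
  proof (rule inj_onI, rule ext)
    fix y y' g assume y: "y \<in> agreeing G A \<Lambda> x" "y' \<in> agreeing G A \<Lambda> x" "restrict y \<Lambda> = restrict y' \<Lambda>"
    show "y g = y' g"
    proof (cases "g \<in> \<Lambda>")
      case True
      then show ?thesis using y(3) by (metis restrict_apply')
    next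
      case False
      then show ?thesis using y(1,2)
        by (cases "g \<in> carrier G") (auto simp: agreeing_def space_config PiE_iff extensional_def)
    qed
  qed
qed

lemma self_agreeing: "x \<in> \<Omega> \<Longrightarrow> x \<in> agreeing G A \<Lambda> x"
  by (simp add: agreeing_def space_config)

lemma agreeing_sub: "agreeing G A \<Lambda> x \<subseteq> \<Omega>"
  by (auto simp: agreeing_def space_config)

lemma agreeing_cong:
  "y \<in> agreeing G A \<Lambda> x \<Longrightarrow> agreeing G A \<Lambda> y = agreeing G A \<Lambda> x"
  by (auto simp: agreeing_def)

definition partition_sum :: "'g set \<Rightarrow> ('g \<Rightarrow> 'a) \<Rightarrow> real" where
  "partition_sum \<Lambda> x = (\<Sum>y\<in>agreeing G A \<Lambda> x. boltzmann G D \<phi> \<Lambda> y)"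

text \<open>
  The expectation of \<open>f\<close> under the Gibbs kernel, as a finite sum.
\<close>

definition gibbs_avg :: "'g set \<Rightarrow> ('g \<Rightarrow> 'a) \<Rightarrow> (('g \<Rightarrow> 'a) \<Rightarrow> real) \<Rightarrow> real" where
  "gibbs_avg \<Lambda> x f = (\<Sum>y\<in>agreeing G A \<Lambda> x. boltzmann G D \<phi> \<Lambda> y * f y) / partition_sum \<Lambda> x"

lemma partition_sum_pos:
  assumes "finite \<Lambda>" "\<Lambda> \<subseteq> carrier G" "x \<in> \<Omega>"
  shows "0 < partition_sum \<Lambda> x"
  unfolding partition_sum_def
  using finite_agreeing[OF assms(1,2)] self_agreeing[OF assms(3), of \<Lambda>] boltzmann_pos
  by (intro sum_pos) auto

lemma gibbs_avg_mono:
  assumes "finite \<Lambda>" "\<Lambda> \<subseteq> carrier G" "x \<in> \<Omega>" "\<And>y. y \<in> \<Omega> \<Longrightarrow> f y \<le> g y"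
  shows "gibbs_avg \<Lambda> x f \<le> gibbs_avg \<Lambda> x g"
  unfolding gibbs_avg_def
  using assms partition_sum_pos[OF assms(1-3)] agreeing_sub[of \<Lambda> x]
  by (intro divide_right_mono sum_mono mult_left_mono less_imp_le[OF boltzmann_pos]) auto

lemma gibbs_avg_const:
  assumes "finite \<Lambda>" "\<Lambda> \<subseteq> carrier G" "x \<in> \<Omega>"
  shows "gibbs_avg \<Lambda> x (\<lambda>_. c) = c"
  using partition_sum_pos[OF assms] by (simp add: gibbs_avg_def partition_sum_def sum_distrib_right[symmetric])

lemma gibbs_avg_cong:
  assumes "\<And>y. y \<in> \<Omega> \<Longrightarrow> f y = g y"
  shows "gibbs_avg \<Lambda> x f = gibbs_avg \<Lambda> x g"
  using assms agreeing_sub[of \<Lambda> x] unfolding gibbs_avg_def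
  by (intro arg_cong2[where f = "(/)"] sum.cong refl) auto

lemma gibbs_avg_sum:
  "gibbs_avg \<Lambda> x (\<lambda>y. \<Sum>i\<in>I. c i * f i y) = (\<Sum>i\<in>I. c i * gibbs_avg \<Lambda> x (f i))"
proof -
  have "(\<Sum>y\<in>agreeing G A \<Lambda> x. boltzmann G D \<phi> \<Lambda> y * (\<Sum>i\<in>I. c i * f i y)) =
        (\<Sum>i\<in>I. c i * (\<Sum>y\<in>agreeing G A \<Lambda> x. boltzmann G D \<phi> \<Lambda> y * f i y))"
    unfolding sum_distrib_left by (subst sum.swap) (simp add: mult.left_commute)
  then show ?thesis by (simp only: gibbs_avg_def sum_divide_distrib[where A = I] times_divide_eq_right)
qed

lemma gibbs_avg_add:
  "gibbs_avg \<Lambda> x (\<lambda>y. f y + g y) = gibbs_avg \<Lambda> x f + gibbs_avg \<Lambda> x g"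
  by (simp add: gibbs_avg_def ring_distribs sum.distrib add_divide_distrib)

text \<open>
  The coordinates that enter the energy of \<open>\<Lambda>\<close>.
\<close>

definition dependence_window :: "'g set \<Rightarrow> 'g set" where
  "dependence_window \<Lambda> = \<Lambda> \<union> (\<lambda>(d, g). d \<otimes> g) ` (D \<times> interacting \<Lambda>)"

lemma finite_dependence_window:
  "finite \<Lambda> \<Longrightarrow> \<Lambda> \<subseteq> carrier G \<Longrightarrow> finite (dependence_window \<Lambda>)"
  using finite_interacting finite_D by (auto simp: dependence_window_def)

lemma dependence_window_sub:
  "\<Lambda> \<subseteq> carrier G \<Longrightarrow> dependence_window \<Lambda> \<subseteq> carrier G"
  using D_sub by (auto simp: dependence_window_def interacting_iff)

lemma boltzmann_cong:
  assumes "x \<in> \<Omega>" "y \<in> \<Omega>" "\<And>g. g \<in> dependence_window \<Lambda> \<Longrightarrow> x g = y g"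
  shows "boltzmann G D \<phi> \<Lambda> x = boltzmann G D \<phi> \<Lambda> y"
proof -
  have "\<phi> (shift G g x) = \<phi> (shift G g y)" if "g \<in> interacting \<Lambda>" for g
  proof (rule \<phi>_shift_cong[OF _ assms(1,2)])
    show "g \<in> carrier G" using that by (simp add: interacting_iff)
    fix d assume "d \<in> D"
    then have "d \<otimes> g \<in> dependence_window \<Lambda>" using that by (force simp: dependence_window_def)
    then show "x (d \<otimes> g) = y (d \<otimes> g)" by (rule assms(3))
  qed
  then show ?thesis by (simp add: boltzmann_eq)
qed

lemma gibbs_avg_depends_on:
  fixes f :: "('g \<Rightarrow> 'a) \<Rightarrow> real"
  assumes \<Lambda>: "finite \<Lambda>" "\<Lambda> \<subseteq> carrier G" and f: "depends_on K f"
  shows "depends_on (dependence_window \<Lambda> \<union> K) (\<lambda>x. gibbs_avg \<Lambda> x f)"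
  unfolding depends_on_def
proof (intro conjI ballI impI)
  fix x y assume xy: "x \<in> \<Omega>" "y \<in> \<Omega>" "\<forall>k\<in>dependence_window \<Lambda> \<union> K. x k = y k"
  have eq: "boltzmann G D \<phi> \<Lambda> (overlay \<Lambda> z x) = boltzmann G D \<phi> \<Lambda> (overlay \<Lambda> z y)"
       "f (overlay \<Lambda> z x) = f (overlay \<Lambda> z y)" if z: "z \<in> \<Lambda> \<rightarrow>\<^sub>E A" for z
  proof -
    have "overlay \<Lambda> z x k = overlay \<Lambda> z y k" if "k \<in> dependence_window \<Lambda> \<union> K" for k
      using xy(3) that by (auto simp: overlay_def)
    then show "boltzmann G D \<phi> \<Lambda> (overlay \<Lambda> z x) = boltzmann G D \<phi> \<Lambda> (overlay \<Lambda> z y)"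
       "f (overlay \<Lambda> z x) = f (overlay \<Lambda> z y)"
      using overlay_in[OF z xy(1)] overlay_in[OF z xy(2)]
      by (auto intro: boltzmann_cong intro!: depends_onD[OF f, of "overlay \<Lambda> z x" "overlay \<Lambda> z y"])
  qed
  then show "gibbs_avg \<Lambda> x f = gibbs_avg \<Lambda> y f"
    unfolding gibbs_avg_def partition_sum_def sum_agreeing[OF \<Lambda>(2) xy(1)] sum_agreeing[OF \<Lambda>(2) xy(2)]
    by (intro arg_cong2[where f = "(/)"] sum.cong refl) auto
qed (use f \<Lambda> finite_dependence_window dependence_window_sub in \<open>auto simp: depends_on_def\<close>)

text \<open>
  On each class of configurations that agree off \<open>\<Lambda>\<close>, the Boltzmann weights for \<open>\<Lambda>\<close> and for a
  larger region are proportional, since the additional terms of the energy do not see \<open>\<Lambda>\<close>.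
\<close>

lemma gibbs_avg_consistent:
  assumes \<Lambda>': "finite \<Lambda>'" "\<Lambda>' \<subseteq> carrier G" and sub: "\<Lambda> \<subseteq> \<Lambda>'" and x: "x \<in> \<Omega>"
  shows "gibbs_avg \<Lambda>' x (\<lambda>y. gibbs_avg \<Lambda> y f) = gibbs_avg \<Lambda>' x f"
proof -
  have \<Lambda>: "finite \<Lambda>" "\<Lambda> \<subseteq> carrier G" using \<Lambda>' sub by (auto intro: finite_subset)
  let ?S = "agreeing G A \<Lambda>' x"
  let ?b = "boltzmann G D \<phi>"
  have int_sub: "interacting \<Lambda> \<subseteq> interacting \<Lambda>'" using sub unfolding subset_iff interacting_iff by blast
  have "\<bar>\<Sum>y\<in>?S. ?b \<Lambda>' y * (f y - gibbs_avg \<Lambda> y f)\<bar> \<le> (\<Sum>y\<in>?S. 0)"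
  proof (rule sum_le_by_fibres[where r = "\<lambda>y. restrict y (carrier G - \<Lambda>)", OF finite_agreeing[OF \<Lambda>']])
    fix y assume y: "y \<in> ?S"
    then have y\<Omega>: "y \<in> \<Omega>" using agreeing_sub by blast
    have "restrict y' (carrier G - \<Lambda>) = restrict y (carrier G - \<Lambda>) \<longleftrightarrow> (\<forall>h\<in>carrier G - \<Lambda>. y' h = y h)" for y'
      by (auto simp: restrict_def fun_eq_iff)
    then have cls: "{y' \<in> ?S. restrict y' (carrier G - \<Lambda>) = restrict y (carrier G - \<Lambda>)} = agreeing G A \<Lambda> y"
      using y sub by (auto simp: agreeing_def) (metis DiffI subsetD)
    define c where "c = exp (- (\<Sum>g\<in>interacting \<Lambda>' - interacting \<Lambda>. \<phi> (shift G g y)))"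
    have b: "?b \<Lambda>' y' = c * ?b \<Lambda> y'" if y': "y' \<in> agreeing G A \<Lambda> y" for y'
    proof -
      have y'\<Omega>: "y' \<in> \<Omega>" using y' agreeing_sub by blast
      have "\<phi> (shift G g y') = \<phi> (shift G g y)" if g: "g \<in> interacting \<Lambda>' - interacting \<Lambda>" for g
      proof (rule \<phi>_shift_cong[OF _ y'\<Omega> y\<Omega>])
        show "g \<in> carrier G" using g by (auto simp: interacting_iff)
        fix d assume "d \<in> D"
        then have "d \<otimes> g \<in> carrier G - \<Lambda>" using g D_sub by (auto simp: interacting_iff)
        then show "y' (d \<otimes> g) = y (d \<otimes> g)" using y' by (auto simp: agreeing_def)
      qed
      moreover have "(\<Sum>g\<in>interacting \<Lambda>'. \<phi> (shift G g y')) =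
         (\<Sum>g\<in>interacting \<Lambda>' - interacting \<Lambda>. \<phi> (shift G g y')) + (\<Sum>g\<in>interacting \<Lambda>. \<phi> (shift G g y'))"
        by (rule sum.subset_diff[OF int_sub finite_interacting[OF \<Lambda>']])
      ultimately show ?thesis by (simp add: boltzmann_eq c_def exp_add[symmetric])
    qed
    have "(\<Sum>y'\<in>agreeing G A \<Lambda> y. ?b \<Lambda>' y' * (f y' - gibbs_avg \<Lambda> y' f)) =
        (\<Sum>y'\<in>agreeing G A \<Lambda> y. c * (?b \<Lambda> y' * f y' - ?b \<Lambda> y' * gibbs_avg \<Lambda> y f))"
      using b agreeing_cong[of _ \<Lambda> y]
      by (intro sum.cong) (simp_all add: gibbs_avg_def partition_sum_def algebra_simps)
    also have "\<dots> = c * ((\<Sum>y'\<in>agreeing G A \<Lambda> y. ?b \<Lambda> y' * f y') - partition_sum \<Lambda> y * gibbs_avg \<Lambda> y f)"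
      by (simp add: sum_distrib_left[symmetric] sum_distrib_right[symmetric] sum_subtractf partition_sum_def)
    also have "\<dots> = 0" using partition_sum_pos[OF \<Lambda> y\<Omega>] by (simp add: gibbs_avg_def)
    finally show "\<bar>\<Sum>y'\<in>{y' \<in> ?S. restrict y' (carrier G - \<Lambda>) = restrict y (carrier G - \<Lambda>)}.
        ?b \<Lambda>' y' * (f y' - gibbs_avg \<Lambda> y' f)\<bar> \<le>
        (\<Sum>y'\<in>{y' \<in> ?S. restrict y' (carrier G - \<Lambda>) = restrict y (carrier G - \<Lambda>)}. 0)"
      unfolding cls by simp
  qed
  then have "(\<Sum>y\<in>?S. ?b \<Lambda>' y * f y) = (\<Sum>y\<in>?S. ?b \<Lambda>' y * gibbs_avg \<Lambda> y f)"
    by (simp add: right_diff_distrib sum_subtractf)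
  then show ?thesis by (simp add: gibbs_avg_def[of \<Lambda>'])
qed

lemma emeasure_gibbs_kernel:
  assumes \<Lambda>: "finite \<Lambda>" "\<Lambda> \<subseteq> carrier G" and x: "x \<in> \<Omega>" and E: "E \<in> sets (config_space G A)"
  shows "emeasure (gibbs_kernel G A D \<phi> \<Lambda> x) E = ennreal (gibbs_avg \<Lambda> x (indicator E))"
proof -
  let ?Ag = "agreeing G A \<Lambda> x"
  let ?p = "\<lambda>y. boltzmann G D \<phi> \<Lambda> y / partition_sum \<Lambda> x"
  have pos: "0 \<le> ?p y" for y
    using partition_sum_pos[OF \<Lambda> x] boltzmann_pos[of \<Lambda> y] by simp
  have "emeasure (gibbs_kernel G A D \<phi> \<Lambda> x) E =
      emeasure (point_measure ?Ag (\<lambda>y. ennreal (?p y))) ((\<lambda>y. y) -` E \<inter> ?Ag)"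
    unfolding gibbs_kernel_def partition_sum_def
    using agreeing_sub E by (subst emeasure_distr) (auto simp: measurable_def space_point_measure sets_point_measure space_config)
  also have "\<dots> = (\<Sum>y\<in>?Ag \<inter> E. ennreal (?p y))"
    using finite_agreeing[OF \<Lambda>] by (subst emeasure_point_measure_finite) (auto simp: Int_commute)
  also have "\<dots> = ennreal (\<Sum>y\<in>?Ag \<inter> E. ?p y)" using pos by (rule sum_ennreal)
  also have "(\<Sum>y\<in>?Ag \<inter> E. ?p y) = (\<Sum>y\<in>?Ag. ?p y * indicator E y)"
    unfolding sum.inter_restrict[OF finite_agreeing[OF \<Lambda>]] by (intro sum.cong refl) (simp add: indicator_def)
  also have "\<dots> = gibbs_avg \<Lambda> x (indicator E)"
    by (simp add: gibbs_avg_def sum_divide_distrib)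
  finally show ?thesis .
qed

lemma sets_prod_algebra:
  "sets (config_space G A) = sigma_sets \<Omega> (prod_algebra (carrier G) (\<lambda>_. count_space A))"
  by (simp add: config_space_def sets_PiM)

lemma prod_algebra_local:
  assumes "E \<in> prod_algebra (carrier G) (\<lambda>_. count_space A)"
  obtains K where "depends_on K (\<lambda>x. x \<in> E)" "E \<subseteq> \<Omega>"
proof -
  obtain J X where J: "E = prod_emb (carrier G) (\<lambda>_. count_space A) J (\<Pi>\<^sub>E j\<in>J. X j)"
    "finite J" "J \<subseteq> carrier G"
    using assms by (elim prod_algebraE)
  have "E = {x\<in>\<Omega>. \<forall>j\<in>J. x j \<in> X j}" using J by (auto simp: prod_emb_def space_PiM PiE_iff extensional_def)
  then show thesis using J by (intro that[of J]) (auto simp: depends_on_def)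
qed

lemma indicator_depends_on:
  "depends_on K (\<lambda>x. x \<in> E) \<Longrightarrow> depends_on K (indicator E :: _ \<Rightarrow> real)"
  unfolding indicator_def by (rule depends_on_compose)

lemma gibbs_kernel_measurable:
  assumes \<Lambda>: "finite \<Lambda>" "\<Lambda> \<subseteq> carrier G" and \<mu>: "sets \<mu> = sets (config_space G A)"
  shows "gibbs_kernel G A D \<phi> \<Lambda> \<in> measurable \<mu> (prob_algebra (config_space G A))"
proof (rule measurable_prob_algebra_generated[OF sets_prod_algebra Int_stable_prod_algebra])
  have space: "space \<mu> = \<Omega>" using sets_eq_imp_space_eq[OF \<mu>] by (simp add: space_config)
  show "prod_algebra (carrier G) (\<lambda>_. count_space A) \<subseteq> Pow \<Omega>"
    using prod_algebra_sets_into_space[of "carrier G" "\<lambda>_. count_space A"] by simp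
  show "sets (gibbs_kernel G A D \<phi> \<Lambda> x) = sets (config_space G A)" for x
    by (simp add: gibbs_kernel_def)
  show "prob_space (gibbs_kernel G A D \<phi> \<Lambda> x)" if "x \<in> space \<mu>" for x
  proof (rule prob_spaceI)
    have "emeasure (gibbs_kernel G A D \<phi> \<Lambda> x) \<Omega> = ennreal (gibbs_avg \<Lambda> x (indicator \<Omega>))"
      using that space sets.top[of "config_space G A"]
      by (intro emeasure_gibbs_kernel[OF \<Lambda>]) (auto simp: space_config)
    also have "gibbs_avg \<Lambda> x (indicator \<Omega>) = gibbs_avg \<Lambda> x (\<lambda>_. 1)" by (rule gibbs_avg_cong) simp
    finally show "emeasure (gibbs_kernel G A D \<phi> \<Lambda> x) (space (gibbs_kernel G A D \<phi> \<Lambda> x)) = 1"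
      using gibbs_avg_const[OF \<Lambda>] that space by (simp add: gibbs_kernel_def space_config)
  qed
  fix E assume E: "E \<in> prod_algebra (carrier G) (\<lambda>_. count_space A)"
  then obtain K where K: "depends_on K (\<lambda>x. x \<in> E)" "E \<subseteq> \<Omega>" by (rule prod_algebra_local)
  have "(\<lambda>x. ennreal (gibbs_avg \<Lambda> x (indicator E))) \<in> borel_measurable \<mu>"
    using depends_on_measurable[OF gibbs_avg_depends_on[OF \<Lambda> indicator_depends_on[OF K(1)]]]
    unfolding measurable_cong_sets[OF \<mu> refl] by simp
  then show "(\<lambda>x. emeasure (gibbs_kernel G A D \<phi> \<Lambda> x) E) \<in> borel_measurable \<mu>"
    using local_event_sets[OF K] emeasure_gibbs_kernel[OF \<Lambda>]
    by (subst measurable_cong[where g = "\<lambda>x. ennreal (gibbs_avg \<Lambda> x (indicator E))"]) (auto simp: space)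
qed

text \<open>
  It suffices to check invariance under the kernels on the finite-window events that generate the
  product sigma-algebra.
\<close>

lemma gibbs_measureI:
  assumes \<mu>: "borel_prob G A \<mu>"
    and eq: "\<And>\<Lambda> K E. finite \<Lambda> \<Longrightarrow> \<Lambda> \<subseteq> carrier G \<Longrightarrow> depends_on K (\<lambda>x. x \<in> E) \<Longrightarrow> E \<subseteq> \<Omega> \<Longrightarrow>
      integral\<^sup>L \<mu> (\<lambda>x. gibbs_avg \<Lambda> x (indicator E)) = measure \<mu> E"
  shows "gibbs_measure G A D \<phi> \<mu>"
  unfolding gibbs_measure_def
proof (intro conjI \<mu> allI impI)
  fix \<Lambda> assume \<Lambda>: "finite \<Lambda> \<and> \<Lambda> \<subseteq> carrier G"
  interpret prob_space \<mu> using \<mu> by (simp add: borel_prob_def)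
  have sets: "sets \<mu> = sets (config_space G A)" using \<mu> by (simp add: borel_prob_def)
  have space: "space \<mu> = \<Omega>" using sets_eq_imp_space_eq[OF sets] by (simp add: space_config)
  let ?\<kappa> = "gibbs_kernel G A D \<phi> \<Lambda>"
  let ?P = "prod_algebra (carrier G) (\<lambda>_. count_space A)"
  have meas: "?\<kappa> \<in> measurable \<mu> (prob_algebra (config_space G A))"
    using \<Lambda> sets by (intro gibbs_kernel_measurable) auto
  have \<mu>_in: "\<mu> \<in> space (prob_algebra \<mu>)" by (simp add: space_prob_algebra prob_space_axioms)
  have emb: "emeasure (Giry_Monad.bind \<mu> ?\<kappa>) E = emeasure \<mu> E" if E: "E \<in> ?P" for E
  proof -
    obtain K where K: "depends_on K (\<lambda>x. x \<in> E)" "E \<subseteq> \<Omega>" using E by (rule prod_algebra_local)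
    have E': "E \<in> sets (config_space G A)" by (rule local_event_sets[OF K])
    have dep: "depends_on (dependence_window \<Lambda> \<union> K) (\<lambda>x. gibbs_avg \<Lambda> x (indicator E))"
      using \<Lambda> K by (intro gibbs_avg_depends_on indicator_depends_on) auto
    have "emeasure (Giry_Monad.bind \<mu> ?\<kappa>) E = (\<integral>\<^sup>+x. emeasure (?\<kappa> x) E \<partial>\<mu>)"
      by (rule emeasure_bind_prob_algebra[OF \<mu>_in meas E'])
    also have "\<dots> = (\<integral>\<^sup>+x. ennreal (gibbs_avg \<Lambda> x (indicator E)) \<partial>\<mu>)"
      using \<Lambda> E' space by (intro nn_integral_cong emeasure_gibbs_kernel) auto
    also have "\<dots> = ennreal (integral\<^sup>L \<mu> (\<lambda>x. gibbs_avg \<Lambda> x (indicator E)))"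
    proof (rule nn_integral_eq_integral[OF integral_depends_on(1)[OF dep \<mu>]])
      have "0 \<le> gibbs_avg \<Lambda> x (indicator E)" if "x \<in> \<Omega>" for x
        using gibbs_avg_mono[of \<Lambda> x "\<lambda>_. 0" "indicator E"] gibbs_avg_const[of \<Lambda> x 0] \<Lambda> that by simp
      then show "AE x in \<mu>. 0 \<le> gibbs_avg \<Lambda> x (indicator E)" using space by (intro AE_I2) auto
    qed
    also have "\<dots> = emeasure \<mu> E" using eq[of \<Lambda>] K \<Lambda> by (simp add: emeasure_eq_measure)
    finally show ?thesis .
  qed
  show "Giry_Monad.bind \<mu> ?\<kappa> = \<mu>"
  proof (rule measure_eqI_generator_eq[where E = ?P and \<Omega> = \<Omega> and A = "\<lambda>_. \<Omega>"])
    have "sets (Giry_Monad.bind \<mu> ?\<kappa>) = sets (config_space G A)"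
      by (rule sets_bind) (use space base_in in \<open>auto simp: gibbs_kernel_def\<close>)
    then show "sets (Giry_Monad.bind \<mu> ?\<kappa>) = sigma_sets \<Omega> ?P" by (simp add: sets_prod_algebra)
    show "sets \<mu> = sigma_sets \<Omega> ?P" using sets by (simp add: sets_prod_algebra)
    show "?P \<subseteq> Pow \<Omega>" using prod_algebra_sets_into_space[of "carrier G" "\<lambda>_. count_space A"] by simp
    have "\<Omega> \<in> ?P" using space_in_prod_algebra[of "carrier G" "\<lambda>_. count_space A"] by simp
    then show "range (\<lambda>_. \<Omega>) \<subseteq> ?P" "\<And>i. emeasure (Giry_Monad.bind \<mu> ?\<kappa>) \<Omega> \<noteq> \<infinity>"
      using emb by (auto simp: emeasure_eq_measure)
  qed (use emb Int_stable_prod_algebra in auto)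
qed

text \<open>
  If boundary conditions \<open>x\<close> on arbitrarily large \<open>\<Lambda>\<close> gave averages that stay away from \<open>\<nu> E\<close>,
  a cluster point of these kernels would be a finitely additive probability and hence extend to a
  measure. By consistency and locality of the kernels it is a Gibbs measure, different from \<open>\<nu>\<close>.
\<close>

theorem uniform_convergence_of_unique:
  assumes unique: "\<And>\<mu>. gibbs_measure G A D \<phi> \<mu> \<Longrightarrow> \<mu> = \<nu>"
    and E: "depends_on K (\<lambda>x. x \<in> E)" "E \<subseteq> \<Omega>" and \<epsilon>: "0 < \<epsilon>"
  shows "\<exists>\<Lambda>\<^sub>0. finite \<Lambda>\<^sub>0 \<and> \<Lambda>\<^sub>0 \<subseteq> carrier G \<and> (\<forall>\<Lambda> x. finite \<Lambda> \<longrightarrow> \<Lambda>\<^sub>0 \<subseteq> \<Lambda> \<longrightarrow> \<Lambda> \<subseteq> carrier G \<longrightarrow> x \<in> \<Omega> \<longrightarrow>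
     \<bar>gibbs_avg \<Lambda> x (indicator E) - measure \<nu> E\<bar> \<le> \<epsilon>)"
proof (rule ccontr)
  assume "\<not> ?thesis"
  then have "\<forall>\<Lambda>\<^sub>0. \<exists>p. finite \<Lambda>\<^sub>0 \<longrightarrow> \<Lambda>\<^sub>0 \<subseteq> carrier G \<longrightarrow> finite (fst p) \<and> \<Lambda>\<^sub>0 \<subseteq> fst p \<and> fst p \<subseteq> carrier G \<and>
      snd p \<in> \<Omega> \<and> \<epsilon> < \<bar>gibbs_avg (fst p) (snd p) (indicator E) - measure \<nu> E\<bar>"
    by (auto simp: not_le)
  then obtain p where p: "\<And>\<Lambda>\<^sub>0. finite \<Lambda>\<^sub>0 \<Longrightarrow> \<Lambda>\<^sub>0 \<subseteq> carrier G \<Longrightarrow> finite (fst (p \<Lambda>\<^sub>0)) \<and> \<Lambda>\<^sub>0 \<subseteq> fst (p \<Lambda>\<^sub>0) \<and>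
      fst (p \<Lambda>\<^sub>0) \<subseteq> carrier G \<and>
      snd (p \<Lambda>\<^sub>0) \<in> \<Omega> \<and> \<epsilon> < \<bar>gibbs_avg (fst (p \<Lambda>\<^sub>0)) (snd (p \<Lambda>\<^sub>0)) (indicator E) - measure \<nu> E\<bar>"
    by metis
  let ?F = "finite_subsets_at_top (carrier G)"
  define q where "q \<Lambda> f = gibbs_avg (fst (p \<Lambda>)) (snd (p \<Lambda>)) f" for \<Lambda> f
  \<comment> \<open>The default value keeps \<open>q'\<close> in the unit interval where \<open>p\<close> is unspecified.\<close>
  define q' where "q' \<Lambda> E = (if finite \<Lambda> \<and> \<Lambda> \<subseteq> carrier G then q \<Lambda> (indicator E) else 0)" for \<Lambda> E
  have q'01: "q' \<Lambda> E \<in> {0..1}" for \<Lambda> E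
  proof (cases "finite \<Lambda> \<and> \<Lambda> \<subseteq> carrier G")
    case True
    then have p': "finite (fst (p \<Lambda>))" "fst (p \<Lambda>) \<subseteq> carrier G" "snd (p \<Lambda>) \<in> \<Omega>" using p by auto
    have "gibbs_avg (fst (p \<Lambda>)) (snd (p \<Lambda>)) (\<lambda>_. 0) \<le> q \<Lambda> (indicator E)"
      "q \<Lambda> (indicator E) \<le> gibbs_avg (fst (p \<Lambda>)) (snd (p \<Lambda>)) (\<lambda>_. 1)"
      unfolding q_def by (intro gibbs_avg_mono p'; simp)+
    then show ?thesis using True by (simp add: q'_def gibbs_avg_const[OF p'])
  qed (auto simp: q'_def)
  obtain \<rho> F' where F': "F' \<le> ?F" "F' \<noteq> bot" and lim: "\<And>E. ((\<lambda>\<Lambda>. q' \<Lambda> E) \<longlongrightarrow> \<rho> E) F'"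
    using filter_cluster_point[of ?F q', OF finite_subsets_at_top_neq_bot q'01] by blast
  have ev: "eventually P F'" if "\<And>\<Lambda>. finite \<Lambda> \<Longrightarrow> W \<subseteq> \<Lambda> \<Longrightarrow> \<Lambda> \<subseteq> carrier G \<Longrightarrow> P \<Lambda>" "finite W" "W \<subseteq> carrier G" for P W
    by (rule filter_leD[OF F'(1)]) (use that in \<open>auto simp: eventually_finite_subsets_at_top\<close>)
  have lim': "((\<lambda>\<Lambda>. q \<Lambda> (indicator E)) \<longlongrightarrow> \<rho> E) F'" for E
    by (rule Lim_transform_eventually[OF lim]) (rule ev[of "{}"]; simp add: q'_def)
  have "\<exists>\<mu>. borel_prob G A \<mu> \<and> (\<forall>K E. depends_on K (\<lambda>x. x \<in> E) \<longrightarrow> E \<subseteq> \<Omega> \<longrightarrow> measure \<mu> E = \<rho> E)"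
  proof (rule measure_of_finitely_additive)
    show "0 \<le> \<rho> E" for E
      by (rule tendsto_lowerbound[OF lim _ F'(2)]) (use q'01 in auto)
    have "eventually (\<lambda>\<Lambda>. q \<Lambda> (indicator \<Omega>) = 1) F'"
    proof (rule ev[of "{}"])
      fix \<Lambda> assume \<Lambda>: "finite \<Lambda>" "\<Lambda> \<subseteq> carrier G"
      have "q \<Lambda> (indicator \<Omega>) = q \<Lambda> (\<lambda>_. 1)" unfolding q_def by (rule gibbs_avg_cong) simp
      then show "q \<Lambda> (indicator \<Omega>) = 1" using p[OF \<Lambda>] by (simp add: q_def gibbs_avg_const)
    qed auto
    then have "((\<lambda>\<Lambda>. q \<Lambda> (indicator \<Omega>)) \<longlongrightarrow> 1) F'" by (rule tendsto_eventually)
    then show "\<rho> \<Omega> = 1" using lim'[of \<Omega>] F'(2) tendsto_unique by blast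
    fix E E' :: "('g \<Rightarrow> 'a) set" assume "E \<inter> E' = {}"
    then have "(indicator (E \<union> E') :: _ \<Rightarrow> real) = (\<lambda>y. indicator E y + indicator E' y)"
      by (auto simp: fun_eq_iff indicator_def)
    then have "q \<Lambda> (indicator (E \<union> E')) = q \<Lambda> (indicator E) + q \<Lambda> (indicator E')" for \<Lambda>
      by (simp only: q_def gibbs_avg_add)
    then have "((\<lambda>\<Lambda>. q \<Lambda> (indicator (E \<union> E'))) \<longlongrightarrow> \<rho> E + \<rho> E') F'"
      using tendsto_add[OF lim'[of E] lim'[of E']] by simp
    then show "\<rho> (E \<union> E') = \<rho> E + \<rho> E'" using lim'[of "E \<union> E'"] F'(2) tendsto_unique by blast
  qed
  then obtain \<mu> where \<mu>: "borel_prob G A \<mu>"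
    and \<mu>\<rho>: "\<And>K E. depends_on K (\<lambda>x. x \<in> E) \<Longrightarrow> E \<subseteq> \<Omega> \<Longrightarrow> measure \<mu> E = \<rho> E" by blast
  have lim_local: "((\<lambda>\<Lambda>. q \<Lambda> f) \<longlongrightarrow> integral\<^sup>L \<mu> f) F'" if f: "depends_on K f" for K f
  proof -
    have K: "finite K" "K \<subseteq> carrier G" using f by (auto simp: depends_on_def)
    have "((\<lambda>\<Lambda>. \<Sum>z\<in>K \<rightarrow>\<^sub>E A. f (overlay K z base) * q \<Lambda> (indicator {x\<in>\<Omega>. restrict x K = z}))
       \<longlongrightarrow> (\<Sum>z\<in>K \<rightarrow>\<^sub>E A. f (overlay K z base) * \<rho> {x\<in>\<Omega>. restrict x K = z})) F'"
      by (intro tendsto_sum tendsto_mult tendsto_const lim')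
    also have "(\<Sum>z\<in>K \<rightarrow>\<^sub>E A. f (overlay K z base) * \<rho> {x\<in>\<Omega>. restrict x K = z}) =
       (\<Sum>z\<in>K \<rightarrow>\<^sub>E A. f (overlay K z base) * measure \<mu> {x\<in>\<Omega>. restrict x K = z})"
    proof (intro sum.cong refl arg_cong2[where f = "(*)"])
      fix z
      have "depends_on K (\<lambda>x. x \<in> {x \<in> \<Omega>. restrict x K = z})"
        using K unfolding depends_on_def by (auto simp: restrict_def fun_eq_iff)
      then show "\<rho> {x \<in> \<Omega>. restrict x K = z} = measure \<mu> {x \<in> \<Omega>. restrict x K = z}"
        by (subst \<mu>\<rho>) auto
    qed
    also have "\<dots> = integral\<^sup>L \<mu> f" by (rule integral_depends_on(2)[OF f \<mu>, symmetric])
    also have "(\<lambda>\<Lambda>. \<Sum>z\<in>K \<rightarrow>\<^sub>E A. f (overlay K z base) * q \<Lambda> (indicator {x\<in>\<Omega>. restrict x K = z})) = (\<lambda>\<Lambda>. q \<Lambda> f)"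
    proof
      fix \<Lambda>
      have "q \<Lambda> f = q \<Lambda> (\<lambda>x. \<Sum>z\<in>K \<rightarrow>\<^sub>E A. f (overlay K z base) * indicator {x\<in>\<Omega>. restrict x K = z} x)"
        unfolding q_def using depends_on_expand[OF f]
        by (intro gibbs_avg_cong) (simp add: indicator_def)
      also have "\<dots> = (\<Sum>z\<in>K \<rightarrow>\<^sub>E A. f (overlay K z base) * q \<Lambda> (indicator {x\<in>\<Omega>. restrict x K = z}))"
        unfolding q_def by (rule gibbs_avg_sum)
      finally show "(\<Sum>z\<in>K \<rightarrow>\<^sub>E A. f (overlay K z base) * q \<Lambda> (indicator {x\<in>\<Omega>. restrict x K = z})) = q \<Lambda> f" ..
    qed
    finally show ?thesis .
  qed
  have "gibbs_measure G A D \<phi> \<mu>"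
  proof (rule gibbs_measureI[OF \<mu>])
    fix \<Lambda> K E assume \<Lambda>: "finite \<Lambda>" "\<Lambda> \<subseteq> carrier G" and E: "depends_on K (\<lambda>x. x \<in> E)" "E \<subseteq> \<Omega>"
    have "((\<lambda>\<Lambda>'. q \<Lambda>' (\<lambda>x. gibbs_avg \<Lambda> x (indicator E))) \<longlongrightarrow> integral\<^sup>L \<mu> (\<lambda>x. gibbs_avg \<Lambda> x (indicator E))) F'"
      by (rule lim_local[OF gibbs_avg_depends_on[OF \<Lambda> indicator_depends_on[OF E(1)]]])
    moreover have "eventually (\<lambda>\<Lambda>'. q \<Lambda>' (\<lambda>x. gibbs_avg \<Lambda> x (indicator E)) = q \<Lambda>' (indicator E)) F'"
    proof (rule ev[OF _ \<Lambda>])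
      fix \<Lambda>' assume "finite \<Lambda>'" "\<Lambda> \<subseteq> \<Lambda>'" "\<Lambda>' \<subseteq> carrier G"
      with p[of \<Lambda>'] show "q \<Lambda>' (\<lambda>x. gibbs_avg \<Lambda> x (indicator E)) = q \<Lambda>' (indicator E)"
        unfolding q_def by (intro gibbs_avg_consistent) auto
    qed
    ultimately have "((\<lambda>\<Lambda>'. q \<Lambda>' (indicator E)) \<longlongrightarrow> integral\<^sup>L \<mu> (\<lambda>x. gibbs_avg \<Lambda> x (indicator E))) F'"
      by (rule Lim_transform_eventually)
    then have "integral\<^sup>L \<mu> (\<lambda>x. gibbs_avg \<Lambda> x (indicator E)) = \<rho> E"
      using lim'[of E] F'(2) tendsto_unique by blast
    then show "integral\<^sup>L \<mu> (\<lambda>x. gibbs_avg \<Lambda> x (indicator E)) = measure \<mu> E" using \<mu>\<rho>[OF E] by simp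
  qed
  then have "\<mu> = \<nu>" by (rule unique)
  then have "((\<lambda>\<Lambda>. \<bar>q \<Lambda> (indicator E) - measure \<nu> E\<bar>) \<longlongrightarrow> \<bar>measure \<nu> E - measure \<nu> E\<bar>) F'"
    using lim'[of E] \<mu>\<rho>[OF E] by (intro tendsto_intros) simp
  moreover have "eventually (\<lambda>\<Lambda>. \<epsilon> \<le> \<bar>q \<Lambda> (indicator E) - measure \<nu> E\<bar>) F'"
    by (rule ev[of "{}"]) (use p in \<open>auto simp: q_def less_imp_le\<close>)
  ultimately have "\<epsilon> \<le> \<bar>measure \<nu> E - measure \<nu> E\<bar>" by (rule tendsto_lowerbound) (rule F'(2))
  with \<epsilon> show False by simp
qed

end

section \<open>Gibbs weights on finite actions\<close>

context lattice_potential begin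

definition acts :: "'v set \<Rightarrow> ('g \<Rightarrow> 'v \<Rightarrow> 'v) \<Rightarrow> bool" where
  "acts V a \<longleftrightarrow> (\<forall>g\<in>carrier G. \<forall>v\<in>V. a g v \<in> V) \<and> (\<forall>v\<in>V. a \<one> v = v) \<and>
     (\<forall>g\<in>carrier G. \<forall>h\<in>carrier G. \<forall>v\<in>V. a (g \<otimes> h) v = a g (a h v))"

lemma acts_in: "acts V a \<Longrightarrow> g \<in> carrier G \<Longrightarrow> v \<in> V \<Longrightarrow> a g v \<in> V"
  and acts_one: "acts V a \<Longrightarrow> v \<in> V \<Longrightarrow> a \<one> v = v"
  and acts_mult: "acts V a \<Longrightarrow> g \<in> carrier G \<Longrightarrow> h \<in> carrier G \<Longrightarrow> v \<in> V \<Longrightarrow> a (g \<otimes> h) v = a g (a h v)"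
  by (auto simp: acts_def)

lemma acts_inv:
  assumes "acts V a" "g \<in> carrier G" "v \<in> V"
  shows "a (inv g) (a g v) = v"
  using acts_mult[OF assms(1) inv_closed[OF assms(2)] assms(2,3)] acts_one[OF assms(1,3)] assms(2) by simp

definition pull :: "('g \<Rightarrow> 'v \<Rightarrow> 'v) \<Rightarrow> ('v \<Rightarrow> 'a) \<Rightarrow> 'v \<Rightarrow> 'g \<Rightarrow> 'a" where
  "pull a x v = (\<lambda>g\<in>carrier G. x (a g v))"

lemma pull_apply: "g \<in> carrier G \<Longrightarrow> pull a x v g = x (a g v)"
  by (simp add: pull_def)

lemma pull_in:
  assumes "acts V a" "x \<in> V \<rightarrow> A" "v \<in> V" shows "pull a x v \<in> \<Omega>"
  using acts_in[OF assms(1) _ assms(3)] assms(2) by (auto simp: pull_def)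

lemma shift_pull:
  assumes "acts V a" "g \<in> carrier G" "v \<in> V"
  shows "shift G g (pull a x v) = pull a x (a g v)"
  using assms by (intro ext) (auto simp: shift_def pull_def acts_mult)

definition weight :: "'v set \<Rightarrow> ('g \<Rightarrow> 'v \<Rightarrow> 'v) \<Rightarrow> ('v \<Rightarrow> 'a) \<Rightarrow> real" where
  "weight V a x = exp (- (\<Sum>v\<in>V. \<phi> (pull a x v)))"

abbreviation confs :: "'v set \<Rightarrow> ('v \<Rightarrow> 'a) set" where "confs V \<equiv> V \<rightarrow>\<^sub>E A"

lemma weight_pos: "0 < weight V a x" by (simp add: weight_def)

lemma finite_confs: "finite V \<Longrightarrow> finite (confs V)"
  using finite_A by (intro finite_PiE) auto

lemma \<phi>_bounded: "\<exists>B\<ge>0. \<forall>x\<in>\<Omega>. \<bar>\<phi> x\<bar> \<le> B"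
proof -
  have dep: "depends_on D \<phi>" using finite_D D_sub \<phi>_cong unfolding depends_on_def by blast
  have "\<phi> ` \<Omega> \<subseteq> (\<lambda>z. \<phi> (overlay D z base)) ` (D \<rightarrow>\<^sub>E A)"
  proof
    fix r assume "r \<in> \<phi> ` \<Omega>"
    then obtain x where x: "x \<in> \<Omega>" "r = \<phi> x" by auto
    have "restrict x D \<in> D \<rightarrow>\<^sub>E A" using x D_sub by (auto simp: PiE_iff)
    moreover from overlay_in[OF this base_in] have "\<phi> x = \<phi> (overlay D (restrict x D) base)"
      using D_sub x by (intro \<phi>_cong) (auto simp: overlay_def)
    ultimately show "r \<in> (\<lambda>z. \<phi> (overlay D z base)) ` (D \<rightarrow>\<^sub>E A)" using x by auto
  qed
  moreover have "finite (D \<rightarrow>\<^sub>E A)" using finite_D finite_A by (intro finite_PiE) auto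
  ultimately have "bounded (\<phi> ` \<Omega>)" by (meson finite_imageI finite_imp_bounded finite_subset)
  then obtain B where B: "\<forall>x\<in>\<Omega>. \<bar>\<phi> x\<bar> \<le> B" by (auto simp: bounded_iff)
  then show ?thesis using base_in by (intro exI[of _ B]) (auto intro: order_trans[OF abs_ge_zero])
qed

text \<open>
  Each changed letter is seen by at most \<open>card D\<close> terms of the energy, and each of these terms
  changes by at most \<open>2 B\<close>.
\<close>

lemma weight_change:
  assumes a: "acts V a" and V: "finite V" and xy: "x \<in> confs V" "y \<in> confs V"
    and B: "\<And>x. x \<in> \<Omega> \<Longrightarrow> \<bar>\<phi> x\<bar> \<le> B"
  shows "exp (- 2 * B * real (card D)) ^ hamming V x y * weight V a x \<le> weight V a y"
proof -
  let ?N = "(\<lambda>(d, u). a (inv d) u) ` (D \<times> {u\<in>V. x u \<noteq> y u})"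
  have B0: "0 \<le> B" using B[OF base_in] abs_ge_zero order_trans by blast
  have same: "\<phi> (pull a x v) = \<phi> (pull a y v)" if v: "v \<in> V - ?N" for v
  proof (rule \<phi>_cong)
    show "pull a x v \<in> \<Omega>" "pull a y v \<in> \<Omega>" using xy v by (auto intro!: pull_in[OF a])
    fix d assume d: "d \<in> D"
    have "a d v \<in> V" using d v D_sub acts_in[OF a] by auto
    moreover have "v = a (inv d) (a d v)" using d v D_sub acts_inv[OF a] by auto
    ultimately have "x (a d v) = y (a d v)" using v d by force
    then show "pull a x v d = pull a y v d" using d D_sub by (auto simp: pull_apply)
  qed
  have "(\<Sum>v\<in>V. \<phi> (pull a y v) - \<phi> (pull a x v)) = (\<Sum>v\<in>V \<inter> ?N. \<phi> (pull a y v) - \<phi> (pull a x v))"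
    using V same by (intro sum.mono_neutral_right) auto
  also have "\<dots> \<le> (\<Sum>v\<in>V \<inter> ?N. 2 * B)"
  proof (rule sum_mono)
    fix v assume "v \<in> V \<inter> ?N"
    then have "\<bar>\<phi> (pull a x v)\<bar> \<le> B" "\<bar>\<phi> (pull a y v)\<bar> \<le> B"
      using xy by (auto intro!: B pull_in[OF a])
    then show "\<phi> (pull a y v) - \<phi> (pull a x v) \<le> 2 * B" by linarith
  qed
  also have "\<dots> = real (card (V \<inter> ?N)) * (2 * B)" by simp
  also have "\<dots> \<le> real (card D * hamming V x y) * (2 * B)"
  proof (intro mult_right_mono of_nat_mono)
    have "card (V \<inter> ?N) \<le> card ?N" using V finite_D by (intro card_mono) auto
    also have "\<dots> \<le> card (D \<times> {u\<in>V. x u \<noteq> y u})" using V finite_D by (intro card_image_le) auto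
    finally show "card (V \<inter> ?N) \<le> card D * hamming V x y" by (simp add: card_cartesian_product hamming_def)
  qed (use B0 in auto)
  finally have "- 2 * B * real (card D) * real (hamming V x y) - (\<Sum>v\<in>V. \<phi> (pull a x v)) \<le> - (\<Sum>v\<in>V. \<phi> (pull a y v))"
    by (simp add: sum_subtractf algebra_simps)
  then have "exp (real (hamming V x y) * (- 2 * B * real (card D)) + - (\<Sum>v\<in>V. \<phi> (pull a x v))) \<le> weight V a y"
    by (simp add: weight_def algebra_simps)
  then show ?thesis unfolding exp_add exp_of_nat_mult by (simp add: weight_def)
qed

text \<open>
  Sum \<open>weight_change\<close> over all \<open>y\<close> and use the generating function of the Hamming distance.
\<close>

lemma weight_le_total:
  assumes a: "acts V a" and V: "finite V" and x: "x \<in> confs V" and A2: "card A \<ge> 2"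
    and B: "\<And>x. x \<in> \<Omega> \<Longrightarrow> \<bar>\<phi> x\<bar> \<le> B"
  shows "(1 + exp (- 2 * B * real (card D))) ^ card V * weight V a x \<le> (\<Sum>y\<in>confs V. weight V a y)"
proof -
  let ?q = "exp (- 2 * B * real (card D))"
  have "(1 + ?q) ^ card V \<le> (\<Sum>y\<in>confs V. ?q ^ hamming V x y)"
    using sum_power_hamming_ge[OF V finite_A A2, of x ?q] x by (auto simp: PiE_iff)
  then have "(1 + ?q) ^ card V * weight V a x \<le> (\<Sum>y\<in>confs V. ?q ^ hamming V x y) * weight V a x"
    using weight_pos[of V a x] by (intro mult_right_mono) auto
  also have "\<dots> = (\<Sum>y\<in>confs V. ?q ^ hamming V x y * weight V a x)" by (rule sum_distrib_right)
  also have "\<dots> \<le> (\<Sum>y\<in>confs V. weight V a y)"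
    by (intro sum_mono weight_change a V x B)
  finally show ?thesis .
qed

text \<open>
  When the orbit map of \<open>v\<close> is injective on the window, the configurations that agree with \<open>x\<close> off
  the image \<open>U\<close> of \<open>\<Lambda>\<close> correspond to the patterns on \<open>\<Lambda>\<close>, and their weights are proportional to the
  Boltzmann weights for the boundary condition \<open>pull a x v\<close>.
\<close>

lemma local_conditioning:
  fixes a :: "'g \<Rightarrow> 'v \<Rightarrow> 'v"
  assumes a: "acts V a" and V: "finite V" and v: "v \<in> V"
    and \<Lambda>: "finite \<Lambda>" "\<Lambda> \<subseteq> carrier G"
    and K: "depends_on K (\<lambda>x. x \<in> E)"
    and good: "inj_on (\<lambda>g. a g v) (dependence_window \<Lambda> \<union> interacting \<Lambda> \<union> K)"
    and x: "x \<in> confs V"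
    and close: "\<And>\<xi>. \<xi> \<in> \<Omega> \<Longrightarrow> \<bar>gibbs_avg \<Lambda> \<xi> (indicator E) - c\<bar> \<le> \<epsilon>"
  defines "U \<equiv> (\<lambda>g. a g v) ` \<Lambda>"
  defines "cls \<equiv> {x' \<in> confs V. restrict x' (V - U) = restrict x (V - U)}"
  shows "\<bar>\<Sum>x'\<in>cls. weight V a x' * (indicator E (pull a x' v) - c)\<bar> \<le> \<epsilon> * (\<Sum>x'\<in>cls. weight V a x')"
proof -
  let ?M = "dependence_window \<Lambda> \<union> interacting \<Lambda> \<union> K"
  let ?i = "inv_into \<Lambda> (\<lambda>g. a g v)"
  let ?\<xi> = "pull a x v"
  let ?b = "boltzmann G D \<phi> \<Lambda>"
  define put where "put z = (\<lambda>u\<in>V. if u \<in> U then z (?i u) else x u)" for z :: "'g \<Rightarrow> 'a"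
  have M_sub: "?M \<subseteq> carrier G"
    using dependence_window_sub[OF \<Lambda>(2)] K by (auto simp: depends_on_def interacting_iff)
  have \<Lambda>M: "\<Lambda> \<subseteq> ?M" by (auto simp: dependence_window_def)
  have inj\<Lambda>: "inj_on (\<lambda>g. a g v) \<Lambda>" using good \<Lambda>M by (rule inj_on_subset)
  have U_sub: "U \<subseteq> V" using \<Lambda> acts_in[OF a _ v] by (auto simp: U_def)
  have \<xi>: "?\<xi> \<in> \<Omega>" using x by (intro pull_in[OF a _ v]) auto
  have put_U: "put z (a g v) = z g" if "g \<in> \<Lambda>" for z g
    using that inv_into_f_f[OF inj\<Lambda> that] U_sub by (auto simp: put_def U_def)
  have put_off: "put z u = x u" if "u \<in> V - U" for z u
    using that by (auto simp: put_def)
  have put_conf: "put z \<in> confs V" if "z \<in> \<Lambda> \<rightarrow>\<^sub>E A" for z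
  proof (rule PiE_I)
    fix u assume u: "u \<in> V"
    show "put z u \<in> A"
    proof (cases "u \<in> U")
      case True
      then obtain g where "g \<in> \<Lambda>" "u = a g v" by (auto simp: U_def)
      then show ?thesis using put_U that by (auto simp: PiE_iff)
    next
      case False
      then show ?thesis using put_off u x by (auto simp: PiE_iff)
    qed
  qed (simp add: put_def)
  have bij: "(\<Sum>x'\<in>cls. f x') = (\<Sum>z\<in>\<Lambda> \<rightarrow>\<^sub>E A. f (put z))" for f :: "('v \<Rightarrow> 'a) \<Rightarrow> real"
  proof (rule sum.reindex_bij_witness[where i = put and j = "\<lambda>x'. \<lambda>g\<in>\<Lambda>. x' (a g v)"])
    fix x' assume x': "x' \<in> cls"
    show "put (\<lambda>g\<in>\<Lambda>. x' (a g v)) = x'"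
    proof
      fix u
      consider "u \<in> U" | "u \<in> V - U" | "u \<notin> V" by auto
      then show "put (\<lambda>g\<in>\<Lambda>. x' (a g v)) u = x' u"
      proof cases
        case 1
        then obtain g where "g \<in> \<Lambda>" "u = a g v" by (auto simp: U_def)
        then show ?thesis using put_U by simp
      next
        case 2
        then show ?thesis using put_off x' unfolding cls_def by (metis (mono_tags, lifting) mem_Collect_eq restrict_apply')
      next
        case 3
        then show ?thesis using x' by (auto simp: put_def cls_def PiE_iff extensional_def)
      qed
    qed
    then show "f (put (\<lambda>g\<in>\<Lambda>. x' (a g v))) = f x'" by simp
    show "(\<lambda>g\<in>\<Lambda>. x' (a g v)) \<in> \<Lambda> \<rightarrow>\<^sub>E A"
      using x' \<Lambda> acts_in[OF a _ v] by (auto simp: cls_def)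
  next
    fix z assume z: "z \<in> \<Lambda> \<rightarrow>\<^sub>E A"
    show "(\<lambda>g\<in>\<Lambda>. put z (a g v)) = z"
      using z put_U by (intro ext) (auto simp: PiE_iff extensional_def)
    show "put z \<in> cls" using put_conf[OF z] put_off by (auto simp: cls_def restrict_def)
  qed
  have pull_put: "pull a (put z) v g = overlay \<Lambda> z ?\<xi> g" if g: "g \<in> ?M" for z g
  proof (cases "g \<in> \<Lambda>")
    case True
    then show ?thesis using put_U \<Lambda> by (auto simp: pull_apply overlay_def)
  next
    case False
    have gc: "g \<in> carrier G" using g M_sub by auto
    have "a g v \<notin> U"
    proof
      assume "a g v \<in> U"
      then obtain h where "h \<in> \<Lambda>" "a g v = a h v" by (auto simp: U_def)
      with inj_onD[OF good, of g h] g \<Lambda>M False show False by auto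
    qed
    then show ?thesis using put_off acts_in[OF a gc v] gc False by (auto simp: pull_apply overlay_def)
  qed
  \<comment> \<open>The factor of proportionality comes from the points whose energy does not see \<open>U\<close>.\<close>
  define C where "C = exp (- (\<Sum>u\<in>V - (\<lambda>g. a g v) ` interacting \<Lambda>. \<phi> (pull a x u)))"
  have w: "weight V a (put z) = C * ?b (overlay \<Lambda> z ?\<xi>)"
    and ind: "(indicator E (pull a (put z) v) :: real) = indicator E (overlay \<Lambda> z ?\<xi>)" if z: "z \<in> \<Lambda> \<rightarrow>\<^sub>E A" for z
  proof -
    have ov: "overlay \<Lambda> z ?\<xi> \<in> \<Omega>" by (rule overlay_in[OF z \<xi>])
    have pp: "pull a (put z) u \<in> \<Omega>" if "u \<in> V" for u
      using put_conf[OF z] that by (intro pull_in[OF a]) auto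
    have sub: "(\<lambda>g. a g v) ` interacting \<Lambda> \<subseteq> V" using acts_in[OF a _ v] by (auto simp: interacting_iff)
    have inj: "inj_on (\<lambda>g. a g v) (interacting \<Lambda>)" using good by (rule inj_on_subset) auto
    have "(\<Sum>u\<in>V. \<phi> (pull a (put z) u)) = (\<Sum>u\<in>V - (\<lambda>g. a g v) ` interacting \<Lambda>. \<phi> (pull a (put z) u)) +
        (\<Sum>u\<in>(\<lambda>g. a g v) ` interacting \<Lambda>. \<phi> (pull a (put z) u))"
      by (rule sum.subset_diff[OF sub V])
    also have "(\<Sum>u\<in>(\<lambda>g. a g v) ` interacting \<Lambda>. \<phi> (pull a (put z) u)) =
        (\<Sum>g\<in>interacting \<Lambda>. \<phi> (shift G g (overlay \<Lambda> z ?\<xi>)))"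
      unfolding sum.reindex[OF inj] o_def
    proof (intro sum.cong refl)
      fix g assume g: "g \<in> interacting \<Lambda>"
      then have gc: "g \<in> carrier G" by (simp add: interacting_iff)
      have "\<phi> (shift G g (pull a (put z) v)) = \<phi> (shift G g (overlay \<Lambda> z ?\<xi>))"
      proof (rule \<phi>_shift_cong[OF gc pp[OF v] ov])
        fix d assume "d \<in> D"
        then have "d \<otimes> g \<in> ?M" using g by (force simp: dependence_window_def)
        then show "pull a (put z) v (d \<otimes> g) = overlay \<Lambda> z ?\<xi> (d \<otimes> g)" by (rule pull_put)
      qed
      then show "\<phi> (pull a (put z) (a g v)) = \<phi> (shift G g (overlay \<Lambda> z ?\<xi>))"
        using shift_pull[OF a gc v] by simp
    qed
    also have "(\<Sum>u\<in>V - (\<lambda>g. a g v) ` interacting \<Lambda>. \<phi> (pull a (put z) u)) =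
        (\<Sum>u\<in>V - (\<lambda>g. a g v) ` interacting \<Lambda>. \<phi> (pull a x u))"
    proof (intro sum.cong refl \<phi>_cong)
      fix u assume u: "u \<in> V - (\<lambda>g. a g v) ` interacting \<Lambda>"
      show "pull a (put z) u \<in> \<Omega>" using pp u by blast
      show "pull a x u \<in> \<Omega>" using u x by (intro pull_in[OF a]) auto
      fix d assume d: "d \<in> D"
      then have dc: "d \<in> carrier G" using D_sub by auto
      have "a d u \<notin> U"
      proof
        assume "a d u \<in> U"
        then obtain l where l: "l \<in> \<Lambda>" "a d u = a l v" by (auto simp: U_def)
        then have lc: "l \<in> carrier G" using \<Lambda> by auto
        have "u = a (inv d) (a l v)" using acts_inv[OF a dc, of u] l u by simp
        also have "\<dots> = a (inv d \<otimes> l) v" using acts_mult[OF a _ lc v, of "inv d"] dc by simp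
        finally have "u = a (inv d \<otimes> l) v" .
        moreover have "inv d \<otimes> l \<in> interacting \<Lambda>"
          unfolding interacting_iff using d l dc lc by (auto simp: m_assoc[symmetric] intro!: bexI[of _ d])
        ultimately show False using u by auto
      qed
      then show "pull a (put z) u d = pull a x u d"
        using put_off acts_in[OF a dc, of u] u dc by (auto simp: pull_apply)
    qed
    finally show "weight V a (put z) = C * ?b (overlay \<Lambda> z ?\<xi>)"
      by (simp add: weight_def C_def boltzmann_eq exp_add[symmetric])
    have "(pull a (put z) v \<in> E) = (overlay \<Lambda> z ?\<xi> \<in> E)"
      using pull_put by (intro depends_onD[OF K pp[OF v] ov]) auto
    then show "(indicator E (pull a (put z) v) :: real) = indicator E (overlay \<Lambda> z ?\<xi>)"
      by (simp add: indicator_def)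
  qed
  have tot: "(\<Sum>x'\<in>cls. weight V a x') = C * partition_sum \<Lambda> ?\<xi>"
    unfolding bij partition_sum_def sum_agreeing[OF \<Lambda>(2) \<xi>] by (simp add: w sum_distrib_left)
  have "(\<Sum>x'\<in>cls. weight V a x' * (indicator E (pull a x' v) - c)) =
      C * ((\<Sum>y\<in>agreeing G A \<Lambda> ?\<xi>. ?b y * indicator E y) - c * partition_sum \<Lambda> ?\<xi>)"
    unfolding bij partition_sum_def sum_agreeing[OF \<Lambda>(2) \<xi>]
    by (simp add: w ind sum_distrib_left sum_subtractf algebra_simps)
  also have "\<dots> = C * partition_sum \<Lambda> ?\<xi> * (gibbs_avg \<Lambda> ?\<xi> (indicator E) - c)"
    using partition_sum_pos[OF \<Lambda> \<xi>] by (simp add: gibbs_avg_def field_simps)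
  finally have "\<bar>\<Sum>x'\<in>cls. weight V a x' * (indicator E (pull a x' v) - c)\<bar> =
      C * partition_sum \<Lambda> ?\<xi> * \<bar>gibbs_avg \<Lambda> ?\<xi> (indicator E) - c\<bar>"
    using partition_sum_pos[OF \<Lambda> \<xi>] by (simp add: abs_mult C_def)
  also have "\<dots> \<le> C * partition_sum \<Lambda> ?\<xi> * \<epsilon>"
    using partition_sum_pos[OF \<Lambda> \<xi>] close[OF \<xi>] by (intro mult_left_mono) (auto simp: C_def)
  finally show ?thesis unfolding tot by (simp add: mult_ac)
qed

text \<open>
  An observable \<open>h\<close> that does not see the image of \<open>\<Lambda>\<close> is constant on the classes to which
  \<open>local_conditioning\<close> applies.
\<close>

lemma decorrelation:
  assumes a: "acts V a" and V: "finite V" and v: "v \<in> V"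
    and \<Lambda>: "finite \<Lambda>" "\<Lambda> \<subseteq> carrier G"
    and K: "depends_on K (\<lambda>x. x \<in> E)"
    and good: "inj_on (\<lambda>g. a g v) (dependence_window \<Lambda> \<union> interacting \<Lambda> \<union> K)"
    and close: "\<And>\<xi>. \<xi> \<in> \<Omega> \<Longrightarrow> \<bar>gibbs_avg \<Lambda> \<xi> (indicator E) - c\<bar> \<le> \<epsilon>" and \<epsilon>: "0 \<le> \<epsilon>"
    and h: "\<And>x. x \<in> confs V \<Longrightarrow> \<bar>h x\<bar> \<le> 1"
      "\<And>x y. x \<in> confs V \<Longrightarrow> y \<in> confs V \<Longrightarrow> (\<And>u. u \<in> V - (\<lambda>g. a g v) ` \<Lambda> \<Longrightarrow> x u = y u) \<Longrightarrow> h x = h y"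
  shows "\<bar>\<Sum>x\<in>confs V. weight V a x * (indicator E (pull a x v) - c) * h x\<bar>
     \<le> \<epsilon> * (\<Sum>x\<in>confs V. weight V a x)"
proof -
  let ?r = "\<lambda>x. restrict x (V - (\<lambda>g. a g v) ` \<Lambda>)"
  have "\<bar>\<Sum>x\<in>confs V. weight V a x * (indicator E (pull a x v) - c) * h x\<bar> \<le> (\<Sum>x\<in>confs V. \<epsilon> * weight V a x)"
  proof (rule sum_le_by_fibres[where r = ?r, OF finite_confs[OF V]])
    fix x assume x: "x \<in> confs V"
    let ?cls = "{x' \<in> confs V. ?r x' = ?r x}"
    have hx: "h x' = h x" if "x' \<in> ?cls" for x'
    proof (rule h(2))
      fix u assume "u \<in> V - (\<lambda>g. a g v) ` \<Lambda>"
      then show "x' u = x u" using that by (metis (mono_tags, lifting) mem_Collect_eq restrict_apply')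
    qed (use that x in auto)
    have "(\<Sum>x'\<in>?cls. weight V a x' * (indicator E (pull a x' v) - c) * h x') =
        (\<Sum>x'\<in>?cls. weight V a x' * (indicator E (pull a x' v) - c)) * h x"
      unfolding sum_distrib_right using hx by (intro sum.cong) auto
    then have "\<bar>\<Sum>x'\<in>?cls. weight V a x' * (indicator E (pull a x' v) - c) * h x'\<bar> =
        \<bar>\<Sum>x'\<in>?cls. weight V a x' * (indicator E (pull a x' v) - c)\<bar> * \<bar>h x\<bar>" by (simp add: abs_mult)
    also have "\<dots> \<le> \<bar>\<Sum>x'\<in>?cls. weight V a x' * (indicator E (pull a x' v) - c)\<bar>"
      using h(1)[OF x] by (intro mult_left_le) auto
    also have "\<dots> \<le> \<epsilon> * (\<Sum>x'\<in>?cls. weight V a x')"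
      by (rule local_conditioning[OF a V v \<Lambda> K good x close])
    finally show "\<bar>\<Sum>x'\<in>?cls. weight V a x' * (indicator E (pull a x' v) - c) * h x'\<bar> \<le> (\<Sum>x'\<in>?cls. \<epsilon> * weight V a x')"
      by (simp add: sum_distrib_left)
  qed
  then show ?thesis by (simp add: sum_distrib_left)
qed

text \<open>
  Expanding the square gives the correlations, between pairs of points, of the deviations from \<open>c\<close>.
  They are at most \<open>\<epsilon>\<close> unless the first point is bad or the second lies within a bounded distance of
  the first.
\<close>

lemma second_moment:
  assumes a: "acts V a" and V: "finite V"
    and \<Lambda>: "finite \<Lambda>" "\<Lambda> \<subseteq> carrier G"
    and K: "depends_on K (\<lambda>x. x \<in> E)"
    and bad: "real (card {v\<in>V. \<not> inj_on (\<lambda>g. a g v) (dependence_window \<Lambda> \<union> interacting \<Lambda> \<union> K)}) \<le> \<theta> * real (card V)"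
    and close: "\<And>\<xi>. \<xi> \<in> \<Omega> \<Longrightarrow> \<bar>gibbs_avg \<Lambda> \<xi> (indicator E) - c\<bar> \<le> \<epsilon>" and \<epsilon>: "0 \<le> \<epsilon>"
    and c: "0 \<le> c" "c \<le> 1"
  shows "(\<Sum>x\<in>confs V. weight V a x * (real (card {v\<in>V. pull a x v \<in> E}) - real (card V) * c)\<^sup>2)
     \<le> (\<epsilon> * (real (card V))\<^sup>2 + \<theta> * (real (card V))\<^sup>2 + real (card K * card \<Lambda>) * real (card V)) * (\<Sum>x\<in>confs V. weight V a x)"
proof -
  let ?n = "real (card V)"
  let ?Z = "\<Sum>x\<in>confs V. weight V a x"
  let ?d = "\<lambda>x v. indicator E (pull a x v) - c"
  let ?bad = "{v\<in>V. \<not> inj_on (\<lambda>g. a g v) (dependence_window \<Lambda> \<union> interacting \<Lambda> \<union> K)}"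
  let ?near = "\<lambda>u. (\<lambda>(k, l). a (inv k \<otimes> l) u) ` (K \<times> \<Lambda>)"
  have Kf: "finite K" "K \<subseteq> carrier G" using K by (auto simp: depends_on_def)
  have Z0: "0 \<le> ?Z" by (intro sum_nonneg less_imp_le[OF weight_pos])
  have d1: "\<bar>?d x v\<bar> \<le> 1" for x v using c by (auto simp: indicator_def)
  have "real (card {v\<in>V. pull a x v \<in> E}) - ?n * c = (\<Sum>v\<in>V. ?d x v)" for x
    using V by (simp add: sum_subtractf indicator_def sum.If_cases Int_def of_bool_def)
  then have "(\<Sum>x\<in>confs V. weight V a x * (real (card {v\<in>V. pull a x v \<in> E}) - ?n * c)\<^sup>2) =
     (\<Sum>x\<in>confs V. \<Sum>u\<in>V. \<Sum>v\<in>V. weight V a x * ?d x u * ?d x v)"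
    unfolding power2_eq_square by (simp only: sum_product) (simp only: sum_distrib_left mult.assoc)
  also have "\<dots> = (\<Sum>u\<in>V. \<Sum>v\<in>V. \<Sum>x\<in>confs V. weight V a x * ?d x u * ?d x v)"
    by (subst sum.swap, rule sum.cong[OF refl], rule sum.swap)
  also have "\<dots> \<le> (\<Sum>u\<in>V. \<Sum>v\<in>V. (\<epsilon> + of_bool (u \<in> ?bad) + of_bool (v \<in> ?near u)) * ?Z)"
  proof (intro sum_mono)
    fix u v assume u: "u \<in> V" and v: "v \<in> V"
    show "(\<Sum>x\<in>confs V. weight V a x * ?d x u * ?d x v) \<le> (\<epsilon> + of_bool (u \<in> ?bad) + of_bool (v \<in> ?near u)) * ?Z"
    proof (cases "u \<in> ?bad \<or> v \<in> ?near u")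
      case True
      have "(\<Sum>x\<in>confs V. weight V a x * ?d x u * ?d x v) \<le> (\<Sum>x\<in>confs V. weight V a x)"
      proof (rule sum_mono)
        fix x
        have "\<bar>?d x u * ?d x v\<bar> \<le> 1" unfolding abs_mult using d1 by (intro mult_le_one) auto
        then have "weight V a x * (?d x u * ?d x v) \<le> weight V a x * 1"
          using weight_pos[of V a x] by (intro mult_left_mono) auto
        then show "weight V a x * ?d x u * ?d x v \<le> weight V a x" by (simp add: mult.assoc)
      qed
      also have "\<dots> = 1 * ?Z" by simp
      also have "\<dots> \<le> (\<epsilon> + of_bool (u \<in> ?bad) + of_bool (v \<in> ?near u)) * ?Z"
        using True \<epsilon> Z0 by (intro mult_right_mono) auto
      finally show ?thesis .
    next
      case False
      have good: "inj_on (\<lambda>g. a g u) (dependence_window \<Lambda> \<union> interacting \<Lambda> \<union> K)" using False u by auto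
      have far: "a k v \<in> V - (\<lambda>g. a g u) ` \<Lambda>" if k: "k \<in> K" for k
      proof -
        have kc: "k \<in> carrier G" using k Kf by auto
        have "a k v \<noteq> a l u" if l: "l \<in> \<Lambda>" for l
        proof
          assume e: "a k v = a l u"
          have lc: "l \<in> carrier G" using l \<Lambda> by auto
          have "v = a (inv k) (a l u)" using acts_inv[OF a kc v] e by simp
          also have "\<dots> = a (inv k \<otimes> l) u" using acts_mult[OF a _ lc u, of "inv k"] kc by simp
          finally have "v \<in> ?near u" using k l by force
          with False show False by simp
        qed
        then show ?thesis using acts_in[OF a kc v] by auto
      qed
      have "\<bar>\<Sum>x\<in>confs V. weight V a x * ?d x u * ?d x v\<bar> \<le> \<epsilon> * ?Z"
      proof (rule decorrelation[OF a V u \<Lambda> K good close \<epsilon> d1])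
        fix x y assume xy: "x \<in> confs V" "y \<in> confs V" "\<And>w. w \<in> V - (\<lambda>g. a g u) ` \<Lambda> \<Longrightarrow> x w = y w"
        have "(pull a x v \<in> E) = (pull a y v \<in> E)"
        proof (rule depends_onD[OF K])
          show "pull a x v \<in> \<Omega>" "pull a y v \<in> \<Omega>" using xy by (auto intro!: pull_in[OF a _ v])
          fix k assume k: "k \<in> K"
          then show "pull a x v k = pull a y v k" using xy(3)[OF far[OF k]] Kf by (auto simp: pull_apply)
        qed
        then show "?d x v = ?d y v" by (simp add: indicator_def)
      qed
      moreover from False have "(of_bool (u \<in> ?bad) :: real) = 0" "(of_bool (v \<in> ?near u) :: real) = 0"
        unfolding of_bool_eq_0_iff by blast+
      ultimately show ?thesis by (simp only: add_0_right)
    qed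
  qed
  also have "\<dots> = (\<Sum>u\<in>V. ?n * \<epsilon> + ?n * of_bool (u \<in> ?bad) + (\<Sum>v\<in>V. of_bool (v \<in> ?near u))) * ?Z"
    by (simp only: sum_distrib_right[symmetric] sum.distrib) simp
  also have "\<dots> \<le> (\<Sum>u\<in>V. ?n * \<epsilon> + ?n * of_bool (u \<in> ?bad) + real (card K * card \<Lambda>)) * ?Z"
  proof (intro mult_right_mono[OF _ Z0] sum_mono add_left_mono)
    fix u
    have "(\<Sum>v\<in>V. of_bool (v \<in> ?near u)) = real (card {v\<in>V. v \<in> ?near u})" using V by (simp only: real_card_filter)
    also have "\<dots> \<le> real (card (?near u))" using Kf \<Lambda> by (intro of_nat_mono card_mono) auto
    also have "\<dots> \<le> real (card (K \<times> \<Lambda>))" using Kf \<Lambda> by (intro of_nat_mono card_image_le) auto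
    finally show "(\<Sum>v\<in>V. of_bool (v \<in> ?near u)) \<le> real (card K * card \<Lambda>)" by (simp add: card_cartesian_product)
  qed
  also have "(\<Sum>u\<in>V. ?n * \<epsilon> + ?n * of_bool (u \<in> ?bad) + real (card K * card \<Lambda>)) =
      ?n * (?n * \<epsilon>) + ?n * real (card ?bad) + ?n * real (card K * card \<Lambda>)"
  proof -
    have "(\<Sum>u\<in>V. of_bool (u \<in> ?bad)) = real (card {u\<in>V. u \<in> ?bad})" using V by (simp only: real_card_filter)
    also have "{u\<in>V. u \<in> ?bad} = ?bad" by auto
    finally show ?thesis by (simp only: sum.distrib sum_distrib_left[symmetric] sum_constant of_nat_mult ac_simps)
  qed
  also have "\<dots> \<le> ?n * (?n * \<epsilon>) + ?n * (\<theta> * ?n) + ?n * real (card K * card \<Lambda>)"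
    using bad by (intro add_mono mult_left_mono) auto
  also have "\<dots> = \<epsilon> * ?n\<^sup>2 + \<theta> * ?n\<^sup>2 + real (card K * card \<Lambda>) * ?n" by (simp add: power2_eq_square)
  finally show ?thesis using Z0 by (simp add: mult_right_mono)
qed

text \<open>
  By Chebyshev's inequality the typical configurations carry at least half of the total weight,
  while \<open>weight_le_total\<close> bounds the share of each of them.
\<close>

theorem many_typical_configurations:
  fixes E :: "'i \<Rightarrow> ('g \<Rightarrow> 'a) set"
  assumes unique: "\<And>\<mu>. gibbs_measure G A D \<phi> \<mu> \<Longrightarrow> \<mu> = \<nu>" and \<nu>: "borel_prob G A \<nu>"
    and A2: "card A \<ge> 2" and I: "finite I"
    and E: "\<And>i. i \<in> I \<Longrightarrow> depends_on K (\<lambda>x. x \<in> E i)" "\<And>i. i \<in> I \<Longrightarrow> E i \<subseteq> \<Omega>" and \<epsilon>1: "0 < \<epsilon>1"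
    and B: "\<And>x. x \<in> \<Omega> \<Longrightarrow> \<bar>\<phi> x\<bar> \<le> B"
  shows "\<exists>M \<theta> n0. finite M \<and> M \<subseteq> carrier G \<and> 0 < \<theta> \<and> (\<forall>(V :: 'v set) a. finite V \<longrightarrow> acts V a \<longrightarrow> card V \<ge> n0 \<longrightarrow>
     real (card {v\<in>V. \<not> inj_on (\<lambda>g. a g v) M}) \<le> \<theta> * real (card V) \<longrightarrow>
     (1 + exp (- 2 * B * real (card D))) ^ card V \<le>
     2 * real (card {x\<in>confs V. \<forall>i\<in>I. \<bar>real (card {v\<in>V. pull a x v \<in> E i}) - real (card V) * measure \<nu> (E i)\<bar> \<le> \<epsilon>1 * real (card V)}))"
proof -
  interpret prob_space \<nu> using \<nu> by (simp add: borel_prob_def)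
  define \<epsilon> where "\<epsilon> = \<epsilon>1\<^sup>2 / (6 * (real (card I) + 1))"
  have \<epsilon>: "0 < \<epsilon>" using \<epsilon>1 by (auto simp: \<epsilon>_def intro!: divide_pos_pos add_nonneg_pos)
  have I\<epsilon>: "real (card I) * (3 * \<epsilon>) \<le> \<epsilon>1\<^sup>2 / 2"
  proof -
    have "(real (card I) + 1) * (3 * \<epsilon>) = \<epsilon>1\<^sup>2 / 2" by (simp add: \<epsilon>_def field_simps add_nonneg_eq_0_iff)
    then show ?thesis using \<epsilon> by (simp add: algebra_simps)
  qed
  have "\<forall>i\<in>I. \<exists>\<Lambda>\<^sub>0. finite \<Lambda>\<^sub>0 \<and> \<Lambda>\<^sub>0 \<subseteq> carrier G \<and> (\<forall>\<Lambda> x. finite \<Lambda> \<longrightarrow> \<Lambda>\<^sub>0 \<subseteq> \<Lambda> \<longrightarrow> \<Lambda> \<subseteq> carrier G \<longrightarrow> x \<in> \<Omega> \<longrightarrow>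
     \<bar>gibbs_avg \<Lambda> x (indicator (E i)) - measure \<nu> (E i)\<bar> \<le> \<epsilon>)"
    using uniform_convergence_of_unique[OF unique E \<epsilon>] by blast
  then obtain L where L: "\<And>i. i \<in> I \<Longrightarrow> finite (L i)" "\<And>i. i \<in> I \<Longrightarrow> L i \<subseteq> carrier G"
    "\<And>i \<Lambda> x. i \<in> I \<Longrightarrow> finite \<Lambda> \<Longrightarrow> L i \<subseteq> \<Lambda> \<Longrightarrow> \<Lambda> \<subseteq> carrier G \<Longrightarrow> x \<in> \<Omega> \<Longrightarrow>
     \<bar>gibbs_avg \<Lambda> x (indicator (E i)) - measure \<nu> (E i)\<bar> \<le> \<epsilon>"
    by metis
  define \<Lambda> where "\<Lambda> = (\<Union>i\<in>I. L i)"
  have \<Lambda>: "finite \<Lambda>" "\<Lambda> \<subseteq> carrier G" using L I by (auto simp: \<Lambda>_def)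
  have close: "\<bar>gibbs_avg \<Lambda> \<xi> (indicator (E i)) - measure \<nu> (E i)\<bar> \<le> \<epsilon>" if "i \<in> I" "\<xi> \<in> \<Omega>" for i \<xi>
    by (rule L(3)[OF that(1) \<Lambda>(1) _ \<Lambda>(2) that(2)]) (use that in \<open>auto simp: \<Lambda>_def\<close>)
  show ?thesis
  \<comment> \<open>Only a nonempty family of events guarantees that \<open>K\<close> is a finite window.\<close>
  proof (cases "I = {}")
    case True
    show ?thesis
    proof (intro exI[of _ "{}"] exI[of _ 1] exI[of _ 0] conjI allI impI)
      fix V :: "'v set" and a assume V: "finite V" and a: "acts V a"
      have "(1 + exp (- 2 * B * real (card D))) ^ card V \<le> (1 + 1) ^ card V"
        using B[OF base_in] by (intro power_mono) (auto intro!: add_nonneg_nonneg mult_nonneg_nonneg order_trans[OF abs_ge_zero])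
      also have "\<dots> \<le> real (card A) ^ card V" using A2 by (intro power_mono) auto
      also have "\<dots> = real (card (confs V))" using V by (simp add: card_PiE)
      finally show "(1 + exp (- 2 * B * real (card D))) ^ card V \<le> 2 * real (card {x\<in>confs V. \<forall>i\<in>I. \<bar>real (card {v\<in>V. pull a x v \<in> E i}) - real (card V) * measure \<nu> (E i)\<bar> \<le> \<epsilon>1 * real (card V)})"
        using True by simp
    qed auto
  next
    case False
    then have K: "finite K" "K \<subseteq> carrier G" using E by (auto simp: depends_on_def)
    define M where "M = dependence_window \<Lambda> \<union> interacting \<Lambda> \<union> K"
    have M: "finite M" "M \<subseteq> carrier G"
      using finite_dependence_window[OF \<Lambda>] dependence_window_sub[OF \<Lambda>(2)] finite_interacting[OF \<Lambda>] K
      by (auto simp: M_def interacting_iff)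
    obtain n0 :: nat where n0: "real n0 > real (card K * card \<Lambda>) / \<epsilon>" using reals_Archimedean2 by blast
    show ?thesis
    proof (intro exI[of _ M] exI[of _ \<epsilon>] exI[of _ "Suc n0"] conjI allI impI M \<epsilon>)
      fix V :: "'v set" and a
      assume V: "finite V" and a: "acts V a" and n: "Suc n0 \<le> card V"
        and bad: "real (card {v\<in>V. \<not> inj_on (\<lambda>g. a g v) M}) \<le> \<epsilon> * real (card V)"
      let ?n = "real (card V)"
      let ?q = "exp (- 2 * B * real (card D))"
      define Z where "Z = (\<Sum>x\<in>confs V. weight V a x)"
      define Y where "Y i x = real (card {v\<in>V. pull a x v \<in> E i}) - ?n * measure \<nu> (E i)" for i x
      let ?T = "{x\<in>confs V. \<forall>i\<in>I. \<bar>Y i x\<bar> \<le> \<epsilon>1 * ?n}"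
      let ?bad = "\<lambda>i. {x\<in>confs V. \<epsilon>1 * ?n < \<bar>Y i x\<bar>}"
      have npos: "?n > 0" using n by simp
      have fin: "finite (confs V)" by (rule finite_confs[OF V])
      have wnn: "0 \<le> weight V a x" for x using weight_pos less_imp_le by blast
      have Z0: "0 \<le> Z" unfolding Z_def by (rule sum_nonneg) (rule wnn)
      have kn: "real (card K * card \<Lambda>) * ?n \<le> \<epsilon> * ?n\<^sup>2"
      proof -
        have "real (card K * card \<Lambda>) / \<epsilon> \<le> ?n" using n0 n by linarith
        then have "real (card K * card \<Lambda>) \<le> \<epsilon> * ?n" using \<epsilon> by (simp add: field_simps)
        then have "real (card K * card \<Lambda>) * ?n \<le> \<epsilon> * ?n * ?n" by (intro mult_right_mono) auto
        then show ?thesis by (simp add: power2_eq_square mult.assoc)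
      qed
      have bad_i: "(\<Sum>x\<in>?bad i. weight V a x) * (\<epsilon>1 * ?n)\<^sup>2 \<le> 3 * \<epsilon> * ?n\<^sup>2 * Z" if i: "i \<in> I" for i
      proof -
        have "(\<Sum>x\<in>?bad i. weight V a x) * (\<epsilon>1 * ?n)\<^sup>2 = (\<Sum>x\<in>?bad i. weight V a x * (\<epsilon>1 * ?n)\<^sup>2)"
          by (rule sum_distrib_right)
        also have "\<dots> \<le> (\<Sum>x\<in>?bad i. weight V a x * (Y i x)\<^sup>2)"
        proof (intro sum_mono mult_left_mono wnn)
          fix x assume "x \<in> ?bad i"
          then have "(\<epsilon>1 * ?n)\<^sup>2 \<le> \<bar>Y i x\<bar>\<^sup>2" using \<epsilon>1 by (intro power_mono) auto
          then show "(\<epsilon>1 * ?n)\<^sup>2 \<le> (Y i x)\<^sup>2" by simp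
        qed
        also have "\<dots> \<le> (\<Sum>x\<in>confs V. weight V a x * (Y i x)\<^sup>2)"
          using fin wnn by (intro sum_mono2) auto
        also have "\<dots> \<le> (\<epsilon> * ?n\<^sup>2 + \<epsilon> * ?n\<^sup>2 + real (card K * card \<Lambda>) * ?n) * Z"
          unfolding Y_def Z_def
          by (rule second_moment[OF a V \<Lambda> E(1)[OF i] _ close[OF i]]) (use bad \<epsilon> in \<open>auto simp: M_def\<close>)
        also have "\<dots> \<le> (3 * \<epsilon> * ?n\<^sup>2) * Z"
          using kn wnn by (intro mult_right_mono) (auto simp: Z_def intro!: sum_nonneg)
        finally show ?thesis .
      qed
      have "(\<Sum>x\<in>confs V - ?T. weight V a x) \<le>
          (\<Sum>x\<in>confs V - ?T. \<Sum>i\<in>I. if \<epsilon>1 * ?n < \<bar>Y i x\<bar> then weight V a x else 0)"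
      proof (rule sum_mono)
        fix x assume "x \<in> confs V - ?T"
        then obtain i where i: "i \<in> I" "\<epsilon>1 * ?n < \<bar>Y i x\<bar>" by auto
        then have "weight V a x = (\<Sum>j\<in>{i}. if \<epsilon>1 * ?n < \<bar>Y j x\<bar> then weight V a x else 0)" by simp
        also have "\<dots> \<le> (\<Sum>j\<in>I. if \<epsilon>1 * ?n < \<bar>Y j x\<bar> then weight V a x else 0)"
          using i I wnn by (intro sum_mono2) auto
        finally show "weight V a x \<le> \<dots>" .
      qed
      also have "\<dots> \<le> (\<Sum>x\<in>confs V. \<Sum>i\<in>I. if \<epsilon>1 * ?n < \<bar>Y i x\<bar> then weight V a x else 0)"
        using fin wnn by (intro sum_mono2) (auto intro!: sum_nonneg)
      also have "\<dots> = (\<Sum>i\<in>I. \<Sum>x\<in>?bad i. weight V a x)"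
        by (subst sum.swap) (simp only: sum.inter_filter[OF fin])
      finally have "(\<Sum>x\<in>confs V - ?T. weight V a x) * (\<epsilon>1 * ?n)\<^sup>2 \<le> (\<Sum>i\<in>I. \<Sum>x\<in>?bad i. weight V a x) * (\<epsilon>1 * ?n)\<^sup>2"
        by (rule mult_right_mono) simp
      also have "\<dots> \<le> (\<Sum>i\<in>I. 3 * \<epsilon> * ?n\<^sup>2 * Z)"
        by (subst sum_distrib_right) (intro sum_mono bad_i)
      also have "\<dots> = (real (card I) * (3 * \<epsilon>)) * (?n\<^sup>2 * Z)" by simp
      also have "\<dots> \<le> (\<epsilon>1\<^sup>2 / 2) * (?n\<^sup>2 * Z)"
        using I\<epsilon> Z0 by (intro mult_right_mono mult_nonneg_nonneg) auto
      finally have "(\<Sum>x\<in>confs V - ?T. weight V a x) * (\<epsilon>1 * ?n)\<^sup>2 \<le> (Z / 2) * (\<epsilon>1 * ?n)\<^sup>2"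
        by (simp add: power_mult_distrib mult_ac)
      moreover have "(\<epsilon>1 * ?n)\<^sup>2 > 0" using \<epsilon>1 npos by simp
      ultimately have "(\<Sum>x\<in>confs V - ?T. weight V a x) \<le> Z / 2" by (simp only: mult_le_cancel_right_pos)
      moreover have "Z = (\<Sum>x\<in>confs V - ?T. weight V a x) + (\<Sum>x\<in>?T. weight V a x)"
        unfolding Z_def by (rule sum.subset_diff) (use fin in auto)
      ultimately have half: "Z \<le> 2 * (\<Sum>x\<in>?T. weight V a x)" by linarith
      have "(1 + ?q) ^ card V * Z \<le> 2 * (\<Sum>x\<in>?T. (1 + ?q) ^ card V * weight V a x)"
      proof -
        have "(1 + ?q) ^ card V * Z \<le> (1 + ?q) ^ card V * (2 * (\<Sum>x\<in>?T. weight V a x))"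
          using half by (rule mult_left_mono) (simp add: add_nonneg_nonneg)
        then show ?thesis by (simp add: sum_distrib_left mult_ac)
      qed
      also have "(\<Sum>x\<in>?T. (1 + ?q) ^ card V * weight V a x) \<le> (\<Sum>x\<in>?T. Z)"
        unfolding Z_def by (intro sum_mono weight_le_total[OF a V _ A2 B]) auto
      finally have "(1 + ?q) ^ card V * Z \<le> (2 * real (card ?T)) * Z" by simp
      moreover have "0 < Z"
      proof -
        have "confs V \<noteq> {}" using A_ne by (simp add: PiE_eq_empty_iff)
        then show ?thesis unfolding Z_def using fin weight_pos by (intro sum_pos) auto
      qed
      ultimately show "(1 + ?q) ^ card V \<le> 2 * real (card {x\<in>confs V. \<forall>i\<in>I. \<bar>real (card {v\<in>V. pull a x v \<in> E i}) - ?n * measure \<nu> (E i)\<bar> \<le> \<epsilon>1 * ?n})"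
        by (simp only: mult_le_cancel_right_pos Y_def)
    qed
  qed
qed

end

section \<open>Approximation of finite partitions, and their entropy\<close>

text \<open>
  The approximable sets form a sigma-algebra: a countable union is first truncated to a finite one,
  whose finitely many members are then approximated.
\<close>

lemma (in prob_space) approximation_by_algebra:
  assumes alg: "algebra (space M) \<A>" and sub: "\<A> \<subseteq> events"
    and B: "B \<in> sigma_sets (space M) \<A>" and \<epsilon>: "0 < \<epsilon>"
  shows "\<exists>E\<in>\<A>. prob ((B - E) \<union> (E - B)) < \<epsilon>"
  using B \<epsilon>
proof (induction arbitrary: \<epsilon> rule: sigma_sets.induct)
  case (Basic B)
  then show ?case by (intro bexI[of _ B]) auto
next
  case Empty
  interpret algebra "space M" \<A> by (rule alg)
  show ?case using Empty by (intro bexI[of _ "{}"]) auto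
next
  case (Compl B)
  interpret algebra "space M" \<A> by (rule alg)
  obtain E where E: "E \<in> \<A>" "prob ((B - E) \<union> (E - B)) < \<epsilon>" using Compl(2)[OF Compl(3)] by (elim bexE)
  have "B \<subseteq> space M" by (rule sigma_sets_into_sp[OF space_closed Compl(1)])
  moreover have "E \<subseteq> space M" using E space_closed by auto
  ultimately have "((space M - B) - (space M - E)) \<union> ((space M - E) - (space M - B)) = (B - E) \<union> (E - B)" by auto
  then show ?case using E by (intro bexI[of _ "space M - E"]) auto
next
  case (Union B)
  interpret algebra "space M" \<A> by (rule alg)
  have ev: "sigma_sets (space M) \<A> \<subseteq> events" using sub by (rule sets.sigma_sets_subset)
  have Bev: "B i \<in> events" for i using Union(1) ev by auto
  let ?U = "\<Union>i. B i"
  let ?P = "\<lambda>n. \<Union>i<n. B i"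
  have "(\<lambda>n. prob (?P n)) \<longlonglongrightarrow> prob (\<Union>n. ?P n)"
    by (rule finite_Lim_measure_incseq) (use Bev in \<open>auto simp: incseq_def intro!: less_le_trans\<close>)
  also have "(\<Union>n. ?P n) = ?U" by auto
  finally have "eventually (\<lambda>n. prob ?U - \<epsilon> / 2 < prob (?P n)) sequentially"
    using Union(3) by (intro order_tendstoD) auto
  then obtain n where n: "prob ?U - \<epsilon> / 2 < prob (?P n)" by (auto simp: eventually_sequentially)
  have "\<forall>i. \<exists>E\<in>\<A>. prob ((B i - E) \<union> (E - B i)) < \<epsilon> / (2 * (real n + 1))"
    using Union(2,3) by auto
  then obtain E where E: "\<And>i. E i \<in> \<A>" "\<And>i. prob ((B i - E i) \<union> (E i - B i)) < \<epsilon> / (2 * (real n + 1))"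
    by metis
  have Eev: "E i \<in> events" for i using E(1) sub by auto
  let ?F = "\<Union>i<n. E i"
  let ?d = "\<lambda>i. (B i - E i) \<union> (E i - B i)"
  have "prob ((?U - ?F) \<union> (?F - ?U)) \<le> prob ((?U - ?P n) \<union> (\<Union>i<n. ?d i))"
    by (intro finite_measure_mono) (use Bev Eev in auto)
  also have "\<dots> \<le> prob (?U - ?P n) + prob (\<Union>i<n. ?d i)"
    by (intro measure_Un_le) (use Bev Eev in auto)
  also have "prob (?U - ?P n) = prob ?U - prob (?P n)"
    by (intro finite_measure_Diff) (use Bev in auto)
  also have "prob (\<Union>i<n. ?d i) \<le> (\<Sum>i<n. prob (?d i))"
    by (intro finite_measure_subadditive_finite) (use Bev Eev in auto)
  also have "\<dots> \<le> (\<Sum>i<n. \<epsilon> / (2 * (real n + 1)))" using E(2) by (intro sum_mono less_imp_le)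
  also have "\<dots> = real n * \<epsilon> / (2 * (real n + 1))" by simp
  also have "\<dots> \<le> \<epsilon> / 2" using Union(3) by (simp add: field_simps)
  finally have "prob ((?U - ?F) \<union> (?F - ?U)) < \<epsilon>" using n by linarith
  moreover have "?F \<in> \<A>" using E(1) by auto
  ultimately show ?case by (intro bexI[of _ ?F])
qed

text \<open>
  Approximate each fibre of \<open>Y\<close> by a member \<open>E s\<close> of the algebra. Off the small set \<open>N\<close> of points
  that lie in one of the symmetric differences, the value \<open>Y x\<close> is the only \<open>s\<close> with \<open>x \<in> E s\<close>.
\<close>

lemma (in prob_space) approximation_of_map:
  assumes alg: "algebra (space M) \<A>" and sub: "\<A> \<subseteq> events"
    and S: "finite S" "S \<noteq> {}" and Y: "\<And>x. x \<in> space M \<Longrightarrow> Y x \<in> S"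
    and fib: "\<And>s. s \<in> S \<Longrightarrow> {x\<in>space M. Y x = s} \<in> events"
    and approx: "\<And>s. s \<in> S \<Longrightarrow> \<exists>B\<in>sigma_sets (space M) \<A>.
       ({x\<in>space M. Y x = s} - B) \<union> (B - {x\<in>space M. Y x = s}) \<in> null_sets M"
    and \<epsilon>: "0 < \<epsilon>"
  shows "\<exists>E Y' N. (\<forall>s\<in>S. E s \<in> \<A>) \<and> (\<forall>x y. (\<forall>s\<in>S. x \<in> E s \<longleftrightarrow> y \<in> E s) \<longrightarrow> Y' x = Y' y) \<and> (\<forall>x. Y' x \<in> S) \<and>
     N \<in> events \<and> prob N \<le> \<epsilon> \<and> (\<forall>x\<in>space M - N. Y x = Y' x)"
proof -
  define \<delta> where "\<delta> = \<epsilon> / real (card S)"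
  have cS: "0 < real (card S)" using S by (simp add: card_gt_0_iff)
  have \<delta>: "0 < \<delta>" using \<epsilon> cS by (simp add: \<delta>_def)
  let ?Y = "\<lambda>s. {x\<in>space M. Y x = s}"
  have "\<exists>E\<in>\<A>. prob ((?Y s - E) \<union> (E - ?Y s)) \<le> \<delta>" if s: "s \<in> S" for s
  proof -
    obtain B where B: "B \<in> sigma_sets (space M) \<A>" "(?Y s - B) \<union> (B - ?Y s) \<in> null_sets M" using approx[OF s] by blast
    obtain E where E: "E \<in> \<A>" "prob ((B - E) \<union> (E - B)) < \<delta>"
      using approximation_by_algebra[OF alg sub B(1) \<delta>] by blast
    have ev: "B \<in> events" "E \<in> events" using B E sub sets.sigma_sets_subset[OF sub] by auto
    have "prob ((?Y s - E) \<union> (E - ?Y s)) \<le> prob (((?Y s - B) \<union> (B - ?Y s)) \<union> ((B - E) \<union> (E - B)))"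
      by (intro finite_measure_mono) (use ev fib[OF s] in auto)
    also have "\<dots> \<le> prob ((?Y s - B) \<union> (B - ?Y s)) + prob ((B - E) \<union> (E - B))"
      by (intro measure_Un_le) (use ev fib[OF s] in auto)
    also have "prob ((?Y s - B) \<union> (B - ?Y s)) = 0" using B(2) by (simp add: measure_eq_0_null_sets)
    finally show ?thesis using E by (intro bexI[of _ E]) auto
  qed
  then obtain E where E: "\<And>s. s \<in> S \<Longrightarrow> E s \<in> \<A>" "\<And>s. s \<in> S \<Longrightarrow> prob ((?Y s - E s) \<union> (E s - ?Y s)) \<le> \<delta>"
    using bchoice[of S "\<lambda>s E. E \<in> \<A> \<and> prob ((?Y s - E) \<union> (E - ?Y s)) \<le> \<delta>"] by auto
  obtain s0 where s0: "s0 \<in> S" using S by blast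
  define pick where "pick T = (if \<exists>s\<in>S. T = {s} then the_elem T else s0)" for T
  define Y' where "Y' x = pick {s\<in>S. x \<in> E s}" for x
  define N where "N = (\<Union>s\<in>S. (?Y s - E s) \<union> (E s - ?Y s))"
  have dev: "(?Y s - E s) \<union> (E s - ?Y s) \<in> events" if "s \<in> S" for s
    using fib[OF that] E(1)[OF that] sub by (intro sets.Un sets.Diff) auto
  have "prob N \<le> (\<Sum>s\<in>S. prob ((?Y s - E s) \<union> (E s - ?Y s)))"
    unfolding N_def by (intro finite_measure_subadditive_finite S) (use dev in blast)
  also have "\<dots> \<le> (\<Sum>s\<in>S. \<delta>)" by (rule sum_mono) (rule E(2))
  also have "\<dots> = \<epsilon>" using cS by (simp add: \<delta>_def)
  finally have N: "prob N \<le> \<epsilon>" .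
  show ?thesis
  proof (intro exI[of _ E] exI[of _ Y'] exI[of _ N] conjI ballI allI impI)
    fix x y assume "\<forall>s\<in>S. (x \<in> E s) = (y \<in> E s)"
    then have "{s\<in>S. x \<in> E s} = {s\<in>S. y \<in> E s}" by auto
    then show "Y' x = Y' y" by (simp add: Y'_def)
  next
    have "pick T \<in> S" if "T \<subseteq> S" for T using s0 that by (auto simp: pick_def)
    then show "Y' x \<in> S" for x by (simp add: Y'_def)
  next
    show "N \<in> events" unfolding N_def by (intro sets.finite_UN S dev)
  next
    fix x assume x: "x \<in> space M - N"
    have "x \<in> E s \<longleftrightarrow> Y x = s" if "s \<in> S" for s using that x unfolding N_def by blast
    then have "{s\<in>S. x \<in> E s} = {Y x}" using Y x by blast
    moreover have "Y x \<in> S" using Y x by blast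
    ultimately show "Y x = Y' x" by (simp add: Y'_def pick_def)
  qed (rule E(1) N; assumption?)+
qed

text \<open>
  Partitions written as the nonempty fibres of a labelling map, so that translates and common
  refinements of partitions become compositions and tuples of maps.
\<close>

definition fibre_partition :: "'x set \<Rightarrow> ('x \<Rightarrow> 'l) \<Rightarrow> 'x set set" where
  "fibre_partition X f = (\<lambda>x. {y\<in>X. f y = f x}) ` X"

lemma fibre_partition_cong:
  assumes "\<And>x y. x \<in> X \<Longrightarrow> y \<in> X \<Longrightarrow> f x = f y \<longleftrightarrow> h x = h y"
  shows "fibre_partition X f = fibre_partition X h"
  unfolding fibre_partition_def using assms by (intro image_cong refl Collect_cong conj_cong) auto

lemma common_refinement_fibre_partitions:
  assumes I: "I \<noteq> {}"
  shows "common_refinement ((\<lambda>i. fibre_partition X (f i)) ` I) = fibre_partition X (\<lambda>x. \<lambda>i\<in>I. f i x)"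
proof (intro equalityI subsetI)
  let ?P = "(\<lambda>i. fibre_partition X (f i)) ` I"
  fix B assume "B \<in> common_refinement ?P"
  then obtain c where c: "\<And>P. P \<in> ?P \<Longrightarrow> c P \<in> P" "B = \<Inter> (c ` ?P)" "B \<noteq> {}"
    unfolding common_refinement by (auto simp: Pi_iff)
  then obtain x where x: "x \<in> B" by blast
  have cell: "c (fibre_partition X (f i)) = {y\<in>X. f i y = f i x}" and xX: "x \<in> X" if i: "i \<in> I" for i
  proof -
    have "c (fibre_partition X (f i)) \<in> fibre_partition X (f i)" using c(1) i by auto
    moreover have "x \<in> c (fibre_partition X (f i))" using x c(2) i by auto
    moreover have cells: "\<exists>x'. Z = {y\<in>X. f i y = f i x'}" if "Z \<in> fibre_partition X (f i)" for Z
      using that by (auto simp: fibre_partition_def)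
    ultimately obtain x' where "c (fibre_partition X (f i)) = {y\<in>X. f i y = f i x'}"
      "x \<in> {y\<in>X. f i y = f i x'}"
      by metis
    then show "c (fibre_partition X (f i)) = {y\<in>X. f i y = f i x}" "x \<in> X" by auto
  qed
  have "B = {y\<in>X. \<forall>i\<in>I. f i y = f i x}" using c(2) cell I by auto
  also have "\<dots> = {y\<in>X. (\<lambda>i\<in>I. f i y) = (\<lambda>i\<in>I. f i x)}"
    by (intro Collect_cong conj_cong refl) (auto simp: restrict_def fun_eq_iff)
  finally show "B \<in> fibre_partition X (\<lambda>x. \<lambda>i\<in>I. f i x)"
    using xX I by (auto simp: fibre_partition_def)
next
  let ?P = "(\<lambda>i. fibre_partition X (f i)) ` I"
  fix B assume "B \<in> fibre_partition X (\<lambda>x. \<lambda>i\<in>I. f i x)"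
  then obtain x where x: "x \<in> X" "B = {y\<in>X. (\<lambda>i\<in>I. f i y) = (\<lambda>i\<in>I. f i x)}" by (auto simp: fibre_partition_def)
  have B: "B = {y\<in>X. \<forall>i\<in>I. f i y = f i x}"
    unfolding x(2) by (intro Collect_cong conj_cong refl) (auto simp: restrict_def fun_eq_iff)
  let ?c = "\<lambda>P. THE C. C \<in> P \<and> x \<in> C"
  have c: "?c (fibre_partition X (f i)) = {y\<in>X. f i y = f i x}" for i
    by (rule the_equality) (use x in \<open>auto simp: fibre_partition_def\<close>)
  have "?c \<in> (\<Pi> P\<in>?P. P)" using c x by (auto simp: fibre_partition_def)
  moreover have "B = \<Inter> (?c ` ?P)" unfolding B using c I by auto
  moreover have "B \<noteq> {}" using B x by auto
  ultimately show "B \<in> common_refinement ?P" unfolding common_refinement by blast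
qed

lemma translate_fibre_partition:
  assumes "act g ` space M = space M"
  shows "translate_partition M act g (fibre_partition (space M) f) = fibre_partition (space M) (\<lambda>x. f (act g x))"
proof -
  have "translate_partition M act g (fibre_partition (space M) f) =
     (\<lambda>x. act g -` {y\<in>space M. f y = f x} \<inter> space M) ` (act g ` space M)"
    using assms by (simp add: translate_partition_def fibre_partition_def image_image)
  also have "\<dots> = fibre_partition (space M) (\<lambda>x. f (act g x))"
    unfolding image_image fibre_partition_def using assms by (intro image_cong refl) auto
  finally show ?thesis .
qed

lemma shannon_entropy_fibre_partition:
  assumes L: "finite L" "f ` space M \<subseteq> L"
  shows "shannon_entropy M (fibre_partition (space M) f) = shannon L (\<lambda>l. measure M {x\<in>space M. f x = l})"
proof -
  let ?fib = "\<lambda>l. {x\<in>space M. f x = l}"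
  have "fibre_partition (space M) f = ?fib ` f ` space M" by (auto simp: fibre_partition_def image_image)
  moreover have "inj_on ?fib (f ` space M)" by (rule inj_onI) auto
  ultimately have "(\<Sum>B\<in>fibre_partition (space M) f. measure M B * ln (measure M B)) =
      (\<Sum>l\<in>f ` space M. measure M (?fib l) * ln (measure M (?fib l)))"
    by (simp add: sum.reindex o_def)
  also have "\<dots> = (\<Sum>l\<in>L. measure M (?fib l) * ln (measure M (?fib l)))"
  proof (rule sum.mono_neutral_left[OF L])
    show "\<forall>l\<in>L - f ` space M. measure M (?fib l) * ln (measure M (?fib l)) = 0"
    proof
      fix l assume "l \<in> L - f ` space M"
      then have "?fib l = {}" by auto
      then show "measure M (?fib l) * ln (measure M (?fib l)) = 0"
        by (simp only: measure_empty mult_zero_left)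
    qed
  qed
  finally show ?thesis by (simp add: shannon_entropy_def shannon_def)
qed

definition cell :: "'x set set \<Rightarrow> 'x \<Rightarrow> 'x set" where
  "cell \<beta> x = (THE B. B \<in> \<beta> \<and> x \<in> B)"

lemma cell:
  assumes "partition_on X \<beta>" "x \<in> X"
  shows "cell \<beta> x \<in> \<beta>" "x \<in> cell \<beta> x" "B \<in> \<beta> \<Longrightarrow> x \<in> B \<longleftrightarrow> cell \<beta> x = B"
proof -
  have ex: "\<exists>!B. B \<in> \<beta> \<and> x \<in> B"
    using assms by (auto simp: partition_on_def disjoint_def)
  show 1: "cell \<beta> x \<in> \<beta>" "x \<in> cell \<beta> x" using theI'[OF ex] by (auto simp: cell_def)
  show "x \<in> B \<longleftrightarrow> cell \<beta> x = B" if "B \<in> \<beta>" using ex 1 that by blast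
qed

lemma fibre_partition_cell:
  assumes "partition_on X \<beta>"
  shows "fibre_partition X (cell \<beta>) = \<beta>"
proof -
  have eq: "{y\<in>X. cell \<beta> y = cell \<beta> x} = cell \<beta> x" if "x \<in> X" for x
  proof -
    have "cell \<beta> x \<subseteq> X" using cell(1)[OF assms that] assms by (auto simp: partition_on_def)
    then show ?thesis using cell[OF assms] that by blast
  qed
  show ?thesis
  proof (intro equalityI subsetI)
    fix B assume B: "B \<in> \<beta>"
    then have "B \<noteq> {}" using assms by (auto simp: partition_on_def)
    then obtain x where x: "x \<in> B" by blast
    then have "x \<in> X" using B assms by (auto simp: partition_on_def)
    moreover have "cell \<beta> x = B" using cell(3)[OF assms \<open>x \<in> X\<close> B] x by simp
    ultimately show "B \<in> fibre_partition X (cell \<beta>)" using eq by (auto simp: fibre_partition_def)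
  qed (use eq cell(1)[OF assms] in \<open>auto simp: fibre_partition_def\<close>)
qed

text \<open>
  The events determined by finitely many of the coordinates \<open>T i\<close> form an algebra. It is applied
  with the letters of a configuration as coordinates and with the atoms of the translates of \<open>\<beta>\<close>.
\<close>

lemma (in prob_space) approximation_by_coordinates:
  fixes T :: "'i \<Rightarrow> 'a \<Rightarrow> 't"
  assumes S: "finite S" "S \<noteq> {}" and Y: "\<And>x. x \<in> space M \<Longrightarrow> Y x \<in> S"
    and fib: "\<And>s. s \<in> S \<Longrightarrow> {x\<in>space M. Y x = s} \<in> events"
    and gen: "\<And>C. C \<in> \<C> \<Longrightarrow> C \<in> events \<and> (\<exists>F. finite F \<and> F \<subseteq> I \<and>
        (\<forall>x\<in>space M. \<forall>y\<in>space M. (\<forall>i\<in>F. T i x = T i y) \<longrightarrow> (x \<in> C \<longleftrightarrow> y \<in> C)))"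
    and approx: "\<And>s. s \<in> S \<Longrightarrow> \<exists>B\<in>sigma_sets (space M) \<C>.
       ({x\<in>space M. Y x = s} - B) \<union> (B - {x\<in>space M. Y x = s}) \<in> null_sets M"
    and \<epsilon>: "0 < \<epsilon>"
  shows "\<exists>F Y' N. finite F \<and> F \<subseteq> I \<and>
     (\<forall>x\<in>space M. \<forall>y\<in>space M. (\<forall>i\<in>F. T i x = T i y) \<longrightarrow> Y' x = Y' y) \<and>
     (\<forall>x. Y' x \<in> S) \<and> N \<in> events \<and> prob N \<le> \<epsilon> \<and> (\<forall>x\<in>space M - N. Y x = Y' x)"
proof -
  define det where "det F E \<longleftrightarrow> finite F \<and> F \<subseteq> I \<and>
    (\<forall>x\<in>space M. \<forall>y\<in>space M. (\<forall>i\<in>F. T i x = T i y) \<longrightarrow> (x \<in> E \<longleftrightarrow> y \<in> E))" for F E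
  define \<A> where "\<A> = {E\<in>events. \<exists>F. det F E}"
  have det_mono: "det F' E" if "det F E" "F \<subseteq> F'" "finite F'" "F' \<subseteq> I" for F F' E
    using that unfolding det_def by blast
  have alg: "algebra (space M) \<A>"
    unfolding algebra_iff_Un
  proof (intro conjI ballI)
    show "\<A> \<subseteq> Pow (space M)" using sets.sets_into_space by (auto simp: \<A>_def)
    have "det {} {}" by (simp add: det_def)
    then show "{} \<in> \<A>" by (auto simp: \<A>_def)
    fix E assume E: "E \<in> \<A>"
    then obtain F where F: "det F E" by (auto simp: \<A>_def)
    then have "det F (space M - E)" unfolding det_def by blast
    then show "space M - E \<in> \<A>" using E by (auto simp: \<A>_def)
    fix E' assume E': "E' \<in> \<A>"
    then obtain F' where F': "det F' E'" by (auto simp: \<A>_def)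
    have "finite (F \<union> F')" "F \<union> F' \<subseteq> I" using F F' by (auto simp: det_def)
    then have "det (F \<union> F') E" "det (F \<union> F') E'" by (auto intro: det_mono[OF F] det_mono[OF F'])
    then have "det (F \<union> F') (E \<union> E')" unfolding det_def by blast
    then show "E \<union> E' \<in> \<A>" using E E' by (auto simp: \<A>_def)
  qed
  have "\<C> \<subseteq> \<A>" using gen by (auto simp: \<A>_def det_def)
  then have mono: "sigma_sets (space M) \<C> \<subseteq> sigma_sets (space M) \<A>" by (rule sigma_sets_mono')
  have "\<exists>E Y' N. (\<forall>s\<in>S. E s \<in> \<A>) \<and> (\<forall>x y. (\<forall>s\<in>S. x \<in> E s \<longleftrightarrow> y \<in> E s) \<longrightarrow> Y' x = Y' y) \<and> (\<forall>x. Y' x \<in> S) \<and>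
     N \<in> events \<and> prob N \<le> \<epsilon> \<and> (\<forall>x\<in>space M - N. Y x = Y' x)"
  proof (rule approximation_of_map[OF alg _ S Y fib _ \<epsilon>])
    show "\<A> \<subseteq> events" by (auto simp: \<A>_def)
    fix s assume "s \<in> S"
    from approx[OF this] mono show "\<exists>B\<in>sigma_sets (space M) \<A>.
       ({x\<in>space M. Y x = s} - B) \<union> (B - {x\<in>space M. Y x = s}) \<in> null_sets M" by blast
  qed
  then obtain E Y' N where E: "\<forall>s\<in>S. E s \<in> \<A>"
    and Y': "\<forall>x y. (\<forall>s\<in>S. x \<in> E s \<longleftrightarrow> y \<in> E s) \<longrightarrow> Y' x = Y' y" "\<forall>x. Y' x \<in> S"
    and N: "N \<in> events" "prob N \<le> \<epsilon>" "\<forall>x\<in>space M - N. Y x = Y' x"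
    by (elim exE conjE)
  have "\<forall>s\<in>S. \<exists>F. det F (E s)" using E by (auto simp: \<A>_def)
  then obtain F where F: "\<And>s. s \<in> S \<Longrightarrow> det (F s) (E s)" by metis
  show ?thesis
  proof (intro exI[of _ "\<Union>s\<in>S. F s"] exI[of _ Y'] exI[of _ N] conjI ballI impI allI)
    show "finite (\<Union>s\<in>S. F s)" "(\<Union>s\<in>S. F s) \<subseteq> I" using S F by (auto simp: det_def)
    fix x y assume xy: "x \<in> space M" "y \<in> space M" "\<forall>i\<in>\<Union>s\<in>S. F s. T i x = T i y"
    show "Y' x = Y' y"
    proof (rule Y'(1)[rule_format])
      fix s assume s: "s \<in> S"
      then have "\<forall>i\<in>F s. T i x = T i y" using xy(3) by blast
      then show "x \<in> E s \<longleftrightarrow> y \<in> E s" using F[OF s] xy(1,2) unfolding det_def by blast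
    qed
  qed (use Y' N in auto)
qed

lemma (in prob_space) prob_close:
  assumes "E \<in> events" "E' \<in> events" "N \<in> events" "\<And>x. x \<in> space M - N \<Longrightarrow> x \<in> E \<longleftrightarrow> x \<in> E'"
  shows "\<bar>prob E - prob E'\<bar> \<le> prob N"
proof -
  have "prob E1 \<le> prob E2 + prob N" if "E1 \<in> events" "E2 \<in> events" "\<And>x. x \<in> space M - N \<Longrightarrow> x \<in> E1 \<longleftrightarrow> x \<in> E2" for E1 E2
  proof -
    have "E1 \<subseteq> E2 \<union> N" using that(3) sets.sets_into_space[OF that(1)] by blast
    then have "prob E1 \<le> prob (E2 \<union> N)" using that assms(3) by (intro finite_measure_mono) auto
    also have "\<dots> \<le> prob E2 + prob N" using that assms(3) by (intro measure_Un_le) auto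
    finally show ?thesis .
  qed
  from this[OF assms(1,2,4)] this[OF assms(2,1)] assms(4) show ?thesis by fastforce
qed

lemma (in prob_space) prob_sum_fibres:
  assumes "finite L" "\<And>x. x \<in> space M \<Longrightarrow> f x \<in> L" "\<And>l. l \<in> L \<Longrightarrow> {x\<in>space M. P x \<and> f x = l} \<in> events"
  shows "prob {x\<in>space M. P x} = (\<Sum>l\<in>L. prob {x\<in>space M. P x \<and> f x = l})"
proof -
  have "{x\<in>space M. P x} = (\<Union>l\<in>L. {x\<in>space M. P x \<and> f x = l})" using assms(2) by auto
  then show ?thesis
    using assms by (simp only:) (intro finite_measure_finite_Union; auto simp: disjoint_family_on_def)
qed

section \<open>The lower bound for every level of the f-invariant\<close>

locale free_group_potential = free_group G m s + lattice_potential G A D \<phi>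
  for G :: "('g, 'b) monoid_scheme" (structure) and m :: nat and s :: "nat \<Rightarrow> 'g"
    and A :: "'a set" and D :: "'g set" and \<phi> :: "('g \<Rightarrow> 'a) \<Rightarrow> real"
begin

lemma finite_word_ball: "finite (word_ball G m s r)"
proof -
  have "{w \<in> words m. length w \<le> r} = {w. set w \<subseteq> {..<m} \<times> UNIV \<and> length w \<le> r}"
    by (auto simp: words_def)
  then show ?thesis unfolding word_ball_def by (simp add: finite_lists_length_le)
qed

lemma word_ball_sub: "word_ball G m s r \<subseteq> carrier G"
  by (auto simp: word_ball_def intro: word_val_closed)

lemma one_in_word_ball: "\<one> \<in> word_ball G m s r"
  unfolding word_ball_def by (rule image_eqI[of _ _ "[]"]) (auto simp: words_def)

lemma shift_shift:
  assumes "g \<in> carrier G" "h \<in> carrier G"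
  shows "shift G h (shift G g x) = shift G (h \<otimes> g) x"
  using assms by (auto simp: shift_def fun_eq_iff m_assoc)

lemma shift_one: "x \<in> \<Omega> \<Longrightarrow> shift G \<one> x = x"
  by (intro ext) (auto simp: shift_def PiE_iff extensional_def)

lemma shift_image:
  assumes "g \<in> carrier G"
  shows "shift G g ` \<Omega> = \<Omega>"
proof (intro equalityI subsetI)
  fix x assume x: "x \<in> \<Omega>"
  have "shift G g (shift G (inv g) x) = x" using assms x by (simp add: shift_shift shift_one)
  then show "x \<in> shift G g ` \<Omega>" using shift_in[OF inv_closed[OF assms] x] by (metis imageI)
qed (use shift_in[OF assms] in auto)

lemma acts_act: "\<sigma> \<in> perm_tuples m V \<Longrightarrow> acts V (act \<sigma>)"
  unfolding acts_def by (intro conjI ballI act_in act_one act_mult)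

end

text \<open>
  The setting at a fixed level: \<open>C\<close> is the ball in the f-invariant, and the points are labelled by the
  atoms of the partition \<open>\<beta>\<close> iterated over \<open>C\<close>.
\<close>

locale invariant_partition = free_group_potential G m s A D \<phi> + prob_space \<nu>
  for G :: "('g, 'b) monoid_scheme" (structure) and m :: nat and s :: "nat \<Rightarrow> 'g"
    and A :: "'a set" and D :: "'g set" and \<phi> :: "('g \<Rightarrow> 'a) \<Rightarrow> real" and \<nu> :: "('g \<Rightarrow> 'a) measure" +
  fixes \<beta> :: "('g \<Rightarrow> 'a) set set" and C :: "'g set"
  assumes sets_\<nu>: "sets \<nu> = sets (config_space G A)"
    and invariant: "shift_invariant G \<nu>"
    and partition: "finite_partition \<nu> \<beta>"
    and C: "finite C" "C \<subseteq> carrier G" "\<one> \<in> C"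
begin

lemma space_\<nu>: "space \<nu> = \<Omega>"
  using sets_eq_imp_space_eq[OF sets_\<nu>] by (simp add: space_config)

lemma borel_prob_\<nu>: "borel_prob G A \<nu>"
  using prob_space_axioms sets_\<nu> by (simp add: borel_prob_def)

lemma finite_\<beta>: "finite \<beta>" and \<beta>_events: "\<beta> \<subseteq> events" and \<beta>_partition: "partition_on \<Omega> \<beta>"
  using partition by (auto simp: finite_partition_def space_\<nu>)

lemma shift_measurable:
  assumes g: "g \<in> carrier G"
  shows "shift G g \<in> measurable \<nu> \<nu>"
proof -
  have "(\<lambda>x. \<lambda>h\<in>carrier G. x (h \<otimes> g)) \<in> measurable (config_space G A) (config_space G A)"
    unfolding config_space_def using g
    by (intro measurable_restrict measurable_component_singleton) auto
  then show ?thesis unfolding measurable_cong_sets[OF sets_\<nu> sets_\<nu>] by (simp add: shift_def[abs_def])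
qed

lemma shift_preimage_event:
  "g \<in> carrier G \<Longrightarrow> E \<in> events \<Longrightarrow> {x\<in>\<Omega>. shift G g x \<in> E} \<in> events"
  using measurable_sets[OF shift_measurable, of g E] by (simp add: vimage_def space_\<nu> Int_def conj_commute)

lemma prob_shift_preimage:
  assumes g: "g \<in> carrier G" and E: "E \<in> events"
  shows "prob {x\<in>\<Omega>. shift G g x \<in> E} = prob E"
proof -
  have "distr \<nu> \<nu> (shift G g) = \<nu>" using invariant g by (auto simp: shift_invariant_def)
  then have "prob E = measure (distr \<nu> \<nu> (shift G g)) E" by simp
  also have "\<dots> = prob (shift G g -` E \<inter> space \<nu>)" by (rule measure_distr[OF shift_measurable[OF g] E])
  finally show ?thesis by (simp add: vimage_def space_\<nu> Int_def conj_commute)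
qed

abbreviation b :: "('g \<Rightarrow> 'a) \<Rightarrow> ('g \<Rightarrow> 'a) set" where "b \<equiv> cell \<beta>"

definition labels :: "('g \<Rightarrow> ('g \<Rightarrow> 'a) set) set" where "labels = (C \<rightarrow>\<^sub>E \<beta>)"

definition label :: "('g \<Rightarrow> 'a) \<Rightarrow> 'g \<Rightarrow> ('g \<Rightarrow> 'a) set" where
  "label x = (\<lambda>g\<in>C. b (shift G g x))"

definition label_dist :: "('g \<Rightarrow> ('g \<Rightarrow> 'a) set) \<Rightarrow> real" where
  "label_dist l = prob {x\<in>\<Omega>. label x = l}"

definition edge_dist :: "nat \<Rightarrow> ('g \<Rightarrow> ('g \<Rightarrow> 'a) set) \<times> ('g \<Rightarrow> ('g \<Rightarrow> 'a) set) \<Rightarrow> real" where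
  "edge_dist i l = prob {x\<in>\<Omega>. (label x, label (shift G (s i) x)) = l}"

lemma b_in: "x \<in> \<Omega> \<Longrightarrow> b x \<in> \<beta>"
  using cell(1)[OF \<beta>_partition] .

lemma \<beta>_ne: "\<beta> \<noteq> {}"
  using b_in[OF base_in] by auto

lemma finite_labels: "finite labels" and labels_ne: "labels \<noteq> {}"
  using C finite_\<beta> \<beta>_ne by (auto simp: labels_def PiE_eq_empty_iff intro!: finite_PiE)

lemma label_in: "x \<in> \<Omega> \<Longrightarrow> label x \<in> labels"
  using C by (auto simp: labels_def label_def intro!: b_in shift_in)

lemma b_event: "{x\<in>\<Omega>. b x = B} \<in> events"
proof (cases "B \<in> \<beta>")
  case True
  have "B \<subseteq> \<Omega>" using True \<beta>_partition by (auto simp: partition_on_def)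
  then have "{x\<in>\<Omega>. b x = B} = B" using cell(3)[OF \<beta>_partition _ True] by blast
  then show ?thesis using True \<beta>_events by auto
next
  case False
  then have "{x\<in>\<Omega>. b x = B} = {}" using b_in by auto
  then show ?thesis by (simp only: sets.empty_sets)
qed

lemma label_event: "{x\<in>\<Omega>. label x = l} \<in> events"
proof (cases "l \<in> labels")
  case True
  have "{x\<in>\<Omega>. label x = l} = (\<Inter>g\<in>C. {x\<in>\<Omega>. shift G g x \<in> {x\<in>\<Omega>. b x = l g}})"
  proof (intro equalityI subsetI)
    fix x assume x: "x \<in> {x\<in>\<Omega>. label x = l}"
    then have "l g = b (shift G g x)" if "g \<in> C" for g using that by (auto simp: label_def)
    then show "x \<in> (\<Inter>g\<in>C. {x\<in>\<Omega>. shift G g x \<in> {x\<in>\<Omega>. b x = l g}})"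
      using x C(2) by (auto intro!: shift_in)
  next
    fix x assume x: "x \<in> (\<Inter>g\<in>C. {x\<in>\<Omega>. shift G g x \<in> {x\<in>\<Omega>. b x = l g}})"
    then have "l g = b (shift G g x)" if "g \<in> C" for g using that by auto
    moreover have "x \<in> \<Omega>" using x C(3) by blast
    ultimately show "x \<in> {x\<in>\<Omega>. label x = l}"
      using True by (auto simp: label_def labels_def fun_eq_iff PiE_iff extensional_def)
  qed
  also have "\<dots> \<in> events"
    using C by (intro sets.finite_INT shift_preimage_event b_event) auto
  finally show ?thesis .
next
  case False
  then have "{x\<in>\<Omega>. label x = l} = {}" using label_in by auto
  then show ?thesis by (simp only: sets.empty_sets)
qed

lemma edge_event:
  assumes "i < m"
  shows "{x\<in>\<Omega>. (label x, label (shift G (s i) x)) = l} \<in> events"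
proof -
  have "{x\<in>\<Omega>. (label x, label (shift G (s i) x)) = l} =
     {x\<in>\<Omega>. label x = fst l} \<inter> {x\<in>\<Omega>. shift G (s i) x \<in> {x\<in>\<Omega>. label x = snd l}}"
    using shift_in[OF gen_closed[OF assms]] by (cases l) auto
  then show ?thesis
    using label_event shift_preimage_event[OF gen_closed[OF assms] label_event] by (simp only:) (rule sets.Int)
qed

lemma sum_label_dist: "(\<Sum>l\<in>labels. label_dist l) = 1"
  using prob_sum_fibres[of labels label "\<lambda>_. True"] finite_labels label_in label_event prob_space
  by (simp add: space_\<nu> label_dist_def)

lemma edge_dist_marginals:
  assumes i: "i < m"
  shows "label_dist l = (\<Sum>l'\<in>labels. edge_dist i (l, l'))" "label_dist l = (\<Sum>l'\<in>labels. edge_dist i (l', l))"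
proof -
  have "prob {x\<in>space \<nu>. label x = l} = (\<Sum>l'\<in>labels. prob {x\<in>space \<nu>. label x = l \<and> label (shift G (s i) x) = l'})"
    using edge_event[OF i] label_in shift_in[OF gen_closed[OF i]]
    by (intro prob_sum_fibres finite_labels) (auto simp: space_\<nu>)
  then show "label_dist l = (\<Sum>l'\<in>labels. edge_dist i (l, l'))"
    by (simp add: label_dist_def edge_dist_def space_\<nu>)
  have "prob {x\<in>space \<nu>. label (shift G (s i) x) = l} = (\<Sum>l'\<in>labels. prob {x\<in>space \<nu>. label (shift G (s i) x) = l \<and> label x = l'})"
  proof (rule prob_sum_fibres[OF finite_labels])
    fix l'
    show "{x\<in>space \<nu>. label (shift G (s i) x) = l \<and> label x = l'} \<in> events"
      using edge_event[OF i, of "(l', l)"] by (simp add: space_\<nu> conj_commute)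
  qed (auto simp: space_\<nu> label_in)
  moreover have "{x\<in>\<Omega>. label (shift G (s i) x) = l} = {x\<in>\<Omega>. shift G (s i) x \<in> {x\<in>\<Omega>. label x = l}}"
    using shift_in[OF gen_closed[OF i]] by auto
  ultimately show "label_dist l = (\<Sum>l'\<in>labels. edge_dist i (l', l))"
    using prob_shift_preimage[OF gen_closed[OF i] label_event[of l]]
    by (simp add: label_dist_def edge_dist_def space_\<nu> conj_commute)
qed

lemma iterated_partition_eq: "iterated_partition \<nu> (shift G) C \<beta> = fibre_partition \<Omega> label"
proof -
  have "(\<lambda>g. translate_partition \<nu> (shift G) g \<beta>) ` C = (\<lambda>g. fibre_partition \<Omega> (\<lambda>x. b (shift G g x))) ` C"
  proof (intro image_cong refl)
    fix g assume "g \<in> C"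
    then have "g \<in> carrier G" using C by auto
    from shift_image[OF this] have "shift G g ` space \<nu> = space \<nu>" by (simp add: space_\<nu>)
    from translate_fibre_partition[where act = "shift G" and g = g and M = \<nu> and f = b, OF this]
    show "translate_partition \<nu> (shift G) g \<beta> = fibre_partition \<Omega> (\<lambda>x. b (shift G g x))"
      by (simp add: space_\<nu> fibre_partition_cell[OF \<beta>_partition])
  qed
  then show ?thesis
    unfolding iterated_partition_def label_def using C(3)
    by (simp only:) (rule common_refinement_fibre_partitions, blast)
qed

lemma vertex_entropy: "shannon_entropy \<nu> (iterated_partition \<nu> (shift G) C \<beta>) = shannon labels label_dist"
  using shannon_entropy_fibre_partition[OF finite_labels, of label \<nu>] label_in
  by (auto simp: iterated_partition_eq space_\<nu> label_dist_def[abs_def] image_subset_iff)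

lemma edge_entropy:
  assumes i: "i < m"
  shows "shannon_entropy \<nu> (common_refinement {iterated_partition \<nu> (shift G) C \<beta>,
      translate_partition \<nu> (shift G) (s i) (iterated_partition \<nu> (shift G) C \<beta>)}) =
    shannon (labels \<times> labels) (edge_dist i)"
proof -
  let ?l2 = "\<lambda>x. label (shift G (s i) x)"
  have "shift G (s i) ` space \<nu> = space \<nu>" using shift_image[OF gen_closed[OF i]] by (simp add: space_\<nu>)
  from translate_fibre_partition[where act = "shift G" and g = "s i" and M = \<nu> and f = label, OF this]
  have "{iterated_partition \<nu> (shift G) C \<beta>, translate_partition \<nu> (shift G) (s i) (iterated_partition \<nu> (shift G) C \<beta>)}
     = (\<lambda>j. fibre_partition \<Omega> (if j then label else ?l2)) ` UNIV"
    by (auto simp: iterated_partition_eq space_\<nu> UNIV_bool)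
  then have "common_refinement {iterated_partition \<nu> (shift G) C \<beta>, translate_partition \<nu> (shift G) (s i) (iterated_partition \<nu> (shift G) C \<beta>)}
     = fibre_partition \<Omega> (\<lambda>x. \<lambda>j\<in>UNIV. (if j then label else ?l2) x)"
    by (simp only:) (rule common_refinement_fibre_partitions, blast)
  also have "\<dots> = fibre_partition (space \<nu>) (\<lambda>x. (label x, ?l2 x))"
    unfolding space_\<nu> by (rule fibre_partition_cong) (auto simp: fun_eq_iff)
  finally show ?thesis
    using shannon_entropy_fibre_partition[of "labels \<times> labels" "\<lambda>x. (label x, ?l2 x)" \<nu>] finite_labels
      label_in shift_in[OF gen_closed[OF i]]
    by (auto simp: edge_dist_def[abs_def] space_\<nu> image_subset_iff)
qed

lemma approximation_by_local_map:
  assumes "0 < \<epsilon>"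
  shows "\<exists>K b' N. depends_on K b' \<and> (\<forall>x. b' x \<in> \<beta>) \<and> N \<in> events \<and> prob N \<le> \<epsilon> \<and> (\<forall>x\<in>\<Omega> - N. b x = b' x)"
proof -
  let ?C = "prod_algebra (carrier G) (\<lambda>_. count_space A)"
  have "\<exists>F Y' N. finite F \<and> F \<subseteq> carrier G \<and>
     (\<forall>x\<in>space \<nu>. \<forall>y\<in>space \<nu>. (\<forall>i\<in>F. x i = y i) \<longrightarrow> Y' x = Y' y) \<and>
     (\<forall>x. Y' x \<in> \<beta>) \<and> N \<in> events \<and> prob N \<le> \<epsilon> \<and> (\<forall>x\<in>space \<nu> - N. b x = Y' x)"
  proof (rule approximation_by_coordinates[where \<C> = ?C and T = "\<lambda>g x. x g", OF finite_\<beta> \<beta>_ne _ _ _ _ assms])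
    fix E assume "E \<in> ?C"
    then obtain K where K: "depends_on K (\<lambda>x. x \<in> E)" "E \<subseteq> \<Omega>" by (rule prod_algebra_local)
    then show "E \<in> events \<and> (\<exists>F. finite F \<and> F \<subseteq> carrier G \<and>
        (\<forall>x\<in>space \<nu>. \<forall>y\<in>space \<nu>. (\<forall>i\<in>F. x i = y i) \<longrightarrow> (x \<in> E \<longleftrightarrow> y \<in> E)))"
      using local_event_sets[OF K] unfolding depends_on_def sets_\<nu> space_\<nu> by blast
  next
    fix B assume "B \<in> \<beta>"
    have "{x\<in>space \<nu>. b x = B} \<in> sigma_sets (space \<nu>) ?C"
      using b_event[of B] by (simp add: space_\<nu> sets_\<nu> sets_prod_algebra)
    then show "\<exists>B'\<in>sigma_sets (space \<nu>) ?C. ({x\<in>space \<nu>. b x = B} - B') \<union> (B' - {x\<in>space \<nu>. b x = B}) \<in> null_sets \<nu>"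
      by (rule bexI[rotated]) simp
  qed (use b_in b_event in \<open>auto simp: space_\<nu>\<close>)
  then obtain F Y' N where F: "finite F" "F \<subseteq> carrier G"
    and Y': "\<forall>x\<in>space \<nu>. \<forall>y\<in>space \<nu>. (\<forall>i\<in>F. x i = y i) \<longrightarrow> Y' x = Y' y"
    and N: "\<forall>x. Y' x \<in> \<beta>" "N \<in> events" "prob N \<le> \<epsilon>" "\<forall>x\<in>space \<nu> - N. b x = Y' x"
    by (elim exE conjE)
  have "depends_on F Y'" unfolding depends_on_def using F Y' by (simp only: space_\<nu>)
  then show ?thesis using N unfolding space_\<nu> by (intro exI conjI)
qed

text \<open>
  This is where \<open>\<beta>\<close> is used to generate: the letter at the identity is a function of finitely many
  translated atoms, up to a small error.
\<close>

lemma letter_from_labels: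
  assumes gen: "generating G \<nu> (shift G) \<beta>" and "0 < \<epsilon>"
  shows "\<exists>F \<psi> N. finite F \<and> F \<subseteq> carrier G \<and> N \<in> events \<and> prob N \<le> \<epsilon> \<and>
    (\<forall>x\<in>\<Omega> - N. x \<one> = \<psi> (\<lambda>g\<in>F. b (shift G g x)))"
proof -
  let ?C = "\<Union>g\<in>carrier G. translate_partition \<nu> (shift G) g \<beta>"
  have letter: "{x\<in>space \<nu>. x \<one> = a} \<in> events" for a
  proof (rule local_event_sets[where K = "{\<one>}", folded sets_\<nu>])
    show "depends_on {\<one>} (\<lambda>x. x \<in> {x\<in>space \<nu>. x \<one> = a})" by (simp add: depends_on_def space_\<nu>)
  qed (auto simp: space_\<nu>)
  have "\<exists>F Y' N. finite F \<and> F \<subseteq> carrier G \<and>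
     (\<forall>x\<in>space \<nu>. \<forall>y\<in>space \<nu>. (\<forall>g\<in>F. b (shift G g x) = b (shift G g y)) \<longrightarrow> Y' x = Y' y) \<and>
     (\<forall>x. Y' x \<in> A) \<and> N \<in> events \<and> prob N \<le> \<epsilon> \<and> (\<forall>x\<in>space \<nu> - N. x \<one> = Y' x)"
  proof (rule approximation_by_coordinates[where \<C> = ?C and T = "\<lambda>g x. b (shift G g x)", OF finite_A A_ne _ letter _ _ assms(2)])
    fix E assume "E \<in> ?C"
    then obtain g B where g: "g \<in> carrier G" "B \<in> \<beta>" "E = shift G g -` B \<inter> space \<nu>"
      by (auto simp: translate_partition_def)
    have "E \<in> events" using measurable_sets[OF shift_measurable[OF g(1)]] g \<beta>_events by auto
    moreover have "x \<in> E \<longleftrightarrow> b (shift G g x) = B" if "x \<in> space \<nu>" for x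
      using that g cell(3)[OF \<beta>_partition shift_in[OF g(1)] g(2), of x] by (auto simp: space_\<nu>)
    ultimately show "E \<in> events \<and> (\<exists>F. finite F \<and> F \<subseteq> carrier G \<and>
        (\<forall>x\<in>space \<nu>. \<forall>y\<in>space \<nu>. (\<forall>i\<in>F. b (shift G i x) = b (shift G i y)) \<longrightarrow> (x \<in> E \<longleftrightarrow> y \<in> E)))"
      using g by (intro conjI exI[of _ "{g}"]) auto
  next
    fix a
    show "\<exists>B'\<in>sigma_sets (space \<nu>) ?C. ({x\<in>space \<nu>. x \<one> = a} - B') \<union> (B' - {x\<in>space \<nu>. x \<one> = a}) \<in> null_sets \<nu>"
      using gen letter[of a] unfolding generating_def by blast
  qed (auto simp: space_\<nu>)
  then obtain F Y' N where F: "finite F" "F \<subseteq> carrier G"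
    and Y': "\<forall>x\<in>space \<nu>. \<forall>y\<in>space \<nu>. (\<forall>g\<in>F. b (shift G g x) = b (shift G g y)) \<longrightarrow> Y' x = Y' y"
    and N: "N \<in> events" "prob N \<le> \<epsilon>" "\<forall>x\<in>space \<nu> - N. x \<one> = Y' x"
    by (elim exE conjE)
  define \<psi> where "\<psi> w = Y' (SOME x. x \<in> \<Omega> \<and> w = (\<lambda>g\<in>F. b (shift G g x)))" for w
  have \<psi>: "\<psi> (\<lambda>g\<in>F. b (shift G g x)) = Y' x" if x: "x \<in> \<Omega>" for x
  proof -
    define y where "y = (SOME y. y \<in> \<Omega> \<and> (\<lambda>g\<in>F. b (shift G g x)) = (\<lambda>g\<in>F. b (shift G g y)))"
    have y: "y \<in> \<Omega> \<and> (\<lambda>g\<in>F. b (shift G g x)) = (\<lambda>g\<in>F. b (shift G g y))"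
      unfolding y_def by (rule someI[of _ x]) (use x in blast)
    have "b (shift G g y) = b (shift G g x)" if "g \<in> F" for g
      using fun_cong[OF conjunct2[OF y], of g] that by simp
    moreover have "y \<in> space \<nu>" "x \<in> space \<nu>" using y x unfolding space_\<nu> by blast+
    ultimately have "Y' y = Y' x" using Y' by blast
    then show ?thesis by (simp only: \<psi>_def y_def)
  qed
  show ?thesis
    using F N \<psi> by (intro exI[of _ F] exI[of _ \<psi>] exI[of _ N]) (auto simp: space_\<nu>)
qed

text \<open>
  Both sides of the count of labelled permutations are compared. The labelling \<open>Y \<sigma> x\<close> of a typical
  configuration \<open>x\<close> has the right statistics, and \<open>x\<close> can be guessed from it up to a proportion \<open>\<delta>\<close>
  of wrong letters. Of the rate \<open>c\<close> of typical configurations, \<open>c / 8\<close> is lost to the wrong letters,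
  while the upper bound on the count exceeds its exponent by \<open>c / 8\<close>; an exponent below \<open>c / 2\<close>
  contradicts \<open>7 c / 8 > c / 2 + c / 8\<close>.
\<close>

lemma level_entropy_lower_bound:
  assumes unique: "\<And>\<mu>. gibbs_measure G A D \<phi> \<mu> \<Longrightarrow> \<mu> = \<nu>" and A2: "card A \<ge> 2"
    and B: "\<And>x. x \<in> \<Omega> \<Longrightarrow> \<bar>\<phi> x\<bar> \<le> B" and gen: "generating G \<nu> (shift G) \<beta>"
  defines "c \<equiv> ln (1 + exp (- 2 * B * real (card D)))"
  shows "c / 2 \<le> (1 - 2 * real m) * shannon labels label_dist + (\<Sum>i<m. shannon (labels \<times> labels) (edge_dist i))"
proof (rule ccontr)
  let ?F = "(1 - 2 * real m) * shannon labels label_dist + (\<Sum>i<m. shannon (labels \<times> labels) (edge_dist i))"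
  assume "\<not> c / 2 \<le> ?F"
  then have F: "?F < c / 2" by simp
  have c: "c > 0" unfolding c_def by (rule ln_gt_zero) simp
  have "\<exists>\<delta>>0. \<forall>(V :: nat set) (x :: nat \<Rightarrow> 'a). finite V \<longrightarrow>
    real (card {y \<in> confs V. real (hamming V x y) \<le> \<delta> * real (card V)}) \<le> exp (c / 8 * real (card V))"
    by (rule small_hamming_balls[OF finite_A]) (use c in simp)
  then obtain \<delta> where \<delta>: "\<delta> > 0" "\<forall>(V :: nat set) (x :: nat \<Rightarrow> 'a). finite V \<longrightarrow>
    real (card {y \<in> confs V. real (hamming V x y) \<le> \<delta> * real (card V)}) \<le> exp (c / 8 * real (card V))"
    by (elim exE conjE)
  define \<eta> where "\<eta> = c / (8 * (real m + 1))"
  have \<eta>: "\<eta> > 0" "(real m + 1) * \<eta> = c / 8" using c by (auto simp: \<eta>_def field_simps add_nonneg_eq_0_iff)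
  let ?S = "\<lambda>(V :: nat set) \<epsilon>. {(y, \<sigma>). y \<in> V \<rightarrow>\<^sub>E labels \<and> \<sigma> \<in> perm_tuples m V \<and> near_type V labels label_dist \<epsilon> y \<and>
        (\<forall>i<m. near_type V (labels \<times> labels) (edge_dist i) \<epsilon> (\<lambda>v. (y v, y (\<sigma> i v))))}"
  have "\<exists>\<epsilon>>0. \<exists>n0. \<forall>V :: nat set. finite V \<longrightarrow> card V \<ge> n0 \<longrightarrow>
    real (card (?S V \<epsilon>)) \<le> fact (card V) ^ m * exp (real (card V) * (?F + (real m + 1) * \<eta>))"
    by (rule card_labelled_perm_tuples[OF finite_labels labels_ne _ sum_label_dist _ edge_dist_marginals \<eta>(1)])
       (simp_all add: label_dist_def edge_dist_def)
  then obtain \<epsilon>c n1 where \<epsilon>c: "\<epsilon>c > 0" and S_le: "\<forall>V :: nat set. finite V \<longrightarrow> card V \<ge> n1 \<longrightarrow>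
    real (card (?S V \<epsilon>c)) \<le> fact (card V) ^ m * exp (real (card V) * (?F + (real m + 1) * \<eta>))"
    by (elim exE conjE)
  have \<delta>4: "0 < \<delta> / 4" using \<delta>(1) by simp
  obtain R \<psi> N2 where R: "finite R" "R \<subseteq> carrier G" and N2: "N2 \<in> events" "prob N2 \<le> \<delta> / 4"
    and \<psi>: "\<forall>x\<in>\<Omega> - N2. x \<one> = \<psi> (\<lambda>g\<in>R. b (shift G g x))"
    using letter_from_labels[OF gen \<delta>4] by (elim exE conjE)
  \<comment> \<open>All translations at which the approximation of \<open>\<beta>\<close> is evaluated below; this set must be fixed
    before the accuracy \<open>\<epsilon>b\<close> is chosen.\<close>
  define H where "H = C \<union> (\<Union>i<m. (\<lambda>g. g \<otimes> s i) ` C) \<union> R"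
  have H: "finite H" "H \<subseteq> carrier G" "C \<subseteq> H" "R \<subseteq> H"
    using C R gen_closed by (auto simp: H_def)
  have Hs: "g \<otimes> s i \<in> H" if "g \<in> C" "i < m" for g i using that by (auto simp: H_def)
  define \<epsilon>1 where "\<epsilon>1 = min (\<epsilon>c / 2) (\<delta> / 4)"
  have \<epsilon>1: "0 < \<epsilon>1" using \<epsilon>c \<delta> by (simp add: \<epsilon>1_def)
  define \<epsilon>b where "\<epsilon>b = \<epsilon>1 / (real (card H) + 1)"
  have \<epsilon>b: "0 < \<epsilon>b" using \<epsilon>1 by (auto simp: \<epsilon>b_def intro!: divide_pos_pos add_nonneg_pos)
  have H\<epsilon>b: "real (card H) * \<epsilon>b \<le> \<epsilon>1"
  proof -
    have "(real (card H) + 1) * \<epsilon>b = \<epsilon>1" by (simp add: \<epsilon>b_def field_simps add_nonneg_eq_0_iff)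
    then show ?thesis using \<epsilon>b by (simp add: algebra_simps)
  qed
  obtain K b' N1 where b': "depends_on K b'" "\<forall>x. b' x \<in> \<beta>" and N1: "N1 \<in> events" "prob N1 \<le> \<epsilon>b"
    and bb': "\<forall>x\<in>\<Omega> - N1. b x = b' x"
    using approximation_by_local_map[OF \<epsilon>b] by (elim exE conjE)
  define Bad where "Bad = (\<Union>h\<in>H. {x\<in>\<Omega>. shift G h x \<in> N1})"
  have pre: "{x\<in>\<Omega>. shift G h x \<in> N1} \<in> events" "prob {x\<in>\<Omega>. shift G h x \<in> N1} \<le> \<epsilon>b" if "h \<in> H" for h
    using shift_preimage_event[of h N1] prob_shift_preimage[of h N1] that H N1 by auto
  have Bad: "Bad \<in> events" "prob Bad \<le> \<epsilon>1"
  proof -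
    show "Bad \<in> events" unfolding Bad_def by (intro sets.finite_UN H pre)
    have "prob Bad \<le> (\<Sum>h\<in>H. prob {x\<in>\<Omega>. shift G h x \<in> N1})"
      unfolding Bad_def by (intro finite_measure_subadditive_finite H) (use pre in blast)
    also have "\<dots> \<le> (\<Sum>h\<in>H. \<epsilon>b)" by (intro sum_mono pre)
    finally show "prob Bad \<le> \<epsilon>1" using H\<epsilon>b by simp
  qed
  have off_Bad: "b (shift G h x) = b' (shift G h x)" if "x \<in> \<Omega> - Bad" "h \<in> H" for x h
    using that bb' shift_in[of h x] H unfolding Bad_def by blast
  define label' where "label' x = (\<lambda>g\<in>C. b' (shift G g x))" for x
  \<comment> \<open>The local approximations to the label and to the letter at the identity.\<close>
  define guess where "guess x = \<psi> (\<lambda>g\<in>R. b' (shift G g x))" for x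
  \<comment> \<open>The events whose frequencies are controlled: a wrong guess, a label at a point, and a pair of
    labels along an edge.\<close>
  define E where "E e = (case e of None \<Rightarrow> {x\<in>\<Omega>. x \<one> \<noteq> guess x}
     | Some (Inl l) \<Rightarrow> {x\<in>\<Omega>. label' x = l}
     | Some (Inr (i, ll)) \<Rightarrow> {x\<in>\<Omega>. (label' x, label' (shift G (s i) x)) = ll})" for e
  define I where "I = insert None (Some ` (Inl ` labels \<union> Inr ` ({..<m} \<times> (labels \<times> labels))))"
  have finI: "finite I" using finite_labels by (simp add: I_def)
  define Kw where "Kw = insert \<one> (\<Union>h\<in>H. (\<lambda>k. k \<otimes> h) ` K)"
  have Kw: "finite Kw" "Kw \<subseteq> carrier G" using b'(1) H by (auto simp: Kw_def depends_on_def)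
  have shift_s: "b' (shift G g (shift G (s i) x)) = b' (shift G (g \<otimes> s i) x)" if "g \<in> C" "i < m" for g i x
    using that C gen_closed by (subst shift_shift) auto
  have label'_cong: "label' x = label' y \<and> guess x = guess y \<and> (\<forall>i<m. label' (shift G (s i) x) = label' (shift G (s i) y))"
    if "\<And>h. h \<in> H \<Longrightarrow> b' (shift G h x) = b' (shift G h y)" for x y
  proof (intro conjI allI impI)
    show "label' x = label' y" unfolding label'_def using that H by (intro restrict_ext) auto
    show "guess x = guess y" unfolding guess_def using that H by (intro arg_cong[where f = \<psi>] restrict_ext) auto
    show "label' (shift G (s i) x) = label' (shift G (s i) y)" if i: "i < m" for i
      unfolding label'_def using \<open>\<And>h. h \<in> H \<Longrightarrow> b' (shift G h x) = b' (shift G h y)\<close> Hs i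
      by (intro restrict_ext) (simp add: shift_s)
  qed
  have E_dep: "depends_on Kw (\<lambda>x. x \<in> E e)" if e: "e \<in> I" for e
    unfolding depends_on_def
  proof (intro conjI Kw ballI impI)
    fix x y assume xy: "x \<in> \<Omega>" "y \<in> \<Omega>" "\<forall>k\<in>Kw. x k = y k"
    have "b' (shift G h x) = b' (shift G h y)" if h: "h \<in> H" for h
    proof (rule depends_onD[OF b'(1)])
      have hc: "h \<in> carrier G" using h H by auto
      show "shift G h x \<in> \<Omega>" "shift G h y \<in> \<Omega>" using xy shift_in[OF hc] by auto
      fix k assume k: "k \<in> K"
      then have "k \<otimes> h \<in> Kw" "k \<in> carrier G" using h b'(1) by (auto simp: Kw_def depends_on_def)
      then show "shift G h x k = shift G h y k" using xy(3) by (simp add: shift_apply)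
    qed
    from label'_cong[of x y, OF this] xy show "x \<in> E e \<longleftrightarrow> y \<in> E e"
      using e by (auto simp: E_def I_def Kw_def)
  qed
  have E_sub: "E e \<subseteq> \<Omega>" for e by (auto simp: E_def split: option.splits sum.splits prod.splits)
  have E_ev: "E e \<in> events" if "e \<in> I" for e
    using local_event_sets[OF E_dep[OF that] E_sub] by (simp add: sets_\<nu>)
  have true_label: "label' x = label x \<and> guess x = \<psi> (\<lambda>g\<in>R. b (shift G g x)) \<and>
      (\<forall>i<m. label' (shift G (s i) x) = label (shift G (s i) x))" if x: "x \<in> \<Omega> - Bad" for x
  proof (intro conjI allI impI)
    show "label' x = label x" unfolding label'_def label_def using off_Bad[OF x] H by (intro restrict_ext) auto
    show "guess x = \<psi> (\<lambda>g\<in>R. b (shift G g x))"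
      unfolding guess_def using off_Bad[OF x] H by (intro arg_cong[where f = \<psi>] restrict_ext) auto
    fix i assume i: "i < m"
    show "label' (shift G (s i) x) = label (shift G (s i) x)"
      unfolding label'_def label_def
    proof (rule restrict_ext)
      fix g assume g: "g \<in> C"
      then have "b (shift G g (shift G (s i) x)) = b (shift G (g \<otimes> s i) x)"
        using C i gen_closed by (subst shift_shift) auto
      then show "b' (shift G g (shift G (s i) x)) = b (shift G g (shift G (s i) x))"
        using off_Bad[OF x Hs[OF g i]] shift_s[OF g i] by simp
    qed
  qed
  have pr_label: "\<bar>prob (E (Some (Inl l))) - label_dist l\<bar> \<le> \<epsilon>1" if l: "l \<in> labels" for l
  proof -
    have "\<bar>prob (E (Some (Inl l))) - prob {x\<in>\<Omega>. label x = l}\<bar> \<le> prob Bad"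
      using E_ev[of "Some (Inl l)"] l label_event Bad(1) true_label
      by (intro prob_close) (auto simp: I_def E_def space_\<nu>)
    then show ?thesis using Bad(2) by (simp add: label_dist_def)
  qed
  have pr_edge: "\<bar>prob (E (Some (Inr (i, ll)))) - edge_dist i ll\<bar> \<le> \<epsilon>1" if i: "i < m" and ll: "ll \<in> labels \<times> labels" for i ll
  proof -
    have "\<bar>prob (E (Some (Inr (i, ll)))) - prob {x\<in>\<Omega>. (label x, label (shift G (s i) x)) = ll}\<bar> \<le> prob Bad"
      using E_ev[of "Some (Inr (i, ll))"] i ll edge_event[OF i] Bad(1) true_label
      by (intro prob_close) (auto simp: I_def E_def space_\<nu>)
    then show ?thesis using Bad(2) by (simp add: edge_dist_def)
  qed
  have pr_guess: "prob (E None) \<le> \<delta> / 2"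
  proof -
    have "E None \<subseteq> N2 \<union> Bad"
    proof
      fix x assume x: "x \<in> E None"
      show "x \<in> N2 \<union> Bad"
      proof (rule ccontr)
        assume "x \<notin> N2 \<union> Bad"
        with x \<psi> true_label[of x] show False by (auto simp: E_def)
      qed
    qed
    then have "prob (E None) \<le> prob (N2 \<union> Bad)" using N2 Bad by (intro finite_measure_mono) auto
    also have "\<dots> \<le> prob N2 + prob Bad" using N2 Bad by (intro measure_Un_le) auto
    also have "\<dots> \<le> \<delta> / 2" using N2(2) Bad(2) by (simp add: \<epsilon>1_def)
    finally show ?thesis .
  qed
  have "\<exists>M \<theta> n0. finite M \<and> M \<subseteq> carrier G \<and> 0 < \<theta> \<and> (\<forall>(V :: nat set) a. finite V \<longrightarrow> acts V a \<longrightarrow> card V \<ge> n0 \<longrightarrow>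
     real (card {v\<in>V. \<not> inj_on (\<lambda>g. a g v) M}) \<le> \<theta> * real (card V) \<longrightarrow>
     (1 + exp (- 2 * B * real (card D))) ^ card V \<le>
     2 * real (card {x\<in>confs V. \<forall>e\<in>I. \<bar>real (card {v\<in>V. pull a x v \<in> E e}) - real (card V) * prob (E e)\<bar> \<le> \<epsilon>1 * real (card V)}))"
    by (rule many_typical_configurations[OF unique borel_prob_\<nu> A2 finI E_dep E_sub \<epsilon>1 B])
  then obtain M \<theta> n2 where M: "finite M" "M \<subseteq> carrier G" and \<theta>: "0 < \<theta>"
    and typical: "\<forall>(V :: nat set) a. finite V \<longrightarrow> acts V a \<longrightarrow> card V \<ge> n2 \<longrightarrow>
     real (card {v\<in>V. \<not> inj_on (\<lambda>g. a g v) M}) \<le> \<theta> * real (card V) \<longrightarrow>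
     (1 + exp (- 2 * B * real (card D))) ^ card V \<le>
     2 * real (card {x\<in>confs V. \<forall>e\<in>I. \<bar>real (card {v\<in>V. pull a x v \<in> E e}) - real (card V) * prob (E e)\<bar> \<le> \<epsilon>1 * real (card V)})"
    by (elim exE conjE)
  obtain n3 where n3: "\<forall>n\<ge>n3. fact n ^ m \<le> 2 * card {\<sigma> \<in> perm_tuples m {..<n::nat}.
       card {v\<in>{..<n}. \<not> inj_on (\<lambda>g. act \<sigma> g v) M} \<le> \<theta> * real n}"
    using few_bad_vertices[OF M \<theta>] by (elim exE)
  obtain n4 :: nat where n4: "real n4 > 8 / c" using reals_Archimedean2 by blast
  \<comment> \<open>\<open>n4 > 8 / c\<close> makes \<open>exp (c n / 4) > exp 2 > 4\<close> in the last step.\<close>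
  define n where "n = n1 + n2 + n3 + n4"
  define V where "V = {..<n}"
  have V: "finite V" "card V = n" by (simp_all add: V_def)
  define good where "good = {\<sigma> \<in> perm_tuples m V. card {v\<in>V. \<not> inj_on (\<lambda>g. act \<sigma> g v) M} \<le> \<theta> * real n}"
  define T where "T \<sigma> = {x\<in>confs V. \<forall>e\<in>I. \<bar>real (card {v\<in>V. pull (act \<sigma>) x v \<in> E e}) - real (card V) * prob (E e)\<bar> \<le> \<epsilon>1 * real (card V)}" for \<sigma>
  define Y where "Y \<sigma> x = (\<lambda>v\<in>V. label' (pull (act \<sigma>) x v))" for \<sigma> x
  have good_many: "fact n ^ m \<le> 2 * real (card good)"
  proof -
    have "n \<ge> n3" by (simp add: n_def)
    then have "fact n ^ m \<le> 2 * card good" using n3 unfolding good_def V_def by blast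
    from of_nat_mono[OF this, where ?'a = real] show ?thesis by simp
  qed
  have fin_good: "finite good" using finite_perm_tuples[OF V(1)] by (simp add: good_def)
  have finT: "finite (T \<sigma>)" for \<sigma> using finite_confs[OF V(1)] by (simp add: T_def)
  have T_large: "exp (c * real n) \<le> 2 * real (card (T \<sigma>))" if \<sigma>: "\<sigma> \<in> good" for \<sigma>
  proof -
    have a: "acts V (act \<sigma>)" using \<sigma> by (intro acts_act) (simp add: good_def)
    have "(1 + exp (- 2 * B * real (card D))) ^ card V \<le> 2 * real (card (T \<sigma>))"
      unfolding T_def using \<sigma> V by (intro typical[rule_format] a) (auto simp: good_def n_def)
    moreover have "(1 + exp (- 2 * B * real (card D))) ^ card V = exp (c * real n)"
    proof -
      have "exp c = 1 + exp (- 2 * B * real (card D))" unfolding c_def by (rule exp_ln) (simp add: add_pos_pos)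
      then show ?thesis using V(2) by (simp add: exp_of_nat2_mult)
    qed
    ultimately show ?thesis by simp
  qed
  have pull\<Omega>: "pull (act \<sigma>) x v \<in> \<Omega>" if "\<sigma> \<in> good" "x \<in> T \<sigma>" "v \<in> V" for \<sigma> x v
    using that by (intro pull_in[OF acts_act]) (auto simp: good_def T_def)
  have label'_in: "label' \<xi> \<in> labels" for \<xi> using b'(2) by (auto simp: label'_def labels_def)
  have Y_S: "(Y \<sigma> x, \<sigma>) \<in> ?S V \<epsilon>c" if \<sigma>: "\<sigma> \<in> good" and x: "x \<in> T \<sigma>" for \<sigma> x
  proof -
    have \<sigma>p: "\<sigma> \<in> perm_tuples m V" using \<sigma> by (simp add: good_def)
    note a = acts_act[OF \<sigma>p]
    have emp: "\<bar>real (card {v\<in>V. pull (act \<sigma>) x v \<in> E e}) - real n * q\<bar> \<le> \<epsilon>c * real n"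
      if "e \<in> I" "\<bar>prob (E e) - q\<bar> \<le> \<epsilon>1" for e q
    proof -
      have "\<bar>real (card {v\<in>V. pull (act \<sigma>) x v \<in> E e}) - real n * prob (E e)\<bar> \<le> \<epsilon>1 * real n"
        using x that(1) V by (auto simp: T_def)
      moreover have "\<bar>real n * prob (E e) - real n * q\<bar> \<le> \<epsilon>1 * real n"
      proof -
        have "\<bar>real n * prob (E e) - real n * q\<bar> = real n * \<bar>prob (E e) - q\<bar>"
          by (simp add: abs_mult right_diff_distrib[symmetric])
        also have "\<dots> \<le> real n * \<epsilon>1" using that(2) by (rule mult_left_mono) simp
        finally show ?thesis by (simp add: mult.commute)
      qed
      moreover have "\<epsilon>1 * real n + \<epsilon>1 * real n \<le> \<epsilon>c * real n"
        unfolding distrib_right[symmetric] by (intro mult_right_mono) (auto simp: \<epsilon>1_def)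
      ultimately show ?thesis by linarith
    qed
    have "near_type V labels label_dist \<epsilon>c (Y \<sigma> x)"
      unfolding near_type_def V(2)
    proof
      fix l assume l: "l \<in> labels"
      have "{v\<in>V. Y \<sigma> x v = l} = {v\<in>V. pull (act \<sigma>) x v \<in> E (Some (Inl l))}"
        using pull\<Omega>[OF \<sigma> x] by (auto simp: Y_def E_def)
      then show "\<bar>real (card {v\<in>V. Y \<sigma> x v = l}) - real n * label_dist l\<bar> \<le> \<epsilon>c * real n"
        using emp[OF _ pr_label[OF l]] l by (simp add: I_def)
    qed
    moreover have "near_type V (labels \<times> labels) (edge_dist i) \<epsilon>c (\<lambda>v. (Y \<sigma> x v, Y \<sigma> x (\<sigma> i v)))" if i: "i < m" for i
      unfolding near_type_def V(2)
    proof
      fix ll assume ll: "ll \<in> labels \<times> labels"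
      have "(Y \<sigma> x v, Y \<sigma> x (\<sigma> i v)) = (label' (pull (act \<sigma>) x v), label' (shift G (s i) (pull (act \<sigma>) x v)))"
        if v: "v \<in> V" for v
      proof -
        have "\<sigma> i v \<in> V" using acts_in[OF a gen_closed[OF i] v] act_gen[OF \<sigma>p i] by simp
        then show ?thesis using v shift_pull[OF a gen_closed[OF i] v, of x] act_gen[OF \<sigma>p i] by (simp add: Y_def)
      qed
      then have "{v\<in>V. (Y \<sigma> x v, Y \<sigma> x (\<sigma> i v)) = ll} = {v\<in>V. pull (act \<sigma>) x v \<in> E (Some (Inr (i, ll)))}"
        using pull\<Omega>[OF \<sigma> x] by (auto simp: E_def)
      then show "\<bar>real (card {v\<in>V. (Y \<sigma> x v, Y \<sigma> x (\<sigma> i v)) = ll}) - real n * edge_dist i ll\<bar> \<le> \<epsilon>c * real n"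
        using emp[OF _ pr_edge[OF i ll]] i ll by (simp add: I_def)
    qed
    moreover have "Y \<sigma> x \<in> V \<rightarrow>\<^sub>E labels" using label'_in by (simp add: Y_def)
    ultimately show ?thesis using \<sigma>p by blast
  qed
  have fibre: "real (card {x\<in>T \<sigma>. Y \<sigma> x = y}) \<le> exp (c / 8 * real n)" if \<sigma>: "\<sigma> \<in> good" for \<sigma> y
  proof -
    have \<sigma>p: "\<sigma> \<in> perm_tuples m V" using \<sigma> by (simp add: good_def)
    note a = acts_act[OF \<sigma>p]
    \<comment> \<open>The configuration reconstructed from the labelling alone. The label at a point contains the atom
      of the point itself, because the identity belongs to \<open>C\<close>.\<close>
    define x' where "x' v = \<psi> (\<lambda>g\<in>R. y (act \<sigma> g v) \<one>)" for v
    have "{x\<in>T \<sigma>. Y \<sigma> x = y} \<subseteq> {x\<in>confs V. real (hamming V x' x) \<le> \<delta> * real (card V)}"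
    proof clarify
      fix x assume x: "x \<in> T \<sigma>" and y: "y = Y \<sigma> x"
      have "x' v = guess (pull (act \<sigma>) x v)" if v: "v \<in> V" for v
        unfolding x'_def guess_def
      proof (intro arg_cong[where f = \<psi>] restrict_ext)
        fix g assume g: "g \<in> R"
        then have gc: "g \<in> carrier G" using R by auto
        have gv: "act \<sigma> g v \<in> V" by (rule acts_in[OF a gc v])
        have "Y \<sigma> x (act \<sigma> g v) \<one> = b' (shift G \<one> (pull (act \<sigma>) x (act \<sigma> g v)))"
          using gv C(3) by (simp add: Y_def label'_def)
        also have "\<dots> = b' (shift G g (pull (act \<sigma>) x v))"
          using shift_one[OF pull\<Omega>[OF \<sigma> x gv]] shift_pull[OF a gc v] by simp
        finally show "y (act \<sigma> g v) \<one> = b' (shift G g (pull (act \<sigma>) x v))" by (simp add: y)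
      qed
      moreover have "pull (act \<sigma>) x v \<one> = x v" if "v \<in> V" for v
        using acts_one[OF a that] by (simp add: pull_apply)
      moreover have "E None = {x\<in>\<Omega>. x \<one> \<noteq> guess x}" by (simp add: E_def)
      ultimately have "pull (act \<sigma>) x v \<in> E None \<longleftrightarrow> x' v \<noteq> x v" if "v \<in> V" for v
        using pull\<Omega>[OF \<sigma> x that] that by (simp only: mem_Collect_eq) metis
      then have "{v\<in>V. x' v \<noteq> x v} = {v\<in>V. pull (act \<sigma>) x v \<in> E None}" by blast
      then have "real (hamming V x' x) = real (card {v\<in>V. pull (act \<sigma>) x v \<in> E None})" by (simp add: hamming_def)
      also have "\<dots> \<le> real n * prob (E None) + \<epsilon>1 * real n"
      proof -
        have "\<bar>real (card {v\<in>V. pull (act \<sigma>) x v \<in> E None}) - real (card V) * prob (E None)\<bar> \<le> \<epsilon>1 * real (card V)"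
          using x by (simp add: T_def I_def)
        then show ?thesis unfolding V(2) by linarith
      qed
      also have "\<dots> \<le> real n * (\<delta> / 2) + \<delta> / 2 * real n"
        using pr_guess \<delta>(1) by (intro add_mono mult_left_mono mult_right_mono) (auto simp: \<epsilon>1_def)
      also have "\<dots> = \<delta> * real (card V)" by (simp add: V(2))
      finally show "x \<in> confs V \<and> real (hamming V x' x) \<le> \<delta> * real (card V)" using x by (simp add: T_def)
    qed
    then have "card {x\<in>T \<sigma>. Y \<sigma> x = y} \<le> card {x\<in>confs V. real (hamming V x' x) \<le> \<delta> * real (card V)}"
      using finite_confs[OF V(1)] by (intro card_mono) auto
    then have "real (card {x\<in>T \<sigma>. Y \<sigma> x = y}) \<le> real (card {x\<in>confs V. real (hamming V x' x) \<le> \<delta> * real (card V)})"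
      by (rule of_nat_mono)
    also have "\<dots> \<le> exp (c / 8 * real n)" using \<delta>(2)[rule_format, OF V(1), of x'] V(2) by simp
    finally show ?thesis .
  qed
  have image_large: "exp (7 * c / 8 * real n) \<le> 2 * real (card (Y \<sigma> ` T \<sigma>))" if \<sigma>: "\<sigma> \<in> good" for \<sigma>
  proof -
    have "real (card (T \<sigma>)) = (\<Sum>x\<in>T \<sigma>. 1)" by simp
    also have "\<dots> = (\<Sum>y\<in>Y \<sigma> ` T \<sigma>. \<Sum>x\<in>{x\<in>T \<sigma>. Y \<sigma> x = y}. 1)" by (rule sum.image_gen[OF finT])
    also have "\<dots> = (\<Sum>y\<in>Y \<sigma> ` T \<sigma>. real (card {x\<in>T \<sigma>. Y \<sigma> x = y}))" by simp
    also have "\<dots> \<le> (\<Sum>y\<in>Y \<sigma> ` T \<sigma>. exp (c / 8 * real n))" by (intro sum_mono fibre[OF \<sigma>])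
    finally have "real (card (T \<sigma>)) \<le> real (card (Y \<sigma> ` T \<sigma>)) * exp (c / 8 * real n)" by simp
    with T_large[OF \<sigma>] have "exp (c * real n) \<le> 2 * real (card (Y \<sigma> ` T \<sigma>)) * exp (c / 8 * real n)" by linarith
    moreover have "exp (c * real n) = exp (7 * c / 8 * real n) * exp (c / 8 * real n)"
      by (simp add: exp_add[symmetric] algebra_simps)
    ultimately show ?thesis by (simp only: mult_le_cancel_right_pos exp_gt_zero)
  qed
  have "(SIGMA \<sigma>:good. Y \<sigma> ` T \<sigma>) \<subseteq> (\<lambda>(y, \<sigma>). (\<sigma>, y)) ` ?S V \<epsilon>c"
  proof (rule subsetI)
    fix p assume "p \<in> (SIGMA \<sigma>:good. Y \<sigma> ` T \<sigma>)"
    then obtain \<sigma> x where p: "p = (\<sigma>, Y \<sigma> x)" "\<sigma> \<in> good" "x \<in> T \<sigma>" by auto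
    show "p \<in> (\<lambda>(y, \<sigma>). (\<sigma>, y)) ` ?S V \<epsilon>c"
      by (rule image_eqI[OF _ Y_S[OF p(2,3)]]) (simp add: p(1))
  qed
  moreover have finS: "finite (?S V \<epsilon>c)"
    by (rule finite_subset[of _ "(V \<rightarrow>\<^sub>E labels) \<times> perm_tuples m V"])
       (use V finite_labels finite_perm_tuples[OF V(1)] in \<open>auto intro!: finite_PiE\<close>)
  ultimately have "card (SIGMA \<sigma>:good. Y \<sigma> ` T \<sigma>) \<le> card (?S V \<epsilon>c)"
    by (rule surj_card_le[rotated])
  then have "(\<Sum>\<sigma>\<in>good. card (Y \<sigma> ` T \<sigma>)) \<le> card (?S V \<epsilon>c)"
    using fin_good finT by (subst (asm) card_SigmaI) auto
  then have "real (\<Sum>\<sigma>\<in>good. card (Y \<sigma> ` T \<sigma>)) \<le> real (card (?S V \<epsilon>c))" by (rule of_nat_mono)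
  then have lower: "(\<Sum>\<sigma>\<in>good. real (card (Y \<sigma> ` T \<sigma>))) \<le> real (card (?S V \<epsilon>c))" by (simp only: of_nat_sum)
  have "fact n ^ m * exp (7 * c / 8 * real n) \<le> 2 * real (card good) * exp (7 * c / 8 * real n)"
    using good_many by (rule mult_right_mono) simp
  also have "\<dots> = 2 * (\<Sum>\<sigma>\<in>good. exp (7 * c / 8 * real n))" by simp
  also have "\<dots> \<le> 2 * (\<Sum>\<sigma>\<in>good. 2 * real (card (Y \<sigma> ` T \<sigma>)))"
    by (intro mult_left_mono sum_mono image_large) auto
  also have "\<dots> = 4 * (\<Sum>\<sigma>\<in>good. real (card (Y \<sigma> ` T \<sigma>)))" by (simp add: sum_distrib_left)
  also have "\<dots> \<le> 4 * (fact n ^ m * exp (real n * (?F + (real m + 1) * \<eta>)))"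
  proof -
    have "real (card (?S V \<epsilon>c)) \<le> fact (card V) ^ m * exp (real (card V) * (?F + (real m + 1) * \<eta>))"
      using V by (intro S_le[rule_format]) (simp_all add: n_def)
    then show ?thesis using lower V(2) by simp
  qed
  also have "\<dots> \<le> 4 * (fact n ^ m * exp (5 * c / 8 * real n))"
  proof -
    have "?F + (real m + 1) * \<eta> \<le> 5 * c / 8" using F \<eta>(2) by simp
    then have "real n * (?F + (real m + 1) * \<eta>) \<le> real n * (5 * c / 8)" by (rule mult_left_mono) simp
    then show ?thesis by (simp add: mult.commute)
  qed
  finally have "fact n ^ m * exp (7 * c / 8 * real n) \<le> fact n ^ m * (4 * exp (5 * c / 8 * real n))"
    by (simp only: ac_simps)
  then have "exp (7 * c / 8 * real n) \<le> 4 * exp (5 * c / 8 * real n)"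
    by (subst (asm) mult_le_cancel_left_pos) simp_all
  moreover have "exp (7 * c / 8 * real n) = exp (c / 4 * real n) * exp (5 * c / 8 * real n)"
    by (simp add: exp_add[symmetric] algebra_simps)
  ultimately have "exp (c / 4 * real n) \<le> 4" by (simp only: mult_le_cancel_right_pos exp_gt_zero)
  moreover have "2 < c / 4 * real n"
  proof -
    have "8 / c < real n" using n4 by (simp add: n_def)
    then show ?thesis using c by (simp add: field_simps)
  qed
  then have "1 + 2 + 2\<^sup>2 / 2 < exp (c / 4 * real n)"
    using exp_lower_Taylor_quadratic[of "2::real"] by (metis exp_less_cancel_iff le_less_trans less_eq_real_def numeral_eq_iff order_le_less_trans zero_le_numeral)
  ultimately show False by simp
qed

end

theorem theorem1p5:
  fixes G :: "('g, 'b) monoid_scheme"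
    and m :: nat
    and s :: "nat \<Rightarrow> 'g"
    and A :: "'a set"
    and D :: "'g set"
    and \<phi> :: "('g \<Rightarrow> 'a) \<Rightarrow> real"
    and \<nu> :: "('g \<Rightarrow> 'a) measure"
    and \<beta> :: "('g \<Rightarrow> 'a) set set"
  assumes "group G"
    and "m \<ge> 1"
    and "free_generators G m s"
    and "finite A"
    and "card A \<ge> 2"
    and "potential G A D \<phi>"
    and "gibbs_measure G A D \<phi> \<nu>"
    and "shift_invariant G \<nu>"
    and "finite_partition \<nu> \<beta>"
    and "generating G \<nu> (shift G) \<beta>"
    and "f_invariant G m s \<nu> (shift G) \<beta> \<le> 0"
  shows "\<exists>\<nu>\<^sub>1 \<nu>\<^sub>2. gibbs_measure G A D \<phi> \<nu>\<^sub>1 \<and> gibbs_measure G A D \<phi> \<nu>\<^sub>2 \<and> \<nu>\<^sub>1 \<noteq> \<nu>\<^sub>2"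
proof (rule ccontr)
  assume "\<not> ?thesis"
  then have unique: "\<mu> = \<nu>" if "gibbs_measure G A D \<phi> \<mu>" for \<mu> using that assms(7) by blast
  have ne: "A \<noteq> {}" using assms(5) by auto
  interpret free_group_potential G m s A D \<phi>
    by (intro free_group_potential.intro free_group.intro free_group_axioms.intro lattice_potential.intro
        lattice_potential_axioms.intro configurations.intro configurations_axioms.intro assms ne)
  have \<nu>: "prob_space \<nu>" "sets \<nu> = sets (config_space G A)"
    using assms(7) by (auto simp: gibbs_measure_def borel_prob_def)
  obtain B where B: "\<And>x. x \<in> \<Omega> \<Longrightarrow> \<bar>\<phi> x\<bar> \<le> B" using \<phi>_bounded by blast
  define c where "c = ln (1 + exp (- 2 * B * real (card D)))"
  have c: "c > 0" unfolding c_def by (rule ln_gt_zero) simp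
  have "ereal (c / 2) \<le> f_invariant G m s \<nu> (shift G) \<beta>"
    unfolding f_invariant_def Let_def
  proof (rule INF_greatest)
    fix r
    interpret invariant_partition G m s A D \<phi> \<nu> \<beta> "word_ball G m s r"
      by (intro invariant_partition.intro free_group_potential_axioms \<nu> invariant_partition_axioms.intro
          assms finite_word_ball word_ball_sub one_in_word_ball)
    show "ereal (c / 2) \<le> ereal ((1 - 2 * real m) * shannon_entropy \<nu> (iterated_partition \<nu> (shift G) (word_ball G m s r) \<beta>) +
       (\<Sum>i<m. shannon_entropy \<nu> (common_refinement {iterated_partition \<nu> (shift G) (word_ball G m s r) \<beta>,
          translate_partition \<nu> (shift G) (s i) (iterated_partition \<nu> (shift G) (word_ball G m s r) \<beta>)})))"
      using level_entropy_lower_bound[OF unique assms(5) B assms(10)]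
      by (simp add: vertex_entropy edge_entropy c_def)
  qed
  then have "ereal (c / 2) \<le> 0" using assms(11) by (rule order_trans)
  then show False using c by (simp add: zero_ereal_def)
qed

end
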